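(* Let $(\mathbf{X}^{(n)})_{n\in\mathbb{N}}$ be a sequence of random graphs with $\mathbf{X}^{(n)}\sim\mathrm{LERGM}(\beta^\star)$, $\beta^\star=(\beta_W^\star,\beta_B^\star)\in\mathbb{R}^{d_1}\times\mathbb{R}^{d_2}$, as described in the context. Suppose that the following five assumptions hold. (A1) With $R_W,R_B>0$ independent of $n$, $B_W=\{\beta_W\in\mathbb{R}^{d_1}:\|\beta_W\|\le R_W\}$ and $B_B=\{\beta_B\in\mathbb{R}^{d_2}:\|\beta_B\|\le R_B\}$, the points $\beta_W^\star$ and $\beta_B^\star$ lie in the interior of $B_W$ and $B_B$, respectively. (A2) There exist constants $L_W,L_B,C_W,C_B\ge 0$ independent of $n$ such that $\|\Delta_m s^{(n)}_{k,k}(x_{k,k})\|\le L_W M_n^{C_W}$ for all $n\in\mathbb{N}$, $1\le k\le K_n$, $x_{k,k}\in\mathbb{X}^{(n)}_{k,k}$, $m\in E^{(n)}_{k,k}$, and $\|\Delta_m s^{(n)}_{k,l}(x_{k,l})\|\le L_B M_n^{C_B}$ for all $n\in\mathbb{N}$, $1\le k<l\le K_n$, $x_{k,l}\in\mathbb{X}^{(n)}_{k,l}$, $m\in E^{(n)}_{k,l}$. (A3) There exist $\xi_W,\xi_B>0$ independent of $n$ such that for all $n\in\mathbb{N}$ $$\min_{1\le k\le K_n}\lambda_{\min}\Big(\sum_{m\in E^{(n)}_{k,k}}\mathbb{E}\big[\Delta_m s^{(n)}_{k,k}(\mathbf{X}^{(n)}_{k,k})\,\Delta_m s^{(n)}_{k,k}(\mathbf{X}^{(n)}_{k,k})^\top\big]\Big)\ge\xi_W,$$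 $$\min_{1\le k<l\le K_n}\lambda_{\min}\Big(\sum_{m\in E^{(n)}_{k,l}}\mathbb{E}\big[\Delta_m s^{(n)}_{k,l}(\mathbf{X}^{(n)}_{k,l})\,\Delta_m s^{(n)}_{k,l}(\mathbf{X}^{(n)}_{k,l})^\top\big]\Big)\ge\xi_B.$$ (A4) There exist $\zeta_W,\zeta_B>0$ independent of $n$ such that $\Upsilon_W^{(n)}\ge\zeta_W$ and $\Upsilon_B^{(n)}\ge\zeta_B$ for all $n\in\mathbb{N}$. (A5) For the Stein estimator $(\hat\beta_W^{(n)},\hat\beta_B^{(n)})$, where $\hat\beta_W^{(n)}\in\operatorname{argmin}_{\beta_W\in B_W}G_W^{(n)}(\mathbf{X}^{(n)},\beta_W)$ and $\hat\beta_B^{(n)}\in\operatorname{argmin}_{\beta_B\in B_B}G_B^{(n)}(\mathbf{X}^{(n)},\beta_B)$, the random vectors $$\mathbb{E}[g_W^{(n)}(\mathbf{X}^{(n)},\beta_W^\star)g_W^{(n)}(\mathbf{X}^{(n)},\beta_W^\star)^\top]^{-1/2}g_W^{(n)}(\mathbf{X}^{(n)},\hat\beta_W^{(n)})$$ and $$\mathbb{E}[g_B^{(n)}(\mathbf{X}^{(n)},\beta_B^\star)g_B^{(n)}(\mathbf{X}^{(n)},\beta_B^\star)^\top]^{-1/2}g_B^{(n)}(\mathbf{X}^{(n)},\hat\beta_B^{(n)})$$ converge to $0$ in probability as $n\to\infty$. If $$\frac{1}{\sqrt{K_n}}\exp\big(2R_WL_WM_n^{C_W}\big)M_n^{14+5C_W}\to0\quad\text{and}\quad\frac{1}{\sqrt{K_n}}\exp\big(2R_BL_BM_n^{C_B}\big)M_n^{14+5C_B}\to0$$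 as $n\to\infty$, then $$Q_W^{(n)}\big(\hat\beta_W^{(n)}-\beta_W^\star\big)\xrightarrow{D}N(0,I_{d_1})\quad\text{and}\quad Q_B^{(n)}\big(\hat\beta_B^{(n)}-\beta_B^\star\big)\xrightarrow{D}N(0,I_{d_2})$$ as $n\to\infty$, where $\xrightarrow{D}$ denotes convergence in distribution.
   Context: Notation. $\|\cdot\|$ is the Euclidean norm, $\langle\cdot,\cdot\rangle$ the standard scalar product, $\lambda_{\min}$ the smallest eigenvalue, $\sigma(t)=1/(1+e^{-t})$, $\Sigma(t)=\log(1+e^t)$. For each $n\in\mathbb{N}$, a finite vertex set $A^{(n)}$ is partitioned into $K_n$ nonempty blocks $A_1^{(n)},\dots,A_{K_n}^{(n)}$, and $M_n=\max_k|A_k^{(n)}|$. $E^{(n)}_{k,k}$ is the set of unordered pairs of distinct vertices of $A^{(n)}_k$; for $k<l$, $E^{(n)}_{k,l}$ is the set of pairs $(u,v)$ with $u\in A^{(n)}_k$, $v\in A^{(n)}_l$. $\mathbb{X}^{(n)}_{k,l}=\{0,1\}^{E^{(n)}_{k,l}}$, and $\mathbb{X}^{(n)}=\prod_{1\le k\le l\le K_n}\mathbb{X}^{(n)}_{k,l}$ is the set of simple undirected graphs on $A^{(n)}$; $x=(x_{k,l})_{k\le l}$. For $m\in E^{(n)}_{k,l}$, $\Diamond_m^1x_{k,l}$ (resp. $\Diamond_m^0x_{k,l}$) is $x_{k,l}$ with the indicator of edge $m$ set to $1$ (resp. $0$), and $\Delta_mf(x_{k,l})=f(\Diamond_m^1x_{k,l})-f(\Diamond_m^0x_{k,l})$.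 Statistics $s^{(n)}_{k,k}:\mathbb{X}^{(n)}_{k,k}\to\mathbb{R}^{d_1}$ and $s^{(n)}_{k,l}:\mathbb{X}^{(n)}_{k,l}\to\mathbb{R}^{d_2}$ ($k<l$) are given; $d_1,d_2$ and $\beta^\star$ do not depend on $n$, everything else may. $\mathbf{X}^{(n)}\sim\mathrm{LERGM}(\beta^\star)$ means that $\mathbf{X}^{(n)}$ is a random element of $\mathbb{X}^{(n)}$ with probability mass function $$p^{(n)}(x)\propto\exp\Big(\sum_{1\le k\le K_n}\langle\beta_W^\star,s^{(n)}_{k,k}(x_{k,k})\rangle+\sum_{1\le k<l\le K_n}\langle\beta_B^\star,s^{(n)}_{k,l}(x_{k,l})\rangle\Big).$$ $\mathbf{X}^{(n)}_{k,l}$ denotes the $(k,l)$-subgraph of $\mathbf{X}^{(n)}$. No assumption is made on the joint distribution of the $\mathbf{X}^{(n)}$ for different $n$. For $k\le l$ and $\beta_\bullet=\beta_W$ if $k=l$, $\beta_\bullet=\beta_B$ if $k<l$, put $$h^{(n)}_{k,l}(x_{k,l},\beta_\bullet)=\sum_{m\in E^{(n)}_{k,l}}\big(\sigma(\langle\beta_\bullet,\Delta_ms^{(n)}_{k,l}(x_{k,l})\rangle)\Delta_ms^{(n)}_{k,l}(x_{k,l})+s^{(n)}_{k,l}(\Diamond_m^0x_{k,l})-s^{(n)}_{k,l}(x_{k,l})\big).$$ Then $g_W^{(n)}(x,\beta_W)=\sum_{1\le k\le K_n}h^{(n)}_{k,k}(x_{k,k},\beta_W)$ and $g_B^{(n)}(x,\beta_B)=\sum_{1\le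 k<l\le K_n}h^{(n)}_{k,l}(x_{k,l},\beta_B)$. These are the gradients in $\beta_W$, $\beta_B$ of $$G_W^{(n)}(x,\beta_W)=\sum_{1\le k\le K_n}\sum_{m\in E^{(n)}_{k,k}}\big(\Sigma(\langle\beta_W,\Delta_ms^{(n)}_{k,k}(x_{k,k})\rangle)+\langle\beta_W,s^{(n)}_{k,k}(\Diamond_m^0x_{k,k})-s^{(n)}_{k,k}(x_{k,k})\rangle\big),$$ $$G_B^{(n)}(x,\beta_B)=\sum_{1\le k<l\le K_n}\sum_{m\in E^{(n)}_{k,l}}\big(\Sigma(\langle\beta_B,\Delta_ms^{(n)}_{k,l}(x_{k,l})\rangle)+\langle\beta_B,s^{(n)}_{k,l}(\Diamond_m^0x_{k,l})-s^{(n)}_{k,l}(x_{k,l})\rangle\big),$$ and the corresponding Hessians are $$\mathcal{G}_W^{(n)}(x,\beta_W)=\sum_{1\le k\le K_n}\sum_{m\in E^{(n)}_{k,k}}\sigma'(\langle\beta_W,\Delta_ms^{(n)}_{k,k}(x_{k,k})\rangle)\Delta_ms^{(n)}_{k,k}(x_{k,k})\Delta_ms^{(n)}_{k,k}(x_{k,k})^\top,$$ $$\mathcal{G}_B^{(n)}(x,\beta_B)=\sum_{1\le k<l\le K_n}\sum_{m\in E^{(n)}_{k,l}}\sigma'(\langle\beta_B,\Delta_ms^{(n)}_{k,l}(x_{k,l})\rangle)\Delta_ms^{(n)}_{k,l}(x_{k,l})\Delta_ms^{(n)}_{k,l}(x_{k,l})^\top.$$ If minimisers in the definition of the Stein estimator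 are not unique, one is picked by an arbitrary deterministic rule. Standardising matrices: for $\bullet\in\{W,B\}$, $$Q_\bullet^{(n)}=\mathbb{E}\big[g_\bullet^{(n)}(\mathbf{X}^{(n)},\beta_\bullet^\star)g_\bullet^{(n)}(\mathbf{X}^{(n)},\beta_\bullet^\star)^\top\big]^{-1/2}\,\mathbb{E}\big[\mathcal{G}_\bullet^{(n)}(\mathbf{X}^{(n)},\beta_\bullet^\star)\big].$$ Smallest eigenvalues: $$\Upsilon_W^{(n)}=\min_{1\le k\le K_n}\lambda_{\min}\big(\mathbb{E}[h^{(n)}_{k,k}(\mathbf{X}^{(n)}_{k,k},\beta_W^\star)h^{(n)}_{k,k}(\mathbf{X}^{(n)}_{k,k},\beta_W^\star)^\top]\big),$$ $$\Upsilon_B^{(n)}=\min_{1\le k<l\le K_n}\lambda_{\min}\big(\mathbb{E}[h^{(n)}_{k,l}(\mathbf{X}^{(n)}_{k,l},\beta_B^\star)h^{(n)}_{k,l}(\mathbf{X}^{(n)}_{k,l},\beta_B^\star)^\top]\big).$$ A minimum over an empty index set is $+\infty$; between-block quantities such as $Q_B^{(n)}$ are considered for $K_n\ge2$, which holds for all large $n$ under the growth condition of the theorem. *)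

theory Defs
  imports "HOL-Probability.Probability"
begin

section \<open>Linear algebra\<close>

definition outer :: "real ^ 'd \<Rightarrow> real ^ 'd \<Rightarrow> real ^ 'd ^ 'd" where
  "outer v w = (\<chi> i j. v $ i * w $ j)"

text \<open>Only used for symmetric matrices, whose set of real eigenvalues is finite and nonempty.\<close>

definition lambda_min :: "real ^ 'd ^ 'd \<Rightarrow> real" where
  "lambda_min S = Min {c. \<exists>v. v \<noteq> 0 \<and> S *v v = c *\<^sub>R v}"

definition pos_semidef :: "real ^ 'd ^ 'd \<Rightarrow> bool" where
  "pos_semidef S \<longleftrightarrow> transpose S = S \<and> (\<forall>v. 0 \<le> v \<bullet> (S *v v))"

text \<open>
  The square root of a positive semidefinite matrix is its unique positive semidefinite root.
  \<open>inv_sqrt_matrix S\<close> is meaningful when \<open>S\<close> is positive definite.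
\<close>

definition sqrt_matrix :: "real ^ 'd ^ 'd \<Rightarrow> real ^ 'd ^ 'd" where
  "sqrt_matrix S = (THE T. pos_semidef T \<and> T ** T = S)"

definition inv_sqrt_matrix :: "real ^ 'd ^ 'd \<Rightarrow> real ^ 'd ^ 'd" where
  "inv_sqrt_matrix S = matrix_inv (sqrt_matrix S)"


section \<open>Modes of convergence\<close>

text \<open>
  The random vectors may live on different probability spaces, so nothing is said about
  their joint distribution.
\<close>

definition converges_in_probability ::
  "(nat \<Rightarrow> 'w measure) \<Rightarrow> (nat \<Rightarrow> 'w \<Rightarrow> 'b :: metric_space) \<Rightarrow> 'b \<Rightarrow> bool" where
  "converges_in_probability P Z c \<longleftrightarrow>
     (\<forall>\<epsilon>>0. (\<lambda>n. measure (P n) {\<omega> \<in> space (P n). dist (Z n \<omega>) c > \<epsilon>}) \<longlonglongrightarrow> 0)"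

definition converges_in_distribution ::
  "(nat \<Rightarrow> 'w measure) \<Rightarrow> (nat \<Rightarrow> 'w \<Rightarrow> 'b :: metric_space) \<Rightarrow> 'b measure \<Rightarrow> bool" where
  "converges_in_distribution P Z N \<longleftrightarrow>
     (\<forall>f :: 'b \<Rightarrow> real. continuous_on UNIV f \<longrightarrow> bounded (range f) \<longrightarrow>
        (\<lambda>n. \<integral>\<omega>. f (Z n \<omega>) \<partial>P n) \<longlonglongrightarrow> (\<integral>z. f z \<partial>N))"

definition std_normal_vector :: "(real ^ 'd) measure" where
  "std_normal_vector = density lborel (\<lambda>z. ennreal (\<Prod>i\<in>UNIV. std_normal_density (z $ i)))"


section \<open>Graphs with block structure\<close>

definition within_pairs :: "nat \<Rightarrow> (nat \<times> nat) set" where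
  "within_pairs K = {(k, l). 1 \<le> k \<and> k = l \<and> l \<le> K}"

definition between_pairs :: "nat \<Rightarrow> (nat \<times> nat) set" where
  "between_pairs K = {(k, l). 1 \<le> k \<and> k < l \<and> l \<le> K}"

definition block_pairs :: "nat \<Rightarrow> (nat \<times> nat) set" where
  "block_pairs K = {(k, l). 1 \<le> k \<and> k \<le> l \<and> l \<le> K}"

definition max_block_size :: "(nat \<Rightarrow> 'v set) \<Rightarrow> nat \<Rightarrow> nat" where
  "max_block_size A K = Max ((\<lambda>k. card (A k)) ` {1..K})"

text \<open>
  Potential edges between blocks \<open>k\<close> and \<open>l\<close>.  Also for \<open>k < l\<close> the pair \<open>(u, v)\<close> is written
  as the set \<open>{u, v}\<close>; since the blocks are disjoint this is a bijection, see below.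
\<close>

definition edges :: "(nat \<Rightarrow> 'v set) \<Rightarrow> nat \<times> nat \<Rightarrow> 'v set set" where
  "edges A = (\<lambda>(k, l). {{u, v} | u v. u \<in> A k \<and> v \<in> A l \<and> u \<noteq> v})"

lemma edges_diagonal: "edges A (k, k) = {e. e \<subseteq> A k \<and> card e = 2}"
  by (auto simp: edges_def card_2_iff)

lemma edges_off_diagonal:
  assumes "A k \<inter> A l = {}"
  shows "bij_betw (\<lambda>(u, v). {u, v}) (A k \<times> A l) (edges A (k, l))"
  using assms by (fastforce simp: bij_betw_def inj_on_def edges_def doubleton_eq_iff)

definition configs :: "'e set \<Rightarrow> ('e \<Rightarrow> nat) set" where
  "configs E = E \<rightarrow>\<^sub>E {0, 1}"

text \<open>A graph \<open>x\<close> is the family of its \<open>(k, l)\<close>-subgraphs \<open>x (k, l)\<close>.\<close>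

type_synonym 'v graph = "nat \<times> nat \<Rightarrow> 'v set \<Rightarrow> nat"

definition graphs :: "(nat \<Rightarrow> 'v set) \<Rightarrow> nat \<Rightarrow> 'v graph set" where
  "graphs A K = (\<Pi>\<^sub>E p \<in> block_pairs K. configs (edges A p))"


section \<open>The local exponential random graph model\<close>

text \<open>
  Within-block and between-block statistics are indexed by block pairs: \<open>sW (k, k)\<close> and
  \<open>sB (k, l)\<close> with \<open>k < l\<close>; values at other indices are never used.
\<close>

type_synonym ('v, 'd) statistics = "nat \<times> nat \<Rightarrow> ('v set \<Rightarrow> nat) \<Rightarrow> real ^ 'd"

definition lergm_weight ::
  "nat \<Rightarrow> ('v, 'd1::finite) statistics \<Rightarrow> ('v, 'd2::finite) statistics \<Rightarrow> real ^ 'd1 \<Rightarrow> real ^ 'd2 \<Rightarrow> 'v graph \<Rightarrow> real"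
  where
  "lergm_weight K sW sB \<beta>W \<beta>B x =
     exp ((\<Sum>p\<in>within_pairs K. \<beta>W \<bullet> sW p (x p)) + (\<Sum>p\<in>between_pairs K. \<beta>B \<bullet> sB p (x p)))"

definition is_lergm ::
  "'w measure \<Rightarrow> ('w \<Rightarrow> 'v graph) \<Rightarrow> (nat \<Rightarrow> 'v set) \<Rightarrow> nat \<Rightarrow>
   ('v, 'd1::finite) statistics \<Rightarrow> ('v, 'd2::finite) statistics \<Rightarrow> real ^ 'd1 \<Rightarrow> real ^ 'd2 \<Rightarrow> bool"
  where
  "is_lergm P X A K sW sB \<beta>W \<beta>B \<longleftrightarrow>
     distributed P (count_space (graphs A K)) X
       (\<lambda>x. ennreal (lergm_weight K sW sB \<beta>W \<beta>B x /
          (\<Sum>y\<in>graphs A K. lergm_weight K sW sB \<beta>W \<beta>B y)))"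


section \<open>Stein estimating functions\<close>

definition logistic :: "real \<Rightarrow> real" where
  "logistic t = 1 / (1 + exp (- t))"

definition softplus :: "real \<Rightarrow> real" where
  "softplus t = ln (1 + exp t)"

definition edge_diff :: "'e \<Rightarrow> (('e \<Rightarrow> nat) \<Rightarrow> real ^ 'd) \<Rightarrow> ('e \<Rightarrow> nat) \<Rightarrow> real ^ 'd" where
  "edge_diff m s x = s (x(m := 1)) - s (x(m := 0))"

definition stein_h ::
  "'e set \<Rightarrow> (('e \<Rightarrow> nat) \<Rightarrow> real ^ 'd) \<Rightarrow> ('e \<Rightarrow> nat) \<Rightarrow> real ^ 'd \<Rightarrow> real ^ 'd" where
  "stein_h E s x \<beta> =
     (\<Sum>m\<in>E. logistic (\<beta> \<bullet> edge_diff m s x) *\<^sub>R edge_diff m s x + s (x(m := 0)) - s x)"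

text \<open>
  In the following, \<open>I\<close> is \<open>within_pairs K\<close> for the within-block versions and
  \<open>between_pairs K\<close> for the between-block versions.
\<close>

definition stein_g ::
  "(nat \<times> nat) set \<Rightarrow> (nat \<Rightarrow> 'v set) \<Rightarrow> ('v, 'd::finite) statistics \<Rightarrow> 'v graph \<Rightarrow> real ^ 'd \<Rightarrow> real ^ 'd"
  where
  "stein_g I A s x \<beta> = (\<Sum>p\<in>I. stein_h (edges A p) (s p) (x p) \<beta>)"

definition stein_potential ::
  "(nat \<times> nat) set \<Rightarrow> (nat \<Rightarrow> 'v set) \<Rightarrow> ('v, 'd::finite) statistics \<Rightarrow> 'v graph \<Rightarrow> real ^ 'd \<Rightarrow> real"
  where
  "stein_potential I A s x \<beta> =
     (\<Sum>p\<in>I. \<Sum>m\<in>edges A p.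
        softplus (\<beta> \<bullet> edge_diff m (s p) (x p)) + \<beta> \<bullet> (s p ((x p)(m := 0)) - s p (x p)))"

definition stein_hessian ::
  "(nat \<times> nat) set \<Rightarrow> (nat \<Rightarrow> 'v set) \<Rightarrow> ('v, 'd::finite) statistics \<Rightarrow> 'v graph \<Rightarrow> real ^ 'd \<Rightarrow> real ^ 'd ^ 'd"
  where
  "stein_hessian I A s x \<beta> =
     (\<Sum>p\<in>I. \<Sum>m\<in>edges A p.
        deriv logistic (\<beta> \<bullet> edge_diff m (s p) (x p)) *\<^sub>R
          outer (edge_diff m (s p) (x p)) (edge_diff m (s p) (x p)))"

text \<open>
  A rule choosing a minimiser over the closed ball of radius \<open>R\<close> for every graph;
  non-uniqueness is resolved by the (arbitrary) choice of the function \<open>b\<close>.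
\<close>

definition is_stein_estimator ::
  "(nat \<times> nat) set \<Rightarrow> (nat \<Rightarrow> 'v set) \<Rightarrow> nat \<Rightarrow> ('v, 'd::finite) statistics \<Rightarrow> real \<Rightarrow>
   ('v graph \<Rightarrow> real ^ 'd) \<Rightarrow> bool"
  where
  "is_stein_estimator I A K s R b \<longleftrightarrow>
     (\<forall>x\<in>graphs A K. is_arg_min (stein_potential I A s x) (\<lambda>\<beta>. \<beta> \<in> cball 0 R) (b x))"

definition g_cov ::
  "'w measure \<Rightarrow> ('w \<Rightarrow> 'v graph) \<Rightarrow> (nat \<times> nat) set \<Rightarrow> (nat \<Rightarrow> 'v set) \<Rightarrow> ('v, 'd::finite) statistics \<Rightarrow>
   real ^ 'd \<Rightarrow> real ^ 'd ^ 'd"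
  where
  "g_cov P X I A s \<beta> = (\<integral>\<omega>. outer (stein_g I A s (X \<omega>) \<beta>) (stein_g I A s (X \<omega>) \<beta>) \<partial>P)"

definition Q_matrix ::
  "'w measure \<Rightarrow> ('w \<Rightarrow> 'v graph) \<Rightarrow> (nat \<times> nat) set \<Rightarrow> (nat \<Rightarrow> 'v set) \<Rightarrow> ('v, 'd::finite) statistics \<Rightarrow>
   real ^ 'd \<Rightarrow> real ^ 'd ^ 'd"
  where
  "Q_matrix P X I A s \<beta> =
     inv_sqrt_matrix (g_cov P X I A s \<beta>) ** (\<integral>\<omega>. stein_hessian I A s (X \<omega>) \<beta> \<partial>P)"

text \<open>
  Minima over the finite set \<open>I\<close> are infima in the extended reals, so that the minimum
  over the empty set is \<open>\<infinity>\<close>.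
\<close>

definition edge_diff_min_eigen ::
  "'w measure \<Rightarrow> ('w \<Rightarrow> 'v graph) \<Rightarrow> (nat \<times> nat) set \<Rightarrow> (nat \<Rightarrow> 'v set) \<Rightarrow> ('v, 'd::finite) statistics \<Rightarrow> ereal"
  where
  "edge_diff_min_eigen P X I A s =
     (INF p\<in>I. ereal (lambda_min (\<Sum>m\<in>edges A p.
        \<integral>\<omega>. outer (edge_diff m (s p) (X \<omega> p)) (edge_diff m (s p) (X \<omega> p)) \<partial>P)))"

definition Upsilon ::
  "'w measure \<Rightarrow> ('w \<Rightarrow> 'v graph) \<Rightarrow> (nat \<times> nat) set \<Rightarrow> (nat \<Rightarrow> 'v set) \<Rightarrow> ('v, 'd::finite) statistics \<Rightarrow>
   real ^ 'd \<Rightarrow> ereal"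
  where
  "Upsilon P X I A s \<beta> =
     (INF p\<in>I. ereal (lambda_min
        (\<integral>\<omega>. outer (stein_h (edges A p) (s p) (X \<omega> p) \<beta>) (stein_h (edges A p) (s p) (X \<omega> p) \<beta>) \<partial>P)))"

end

theory Submission
  imports Defs
begin

text \<open>
  The estimating function is \<open>g(\<beta>) = \<Sum>\<^sub>p h\<^sub>p(\<beta>)\<close>, a sum over block pairs of functions of the subgraphs, which
  are independent because the weight of the model is a product.  Resampling one edge from its
  conditional law shows \<open>E h\<^sub>p(\<beta>\<^sup>\<star>) = 0\<close> (\<open>stein_identity\<close>); moreover \<open>h\<^sub>p\<close> is bounded by the number of edges
  times the bound \<open>D\<close> on the edge differences.  With \<open>S = E[g(\<beta>\<^sup>\<star>) g(\<beta>\<^sup>\<star>)\<^sup>T]\<close> and \<open>J = S\<^bsup>-1/2\<^esup>\<close> the vector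
  \<open>Z = - J g(\<beta>\<^sup>\<star>)\<close> is therefore a normalised sum of independent, centred, uniformly small vectors, and its
  characteristic function tends to that of the standard normal law (\<open>Z_iexp_approx\<close>).

  It remains to compare \<open>Z\<close> with \<open>W = J E[H(\<beta>\<^sup>\<star>)] \<delta>\<close>, where \<open>\<delta>\<close> is the estimation error and \<open>H\<close> the Hessian.
  First, \<open>\<sigma>'(t) \<ge> exp(-\<bar>t\<bar>)/4\<close>, so \<open>g\<close> is strongly monotone on the ball of radius \<open>R\<close>, with a constant of order
  \<open>N exp(-RD)\<close> as soon as \<open>\<Sum> \<Delta> \<Delta>\<^sup>T\<close> is close to its mean, which Chebyshev's inequality provides; here \<open>N\<close> is the
  number of block pairs.  As \<open>J g\<close> at the estimator tends to zero and \<open>Z\<close> is tight, this gives a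
  consistency rate for \<open>\<delta>\<close> of order \<open>exp(RD) / sqrt N\<close>, up to powers of \<open>D\<close> and of the block size.
  Second, a Taylor expansion of \<open>g\<close> and the concentration of \<open>H(\<beta>\<^sup>\<star>)\<close> around its mean bound \<open>W - Z\<close> by \<open>J g\<close> at the estimator plus terms of second order
  (\<open>linearization_on_good_event\<close>).  The growth condition makes them vanish (\<open>growth_tendsto\<close>).

  Finally, convergence of characteristic functions is turned into convergence in distribution of random
  vectors by approximating a bounded continuous function by a trigonometric polynomial that is close to it
  on a large ball and whose bound on the whole space does not depend on the ball (\<open>trig_poly_approximation\<close>).  Being Lipschitz, sines and cosines also absorb
  the difference \<open>W - Z\<close>.
\<close>

section \<open>Symmetric matrices and inverse square roots\<close>

lemma outer_mult_vector: "outer v w *v u = (w \<bullet> u) *\<^sub>R v"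
  by (simp add: vec_eq_iff outer_def matrix_vector_mult_def inner_vec_def sum_distrib_left sum_distrib_right mult_ac)

lemma transpose_outer: "transpose (outer v w) = outer w v"
  by (simp add: transpose_def outer_def vec_eq_iff mult.commute)

lemma norm_outer: "norm (outer v w) = norm v * norm w"
proof -
  have "norm (outer v w) = L2_set (\<lambda>i. \<bar>v $ i\<bar> * norm w) UNIV"
    unfolding norm_vec_def[of "outer v w"]
  proof (rule L2_set_cong[OF refl])
    fix i
    have "outer v w $ i = (v $ i) *\<^sub>R w" by (simp add: outer_def vec_eq_iff)
    then show "norm (outer v w $ i) = \<bar>v $ i\<bar> * norm w" by simp
  qed
  also have "\<dots> = norm v * norm w"
    by (simp add: L2_set_right_distrib[symmetric] norm_vec_def mult.commute L2_set_left_distrib)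
  finally show ?thesis .
qed

lemma norm_matrix_vector_mult_le:
  fixes S :: "real ^ 'n ^ 'm"
  shows "norm (S *v x) \<le> norm S * norm x"
proof -
  have "norm (S *v x) = L2_set (\<lambda>i. \<bar>S $ i \<bullet> x\<bar>) UNIV"
    by (simp add: norm_vec_def matrix_vector_mul_component)
  also have "\<dots> \<le> L2_set (\<lambda>i. norm (S $ i) * norm x) UNIV"
    by (intro L2_set_mono) (auto intro: Cauchy_Schwarz_ineq2)
  also have "\<dots> = norm S * norm x"
    by (simp add: L2_set_left_distrib[symmetric] norm_vec_def[of S])
  finally show ?thesis .
qed

lemma symmetric_matrix_inner:
  fixes S :: "real ^ 'd ^ 'd"
  assumes "transpose S = S"
  shows "(S *v x) \<bullet> y = x \<bullet> (S *v y)"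
  by (metis assms dot_lmul_matrix vector_transpose_matrix)

lemma matrix_vector_mult_sum: "(\<Sum>i\<in>I. f i) *v x = (\<Sum>i\<in>I. f i *v x)" for f :: "'i \<Rightarrow> real ^ 'n ^ 'm"
  by (induction I rule: infinite_finite_induct) (auto simp: matrix_vector_mult_add_rdistrib)

text \<open>
  A minimiser \<open>v\<close> of the quadratic form on the unit sphere of \<open>U\<close> is an eigenvector: along \<open>v + t w\<close>, with
  \<open>w = S v - c v\<close> in \<open>U\<close> by invariance, the form minus \<open>c\<close> times the squared norm is nonnegative, vanishes at
  \<open>t = 0\<close> and has derivative twice the squared norm of \<open>w\<close> there, so \<open>w = 0\<close>.  Working in an invariant subspace allows
  eigenvectors to be split off one at a time.
\<close>

lemma Rayleigh_minimum:
  fixes S :: "real ^ 'd ^ 'd"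
  assumes sym: "transpose S = S" and U: "subspace U" "\<And>u. u \<in> U \<Longrightarrow> S *v u \<in> U"
    and "U \<noteq> {0}"
  obtains v c where "v \<in> U" "norm v = 1" "S *v v = c *\<^sub>R v"
    "\<And>u. u \<in> U \<Longrightarrow> c * (norm u)\<^sup>2 \<le> u \<bullet> (S *v u)"
proof -
  let ?q = "\<lambda>u. u \<bullet> (S *v u)"
  have "0 \<in> U" using U(1) by (rule subspace_0)
  with \<open>U \<noteq> {0}\<close> obtain w where w: "w \<in> U" "w \<noteq> 0" by blast
  have "compact (U \<inter> sphere 0 1)"
    by (intro closed_Int_compact closed_subspace U(1) compact_sphere)
  moreover have "(1 / norm w) *\<^sub>R w \<in> U \<inter> sphere 0 1"
    using w U(1) by (auto intro: subspace_scale)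
  then have "U \<inter> sphere 0 1 \<noteq> {}" by blast
  moreover have "continuous_on (U \<inter> sphere 0 1) ?q"
    by (intro continuous_intros matrix_vector_mult_linear_continuous_on)
  ultimately obtain v where v: "v \<in> U \<inter> sphere 0 1" and vmin: "\<And>u. u \<in> U \<inter> sphere 0 1 \<Longrightarrow> ?q v \<le> ?q u"
    using continuous_attains_inf by (metis (no_types, lifting))
  define c where "c = ?q v"
  have ray: "c * (norm u)\<^sup>2 \<le> ?q u" if "u \<in> U" for u
  proof (cases "u = 0")
    case False
    then have "(1 / norm u) *\<^sub>R u \<in> U \<inter> sphere 0 1"
      using that U(1) by (auto intro: subspace_scale)
    from vmin[OF this] have "c \<le> (1 / norm u)\<^sup>2 * ?q u"
      by (simp add: c_def matrix_vector_mult_scaleR power2_eq_square)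
    then show ?thesis using False by (simp add: field_simps)
  qed simp
  define w where "w = S *v v - c *\<^sub>R v"
  have wU: "w \<in> U" using v U by (auto simp: w_def intro!: subspace_diff subspace_scale)
  have nv: "norm v = 1" "v \<bullet> v = 1" using v by (auto simp: norm_eq_1)
  have "w = 0"
  proof (rule ccontr)
    assume "w \<noteq> 0"
    define k where "k = ?q w - c * (norm w)\<^sup>2"
    \<comment> \<open>the form of \<open>S - c\<close> at \<open>v + t w\<close>, where \<open>k\<close> is its value at \<open>w\<close>\<close>
    have ineq: "0 \<le> 2 * t * (norm w)\<^sup>2 + t\<^sup>2 * k" for t
    proof -
      have "v + t *\<^sub>R w \<in> U" using v wU U(1) by (auto intro!: subspace_add subspace_scale)
      from ray[OF this] have "c * ((v + t *\<^sub>R w) \<bullet> (v + t *\<^sub>R w)) \<le> ?q (v + t *\<^sub>R w)"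
        by (simp add: power2_norm_eq_inner)
      moreover have "v \<bullet> (S *v w) = (S *v v) \<bullet> w" using symmetric_matrix_inner[OF sym] by simp
      moreover have "S *v v = w + c *\<^sub>R v" by (simp add: w_def)
      moreover have "w \<bullet> v = 0"
        using nv by (simp add: w_def inner_diff_left inner_commute[of "S *v v" v] c_def)
      ultimately show ?thesis
        unfolding k_def power2_norm_eq_inner
        using nv by (simp add: c_def[symmetric] matrix_vector_right_distrib matrix_vector_mult_scaleR inner_add_left inner_add_right
            inner_commute[of v w] algebra_simps power2_eq_square)
    qed
    have pos: "(norm w)\<^sup>2 > 0" using \<open>w \<noteq> 0\<close> by simp
    show False
    proof (cases "k \<le> 0")
      case True
      then have "(-1)\<^sup>2 * k \<le> 0" by simp
      then show False using ineq[of "-1"] pos by auto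
    next
      case False
      have "2 * (- (norm w)\<^sup>2 / k) * (norm w)\<^sup>2 + (- (norm w)\<^sup>2 / k)\<^sup>2 * k = - ((norm w)\<^sup>2)\<^sup>2 / k"
        using False by (simp add: field_simps power2_eq_square)
      moreover have "((norm w)\<^sup>2)\<^sup>2 / k > 0" using pos False by simp
      ultimately show False using ineq[of "- (norm w)\<^sup>2 / k"] by linarith
    qed
  qed
  then have "S *v v = c *\<^sub>R v" by (simp add: w_def)
  with v ray nv that show thesis by blast
qed

text \<open>
  Take an orthonormal set of eigenvectors of maximal size.  If it did not span, its orthogonal complement
  would be a nonzero invariant subspace and would contain a further unit eigenvector.
\<close>

lemma symmetric_eigenbasis:
  fixes S :: "real ^ 'd ^ 'd"
  assumes sym: "transpose S = S"
  obtains B where "finite B" "span B = UNIV" "\<And>v. v \<in> B \<Longrightarrow> norm v = 1"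
    "\<And>v w. v \<in> B \<Longrightarrow> w \<in> B \<Longrightarrow> v \<noteq> w \<Longrightarrow> v \<bullet> w = 0"
    "\<And>v. v \<in> B \<Longrightarrow> S *v v = (v \<bullet> (S *v v)) *\<^sub>R v"
proof -
  define good where "good B \<longleftrightarrow> pairwise orthogonal B \<and> (\<forall>v\<in>B. norm v = 1 \<and> (\<exists>c. S *v v = c *\<^sub>R v))" for B
  have ind: "independent B" if "good B" for B
    by (rule pairwise_orthogonal_independent) (use that in \<open>auto simp: good_def\<close>)
  have fin: "finite B" "card B \<le> DIM(real ^ 'd)" if "good B" for B
    using independent_bound[OF ind[OF that]] by auto
  have "good {}" by (simp add: good_def)
  then obtain B where B: "good B" and Bmax: "\<And>C. good C \<Longrightarrow> card C \<le> card B"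
    using ex_has_greatest_nat[of good "{}" card "Suc DIM(real ^ 'd)"] fin(2) by (metis le_SucI less_Suc_eq_le)
  have span: "span B = UNIV"
  proof (rule ccontr)
    assume "span B \<noteq> UNIV"
    define U where "U = {u. \<forall>b\<in>B. b \<bullet> u = 0}"
    have sub: "subspace U" by (auto simp: U_def subspace_def inner_add_right)
    have inv: "S *v u \<in> U" if "u \<in> U" for u
      unfolding U_def
    proof (clarify)
      fix b assume b: "b \<in> B"
      then obtain c where "S *v b = c *\<^sub>R b" using B by (auto simp: good_def)
      then show "b \<bullet> (S *v u) = 0"
        using symmetric_matrix_inner[OF sym, of b u] that b by (simp add: U_def)
    qed
    obtain a where a: "a \<noteq> 0" "\<forall>x\<in>span B. a \<bullet> x = 0"
      using span_not_UNIV_orthogonal[OF \<open>span B \<noteq> UNIV\<close>] by auto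
    then have "a \<in> U" by (auto simp: U_def span_base inner_commute)
    with a have "U \<noteq> {0}" by blast
    from Rayleigh_minimum[OF sym sub inv this] obtain v c where v: "v \<in> U" "norm v = 1" "S *v v = c *\<^sub>R v"
      by metis
    have "v \<notin> B" using v by (auto simp: U_def norm_eq_1)
    have "good (insert v B)" using B v
      by (auto simp: good_def pairwise_insert U_def orthogonal_def inner_commute)
    from Bmax[OF this] show False using \<open>v \<notin> B\<close> fin(1)[OF B] by simp
  qed
  have "S *v v = (v \<bullet> (S *v v)) *\<^sub>R v" if v: "v \<in> B" for v
  proof -
    obtain c where "S *v v = c *\<^sub>R v" "v \<bullet> v = 1" using v B by (auto simp: good_def norm_eq_1)
    then show ?thesis by simp
  qed
  moreover have "v \<bullet> w = 0" if "v \<in> B" "w \<in> B" "v \<noteq> w" for v w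
    using that B by (auto simp: good_def pairwise_def orthogonal_def)
  ultimately show thesis using that fin(1)[OF B] span B by (auto simp: good_def)
qed

text \<open>
  Eigenvectors of different eigenvalues are orthogonal, hence independent.  Finiteness is what makes the
  minimum in the definition of \<open>lambda_min\<close> meaningful.
\<close>

lemma finite_eigenvalues:
  fixes S :: "real ^ 'd ^ 'd"
  assumes sym: "transpose S = S"
  shows "finite {c. \<exists>v. v \<noteq> 0 \<and> S *v v = c *\<^sub>R v}" (is "finite ?E")
proof -
  define f where "f c = (SOME v. v \<noteq> 0 \<and> S *v v = c *\<^sub>R v)" for c
  have f: "f c \<noteq> 0 \<and> S *v f c = c *\<^sub>R f c" if "c \<in> ?E" for c
    using that unfolding f_def mem_Collect_eq by (rule someI_ex)
  have orth: "f c \<bullet> f d = 0" if "c \<in> ?E" "d \<in> ?E" "c \<noteq> d" for c d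
  proof -
    have "c * (f c \<bullet> f d) = d * (f c \<bullet> f d)"
      using symmetric_matrix_inner[OF sym, of "f c" "f d"] f[OF that(1)] f[OF that(2)] by simp
    with that(3) show ?thesis by (simp only: mult_cancel_right) blast
  qed
  have inj: "inj_on f ?E"
  proof (rule inj_onI, rule ccontr)
    fix c d assume *: "c \<in> ?E" "d \<in> ?E" "f c = f d" "c \<noteq> d"
    from orth[OF *(1,2,4)] *(3) f[OF *(1)] show False by simp
  qed
  have "independent (f ` ?E)"
  proof (rule pairwise_orthogonal_independent)
    show "pairwise orthogonal (f ` ?E)"
    proof (rule pairwiseI)
      fix x y assume "x \<in> f ` ?E" "y \<in> f ` ?E" and xy: "x \<noteq> y"
      then obtain c d where cd: "c \<in> ?E" "d \<in> ?E" "x = f c" "y = f d" by (elim imageE)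
      with xy have "c \<noteq> d" by blast
      with cd show "orthogonal x y" using orth by (simp only: orthogonal_def)
    qed
    show "0 \<notin> f ` ?E"
    proof
      assume "0 \<in> f ` ?E"
      then obtain c where "c \<in> ?E" "0 = f c" by (elim imageE)
      with f[of c] show False by simp
    qed
  qed
  then have "finite (f ` ?E)" by (rule finiteI_independent)
  then show ?thesis using inj by (rule finite_imageD)
qed

lemma lambda_min_le_quadratic_form:
  fixes S :: "real ^ 'd ^ 'd"
  assumes sym: "transpose S = S"
  shows "lambda_min S * (norm u)\<^sup>2 \<le> u \<bullet> (S *v u)"
proof -
  have "(UNIV :: (real ^ 'd) set) \<noteq> {0}"
    by (metis UNIV_I norm_axis_1 norm_zero singletonD zero_neq_one)
  from Rayleigh_minimum[OF sym subspace_UNIV _ this] obtain v c where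
    v: "norm v = 1" "S *v v = c *\<^sub>R v" and ray: "\<And>u. c * (norm u)\<^sup>2 \<le> u \<bullet> (S *v u)"
    by (metis UNIV_I)
  have "lambda_min S \<le> c"
    unfolding lambda_min_def using v
    by (intro Min_le finite_eigenvalues[OF sym]) (auto intro!: exI[of _ v])
  then have "lambda_min S * (norm u)\<^sup>2 \<le> c * (norm u)\<^sup>2" by (intro mult_right_mono) auto
  with ray[of u] show ?thesis by linarith
qed

text \<open>
  The root with the eigenvectors of \<open>S\<close> and the square roots of its eigenvalues exists.  It is unique because
  any other root \<open>T'\<close> acts in the same way on the eigenbasis: from \<open>(T' + sqrt c) (T' - sqrt c) v = (S - c) v = 0\<close> and positive
  definiteness of \<open>T' + sqrt c\<close> it follows that \<open>T' v = sqrt c v\<close>.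
\<close>

lemma sqrt_matrix:
  fixes S :: "real ^ 'd ^ 'd"
  assumes sym: "transpose S = S" and pos: "\<And>v. v \<noteq> 0 \<Longrightarrow> 0 < v \<bullet> (S *v v)"
  shows "pos_semidef (sqrt_matrix S)" "sqrt_matrix S ** sqrt_matrix S = S"
proof -
  obtain B where B: "finite B" "span B = UNIV" "\<And>v. v \<in> B \<Longrightarrow> norm v = 1"
    "\<And>v w. v \<in> B \<Longrightarrow> w \<in> B \<Longrightarrow> v \<noteq> w \<Longrightarrow> v \<bullet> w = 0"
    "\<And>v. v \<in> B \<Longrightarrow> S *v v = (v \<bullet> (S *v v)) *\<^sub>R v"
    using symmetric_eigenbasis[OF sym] by blast
  define c where "c v = v \<bullet> (S *v v)" for v
  have cpos: "c v > 0" if "v \<in> B" for v using B(3)[OF that] pos[of v] by (force simp: c_def)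
  have eq_on_basis: "T1 = T2" if "\<And>v. v \<in> B \<Longrightarrow> T1 *v v = T2 *v v" for T1 T2 :: "real ^ 'd ^ 'd"
  proof -
    have "T1 *v x = T2 *v x" for x
      by (rule linear_eq_on_span[of "(*v) T1" "(*v) T2" B]) (use that B(2) in auto)
    then show ?thesis using matrix_eq by blast
  qed
  define T where "T = (\<Sum>v\<in>B. sqrt (c v) *\<^sub>R outer v v)"
  have T_apply: "T *v x = (\<Sum>v\<in>B. (sqrt (c v) * (v \<bullet> x)) *\<^sub>R v)" for x
    by (simp add: T_def matrix_vector_mult_sum scaleR_matrix_vector_assoc[symmetric] outer_mult_vector)
  have T_eig: "T *v w = sqrt (c w) *\<^sub>R w" if "w \<in> B" for w
  proof -
    have "T *v w = (\<Sum>v\<in>B. if v = w then sqrt (c w) *\<^sub>R w else 0)"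
      unfolding T_apply using that B(3,4) by (intro sum.cong) (auto simp: norm_eq_1)
    then show ?thesis using B(1) that by simp
  qed
  have Tsym: "transpose T = T"
  proof -
    have "transpose T = (\<Sum>v\<in>B. sqrt (c v) *\<^sub>R transpose (outer v v))"
      by (simp add: T_def transpose_def vec_eq_iff)
    then show ?thesis by (simp add: T_def transpose_outer)
  qed
  have "0 \<le> x \<bullet> (T *v x)" for x
  proof -
    have "x \<bullet> (T *v x) = (\<Sum>v\<in>B. sqrt (c v) * (v \<bullet> x)\<^sup>2)"
      unfolding T_apply inner_sum_right inner_scaleR_right
      by (intro sum.cong refl) (simp add: inner_commute power2_eq_square)
    also have "0 \<le> \<dots>" using less_imp_le[OF cpos] by (intro sum_nonneg mult_nonneg_nonneg) auto
    finally show ?thesis .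
  qed
  with Tsym have psd: "pos_semidef T" by (simp add: pos_semidef_def)
  have TT: "T ** T = S"
  proof (rule eq_on_basis)
    fix v assume v: "v \<in> B"
    have "(T ** T) *v v = (sqrt (c v) * sqrt (c v)) *\<^sub>R v"
      by (simp only: matrix_vector_mul_assoc[symmetric] T_eig[OF v] matrix_vector_mult_scaleR scaleR_scaleR)
    also have "\<dots> = c v *\<^sub>R v" using cpos[OF v] by simp
    also have "\<dots> = S *v v" unfolding c_def by (rule B(5)[OF v, symmetric])
    finally show "(T ** T) *v v = S *v v" .
  qed
  have unique: "T' = T" if T': "pos_semidef T'" "T' ** T' = S" for T'
  proof (rule eq_on_basis)
    fix v assume v: "v \<in> B"
    define w where "w = T' *v v - sqrt (c v) *\<^sub>R v"
    have "T' *v (T' *v v) = c v *\<^sub>R v"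
      unfolding matrix_vector_mul_assoc T'(2) c_def by (rule B(5)[OF v])
    then have "T' *v w + sqrt (c v) *\<^sub>R w = 0"
      using cpos[OF v] by (simp add: w_def matrix_vector_mult_diff_distrib matrix_vector_mult_scaleR algebra_simps less_imp_le)
    then have "w \<bullet> (T' *v w) + sqrt (c v) * (w \<bullet> w) = 0"
      by (metis inner_add_right inner_scaleR_right inner_zero_right)
    moreover have "0 \<le> w \<bullet> (T' *v w)" using T'(1) by (simp add: pos_semidef_def)
    moreover have "0 \<le> sqrt (c v) * (w \<bullet> w)" using cpos[OF v] by simp
    ultimately have "sqrt (c v) * (w \<bullet> w) = 0" by linarith
    then have "w = 0" using cpos[OF v] by simp
    then show "T' *v v = T *v v" using T_eig[OF v] by (simp add: w_def)
  qed
  have "sqrt_matrix S = T" unfolding sqrt_matrix_def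
    using psd TT unique by (intro the_equality conjI) blast+
  with psd TT show "pos_semidef (sqrt_matrix S)" "sqrt_matrix S ** sqrt_matrix S = S" by auto
qed

text \<open>
  Everything follows from the identity \<open>v \<bullet> S v = norm (T v)\<^sup>2\<close> for the root \<open>T\<close> of \<open>S\<close>: bounds for the quadratic form of \<open>S\<close> are
  bounds for \<open>T\<close>, and in the opposite direction for its inverse \<open>J\<close>.
\<close>

lemma inv_sqrt_matrix:
  fixes S :: "real ^ 'd ^ 'd"
  assumes sym: "transpose S = S" and low: "\<And>v. l * (norm v)\<^sup>2 \<le> v \<bullet> (S *v v)" and l: "0 < l"
  defines "J \<equiv> inv_sqrt_matrix S"
  shows transpose_inv_sqrt_matrix: "transpose J = J"
    and inv_sqrt_matrix_normalizes: "J ** S ** J = mat 1"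
    and norm_inv_sqrt_matrix_le: "norm (J *v w) \<le> norm w / sqrt l"
    and norm_le_norm_inv_sqrt_matrix:
      "(\<And>v. v \<bullet> (S *v v) \<le> u * (norm v)\<^sup>2) \<Longrightarrow> norm w \<le> sqrt u * norm (J *v w)"
proof -
  define T where "T = sqrt_matrix S"
  have pos: "0 < v \<bullet> (S *v v)" if "v \<noteq> 0" for v
    using low[of v] l that by (smt (verit) mult_pos_pos zero_less_norm_iff zero_less_power)
  have Tsym: "transpose T = T" and TT: "T ** T = S"
    using sqrt_matrix[OF sym pos] by (auto simp: T_def pos_semidef_def)
  have nT: "(norm (T *v v))\<^sup>2 = v \<bullet> (S *v v)" for v
    using symmetric_matrix_inner[OF Tsym, of v "T *v v"]
    by (simp add: power2_norm_eq_inner matrix_vector_mul_assoc TT)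
  have "T *v v = 0 \<Longrightarrow> v = 0" for v using nT[of v] pos[of v] by force
  then have "invertible T"
    by (metis invertible_left_inverse matrix_left_invertible_ker)
  then have "\<exists>T'. T ** T' = mat 1 \<and> T' ** T = mat 1" by (simp add: invertible_def)
  then have "T ** (SOME T'. T ** T' = mat 1 \<and> T' ** T = mat 1) = mat 1
      \<and> (SOME T'. T ** T' = mat 1 \<and> T' ** T = mat 1) ** T = mat 1"
    by (rule someI_ex)
  then have TJ: "T ** J = mat 1" "J ** T = mat 1"
    unfolding J_def inv_sqrt_matrix_def matrix_inv_def T_def by (rule conjunct1, rule conjunct2)
  have "transpose J = transpose J ** (T ** J)" by (simp add: TJ)
  also have "\<dots> = transpose (T ** J) ** J" by (simp add: matrix_transpose_mul Tsym matrix_mul_assoc)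
  finally show "transpose J = J" by (simp add: TJ transpose_mat)
  have "J ** S ** J = (J ** T) ** (T ** J)" by (simp add: TT[symmetric] matrix_mul_assoc)
  then show "J ** S ** J = mat 1" by (simp add: TJ)
  have w: "T *v (J *v w) = w" by (simp add: matrix_vector_mul_assoc TJ)
  have "l * (norm (J *v w))\<^sup>2 \<le> (norm w)\<^sup>2" using low[of "J *v w"] nT[of "J *v w"] w by simp
  then have "sqrt (l * (norm (J *v w))\<^sup>2) \<le> norm w" by (intro real_le_lsqrt) auto
  then show "norm (J *v w) \<le> norm w / sqrt l" using l by (simp add: real_sqrt_mult field_simps)
  assume up: "\<And>v. v \<bullet> (S *v v) \<le> u * (norm v)\<^sup>2"
  have "(norm w)\<^sup>2 \<le> u * (norm (J *v w))\<^sup>2" using up[of "J *v w"] nT[of "J *v w"] w by simp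
  then have "norm w \<le> sqrt (u * (norm (J *v w))\<^sup>2)" by (rule real_le_rsqrt)
  then show "norm w \<le> sqrt u * norm (J *v w)" by (simp add: real_sqrt_mult)
qed

section \<open>Sums of independent bounded random vectors\<close>

lemma exp_minus_approx:
  fixes x :: real
  assumes "0 \<le> x"
  shows "\<bar>exp (- x) - (1 - x)\<bar> \<le> x\<^sup>2"
proof -
  have "1 + x \<le> exp x" by (rule exp_ge_add_one_self)
  then have "exp (- x) \<le> 1 / (1 + x)" using assms by (simp add: exp_minus field_simps)
  also have "\<dots> \<le> 1 - x + x\<^sup>2"
  proof -
    have "(1 - x + x\<^sup>2) * (1 + x) = 1 + x ^ 3" by (simp add: algebra_simps power2_eq_square power3_eq_cube)
    then show ?thesis using assms by (simp add: divide_le_eq)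
  qed
  finally show ?thesis using exp_ge_add_one_self[of "- x"] by simp
qed

text \<open>
  A quantitative central limit theorem for characteristic functions.  Each factor differs from \<open>1 - v\<^sub>i/2\<close>,
  with \<open>v\<^sub>i\<close> the variance of \<open>Y\<^sub>i\<close>, by at most \<open>b v\<^sub>i\<close>, since the third moment is at most \<open>b v\<^sub>i\<close>; and \<open>exp(-v\<^sub>i/2)\<close> differs
  from it by at most \<open>b\<^sup>2 v\<^sub>i\<close>.  For factors in the unit disc the errors of a product add up.
\<close>

lemma (in prob_space) sum_indep_iexp_approx:
  fixes Y :: "'i \<Rightarrow> 'a \<Rightarrow> real"
  assumes I: "finite I" and indep: "indep_vars (\<lambda>_. borel) Y I"
    and bound: "\<And>i \<omega>. i \<in> I \<Longrightarrow> \<omega> \<in> space M \<Longrightarrow> \<bar>Y i \<omega>\<bar> \<le> b"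
    and mean: "\<And>i. i \<in> I \<Longrightarrow> expectation (Y i) = 0"
    and s: "s = (\<Sum>i\<in>I. expectation (\<lambda>\<omega>. (Y i \<omega>)\<^sup>2))" and b: "0 \<le> b"
  shows "cmod (expectation (\<lambda>\<omega>. iexp (\<Sum>i\<in>I. Y i \<omega>)) - complex_of_real (exp (- s / 2))) \<le> (b + b\<^sup>2) * s"
proof -
  let ?v = "\<lambda>i. expectation (\<lambda>\<omega>. (Y i \<omega>)\<^sup>2)"
  let ?c = "\<lambda>i. char (distr M borel (Y i)) 1"
  have rv[measurable]: "random_variable borel (Y i)" if "i \<in> I" for i
    using indep that by (auto simp: indep_vars_def)
  have v0: "0 \<le> ?v i" for i by simp
  have single: "cmod (?c i - complex_of_real (exp (- ?v i / 2))) \<le> (b + b\<^sup>2) * ?v i" if i: "i \<in> I" for i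
  proof -
    have [measurable]: "Y i \<in> borel_measurable M" using rv[OF i] .
    have int1: "integrable M (Y i)"
      using bound[OF i] by (intro integrable_const_bound[where B=b]) auto
    have int2: "integrable M (\<lambda>\<omega>. (Y i \<omega>)\<^sup>2)"
      using bound[OF i] b by (intro integrable_const_bound[where B="b\<^sup>2"]) (auto simp: abs_le_square_iff[symmetric])
    have vb: "?v i \<le> b\<^sup>2"
    proof -
      have "?v i \<le> expectation (\<lambda>_. b\<^sup>2)"
        using bound[OF i] int2 b by (intro integral_mono) (auto simp: abs_le_square_iff[symmetric])
      then show ?thesis by (simp add: prob_space)
    qed
    have "cmod (?c i - (1 - 1\<^sup>2 * ?v i / 2)) \<le> 1\<^sup>2 / 6 * expectation (\<lambda>x. min (6 * (Y i x)\<^sup>2) (\<bar>1\<bar> * \<bar>Y i x\<bar> ^ 3))"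
      by (rule char_approx3') (use int1 int2 mean[OF i] in auto)
    also have "\<dots> \<le> 1 / 6 * expectation (\<lambda>x. b * (Y i x)\<^sup>2)"
    proof -
      have "min (6 * (Y i x)\<^sup>2) (\<bar>1\<bar> * \<bar>Y i x\<bar> ^ 3) \<le> b * (Y i x)\<^sup>2" if "x \<in> space M" for x
      proof -
        have "\<bar>Y i x\<bar> ^ 3 = \<bar>Y i x\<bar> * (Y i x)\<^sup>2" by (simp add: power2_eq_square power3_eq_cube)
        also have "\<dots> \<le> b * (Y i x)\<^sup>2" using bound[OF i that] by (intro mult_right_mono) auto
        finally show ?thesis by simp
      qed
      moreover have "integrable M (\<lambda>x. min (6 * (Y i x)\<^sup>2) (\<bar>1\<bar> * \<bar>Y i x\<bar> ^ 3))"
        by (rule Bochner_Integration.integrable_bound[OF integrable_mult_right[OF int2, of 6]]) auto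
      ultimately have "expectation (\<lambda>x. min (6 * (Y i x)\<^sup>2) (\<bar>1\<bar> * \<bar>Y i x\<bar> ^ 3)) \<le> expectation (\<lambda>x. b * (Y i x)\<^sup>2)"
        using int2 by (intro integral_mono) auto
      then show ?thesis by simp
    qed
    also have "\<dots> \<le> b * ?v i" using b v0[of i] by simp
    finally have 1: "cmod (?c i - (1 - ?v i / 2)) \<le> b * ?v i" by simp
    have "\<bar>exp (- ?v i / 2) - (1 - ?v i / 2)\<bar> \<le> (?v i / 2)\<^sup>2"
      using exp_minus_approx[of "?v i / 2"] v0[of i] by simp
    also have "\<dots> \<le> b\<^sup>2 * ?v i"
    proof -
      have "(?v i / 2)\<^sup>2 = (?v i / 4) * ?v i" by (simp add: power2_eq_square)
      also have "\<dots> \<le> b\<^sup>2 * ?v i" using vb v0[of i] zero_le_power2[of b] by (intro mult_right_mono) linarith+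
      finally show ?thesis .
    qed
    finally have "cmod (complex_of_real (1 - ?v i / 2) - complex_of_real (exp (- ?v i / 2))) \<le> b\<^sup>2 * ?v i"
      by (metis abs_minus_commute norm_of_real of_real_diff)
    with 1 show ?thesis
      using norm_triangle_ineq[of "?c i - (1 - ?v i / 2)" "complex_of_real (1 - ?v i / 2) - complex_of_real (exp (- ?v i / 2))"]
      by (simp add: distrib_right)
  qed
  have "expectation (\<lambda>\<omega>. iexp (\<Sum>i\<in>I. Y i \<omega>)) = char (distr M borel (\<lambda>\<omega>. \<Sum>i\<in>I. Y i \<omega>)) 1"
    by (simp add: char_def integral_distr)
  also have "\<dots> = (\<Prod>i\<in>I. ?c i)" by (rule char_distr_sum[OF indep])
  also have "complex_of_real (exp (- s / 2)) = (\<Prod>i\<in>I. complex_of_real (exp (- ?v i / 2)))"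
    using I by (simp add: s exp_sum sum_negf[symmetric] sum_divide_distrib)
  then have "cmod ((\<Prod>i\<in>I. ?c i) - complex_of_real (exp (- s / 2)))
      \<le> (\<Sum>i\<in>I. cmod (?c i - complex_of_real (exp (- ?v i / 2))))"
    using rv v0 by (simp only:) (intro norm_prod_diff real_distribution.cmod_char_le_1 real_distribution_distr, auto)
  also have "\<dots> \<le> (\<Sum>i\<in>I. (b + b\<^sup>2) * ?v i)" by (intro sum_mono single)
  also have "\<dots> = (b + b\<^sup>2) * s" by (simp add: s sum_distrib_left)
  finally show ?thesis .
qed

lemma (in prob_space) indep_sum_second_moment:
  fixes Y :: "'i \<Rightarrow> 'a \<Rightarrow> 'b::euclidean_space"
  assumes I: "finite I" and indep: "indep_vars (\<lambda>_. borel) Y I"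
    and bound: "\<And>i \<omega>. i \<in> I \<Longrightarrow> \<omega> \<in> space M \<Longrightarrow> norm (Y i \<omega>) \<le> b"
    and mean: "\<And>i. i \<in> I \<Longrightarrow> expectation (Y i) = 0"
  shows "expectation (\<lambda>\<omega>. (u \<bullet> (\<Sum>i\<in>I. Y i \<omega>)) * (v \<bullet> (\<Sum>i\<in>I. Y i \<omega>)))
    = (\<Sum>i\<in>I. expectation (\<lambda>\<omega>. (u \<bullet> Y i \<omega>) * (v \<bullet> Y i \<omega>)))"
proof -
  have rv: "Y i \<in> borel_measurable M" if "i \<in> I" for i
    using indep that by (auto simp: indep_vars_def)
  have int: "integrable M (Y i)" if "i \<in> I" for i
    using bound[OF that] rv[OF that] by (intro integrable_const_bound[where B=b]) auto
  have intp: "integrable M (\<lambda>\<omega>. (u \<bullet> Y i \<omega>) * (v \<bullet> Y j \<omega>))" if "i \<in> I" "j \<in> I" for i j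
  proof (rule integrable_const_bound[where B="(norm u * b) * (norm v * b)"])
    show "AE \<omega> in M. norm ((u \<bullet> Y i \<omega>) * (v \<bullet> Y j \<omega>)) \<le> (norm u * b) * (norm v * b)"
    proof (rule AE_I2)
      fix \<omega> assume w: "\<omega> \<in> space M"
      have *: "\<bar>x \<bullet> Y k \<omega>\<bar> \<le> norm x * b" if "k \<in> I" for k x
        using Cauchy_Schwarz_ineq2[of x "Y k \<omega>"] mult_left_mono[OF bound[OF that w], of "norm x"] by simp
      have "0 \<le> b" using bound[OF that(1) w] by (smt (verit) norm_ge_zero)
      then show "norm ((u \<bullet> Y i \<omega>) * (v \<bullet> Y j \<omega>)) \<le> (norm u * b) * (norm v * b)"
        using * that by (auto simp: abs_mult intro!: mult_mono)
    qed
  qed (use rv that in measurable)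
  have cross: "expectation (\<lambda>\<omega>. (u \<bullet> Y i \<omega>) * (v \<bullet> Y j \<omega>)) = 0" if ij: "i \<in> I" "j \<in> I" "i \<noteq> j" for i j
  proof -
    define w where "w k = (if k = i then u else v)" for k
    have "indep_vars (\<lambda>_. borel) (\<lambda>k \<omega>. w k \<bullet> Y k \<omega>) {i, j}"
      by (rule indep_vars_compose2[OF indep_vars_subset[OF indep]]) (use ij in auto)
    from indep_vars_lebesgue_integral[OF _ this]
    have "expectation (\<lambda>\<omega>. (u \<bullet> Y i \<omega>) * (v \<bullet> Y j \<omega>)) = expectation (\<lambda>\<omega>. u \<bullet> Y i \<omega>) * expectation (\<lambda>\<omega>. v \<bullet> Y j \<omega>)"
      using int ij by (auto simp: w_def)
    also have "\<dots> = 0" using mean[OF ij(1)] int[OF ij(1)] by simp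
    finally show ?thesis .
  qed
  have "expectation (\<lambda>\<omega>. (u \<bullet> (\<Sum>i\<in>I. Y i \<omega>)) * (v \<bullet> (\<Sum>i\<in>I. Y i \<omega>)))
    = (\<Sum>i\<in>I. \<Sum>j\<in>I. expectation (\<lambda>\<omega>. (u \<bullet> Y i \<omega>) * (v \<bullet> Y j \<omega>)))"
    by (simp add: inner_sum_right sum_product intp)
  also have "\<dots> = (\<Sum>i\<in>I. \<Sum>j\<in>I. if j = i then expectation (\<lambda>\<omega>. (u \<bullet> Y i \<omega>) * (v \<bullet> Y i \<omega>)) else 0)"
    by (intro sum.cong) (auto simp: cross)
  finally show ?thesis using I by simp
qed

text \<open>
  The variance of a sum of independent vectors is the sum of the variances.  The euclidean space is general because
  the lemma is applied to matrices with the Frobenius norm.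
\<close>

lemma (in prob_space) indep_sum_norm_square:
  fixes Y :: "'i \<Rightarrow> 'a \<Rightarrow> 'b::euclidean_space"
  assumes I: "finite I" and indep: "indep_vars (\<lambda>_. borel) Y I"
    and bound: "\<And>i \<omega>. i \<in> I \<Longrightarrow> \<omega> \<in> space M \<Longrightarrow> norm (Y i \<omega>) \<le> b"
  shows "expectation (\<lambda>\<omega>. (norm ((\<Sum>i\<in>I. Y i \<omega>) - (\<Sum>i\<in>I. expectation (Y i))))\<^sup>2) \<le> real (card I) * (2 * b)\<^sup>2"
proof -
  define Z where "Z i \<omega> = Y i \<omega> - expectation (Y i)" for i \<omega>
  have rv: "Y i \<in> borel_measurable M" if "i \<in> I" for i
    using indep that by (auto simp: indep_vars_def)
  have int: "integrable M (Y i)" if "i \<in> I" for i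
    using bound[OF that] rv[OF that] by (intro integrable_const_bound[where B=b]) auto
  have indepZ: "indep_vars (\<lambda>_. borel) Z I"
    unfolding Z_def by (rule indep_vars_compose2[OF indep]) auto
  have meanZ: "expectation (Z i) = 0" if "i \<in> I" for i
    using int[OF that] by (simp add: Z_def[abs_def] prob_space)
  have Eb: "norm (expectation (Y i)) \<le> b" if "i \<in> I" for i
  proof -
    have "norm (expectation (Y i)) \<le> expectation (\<lambda>\<omega>. norm (Y i \<omega>))" by (rule integral_norm_bound)
    also have "\<dots> \<le> expectation (\<lambda>_. b)" using bound[OF that] int[OF that] by (intro integral_mono) auto
    finally show ?thesis by (simp add: prob_space)
  qed
  have boundZ: "norm (Z i \<omega>) \<le> 2 * b" if "i \<in> I" "\<omega> \<in> space M" for i \<omega>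
    using norm_triangle_ineq4[of "Y i \<omega>" "expectation (Y i)"] bound[OF that] Eb[OF that(1)] by (simp add: Z_def)
  have rvZ: "Z i \<in> borel_measurable M" if "i \<in> I" for i
    using indepZ that by (auto simp: indep_vars_def)
  have ip: "integrable M (\<lambda>\<omega>. (c \<bullet> X \<omega>) * (c \<bullet> X \<omega>))"
    if "X \<in> borel_measurable M" "\<And>\<omega>. \<omega> \<in> space M \<Longrightarrow> norm (X \<omega>) \<le> B" for X :: "'a \<Rightarrow> 'b" and B c
  proof (rule integrable_const_bound[where B="(norm c * B) * (norm c * B)"])
    show "AE \<omega> in M. norm ((c \<bullet> X \<omega>) * (c \<bullet> X \<omega>)) \<le> norm c * B * (norm c * B)"
    proof (rule AE_I2)
      fix \<omega> assume w: "\<omega> \<in> space M"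
      have "\<bar>c \<bullet> X \<omega>\<bar> \<le> norm c * B"
        using Cauchy_Schwarz_ineq2[of c "X \<omega>"] mult_left_mono[OF that(2)[OF w], of "norm c"] by simp
      moreover from this have "0 \<le> norm c * B" by linarith
      ultimately show "norm ((c \<bullet> X \<omega>) * (c \<bullet> X \<omega>)) \<le> norm c * B * (norm c * B)"
        unfolding real_norm_def abs_mult by (intro mult_mono) auto
    qed
  qed (use that in measurable)
  have sumb: "norm (\<Sum>i\<in>I. Z i \<omega>) \<le> (\<Sum>i\<in>I. 2 * b)" if "\<omega> \<in> space M" for \<omega>
    by (rule order_trans[OF norm_sum sum_mono]) (use boundZ that in auto)
  have "expectation (\<lambda>\<omega>. (norm ((\<Sum>i\<in>I. Y i \<omega>) - (\<Sum>i\<in>I. expectation (Y i))))\<^sup>2)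
      = expectation (\<lambda>\<omega>. \<Sum>c\<in>Basis. (c \<bullet> (\<Sum>i\<in>I. Z i \<omega>)) * (c \<bullet> (\<Sum>i\<in>I. Z i \<omega>)))"
    unfolding power2_norm_eq_inner
    by (subst euclidean_inner) (simp add: Z_def sum_subtractf inner_commute)
  also have "\<dots> = (\<Sum>c\<in>Basis. expectation (\<lambda>\<omega>. (c \<bullet> (\<Sum>i\<in>I. Z i \<omega>)) * (c \<bullet> (\<Sum>i\<in>I. Z i \<omega>))))"
    by (intro Bochner_Integration.integral_sum ip[OF _ sumb] borel_measurable_sum rvZ)
  also have "\<dots> = (\<Sum>c\<in>Basis. \<Sum>i\<in>I. expectation (\<lambda>\<omega>. (c \<bullet> Z i \<omega>) * (c \<bullet> Z i \<omega>)))"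
    by (intro sum.cong refl indep_sum_second_moment[OF I indepZ boundZ meanZ])
  also have "\<dots> = (\<Sum>i\<in>I. expectation (\<lambda>\<omega>. \<Sum>c\<in>Basis. (c \<bullet> Z i \<omega>) * (c \<bullet> Z i \<omega>)))"
    by (subst sum.swap) (intro sum.cong refl Bochner_Integration.integral_sum[symmetric] ip[OF rvZ boundZ])
  also have "\<dots> \<le> (\<Sum>i\<in>I. (2 * b)\<^sup>2)"
  proof (rule sum_mono)
    fix i assume i: "i \<in> I"
    have "expectation (\<lambda>\<omega>. \<Sum>c\<in>Basis. (c \<bullet> Z i \<omega>) * (c \<bullet> Z i \<omega>)) \<le> expectation (\<lambda>_. (2 * b)\<^sup>2)"
    proof (rule integral_mono)
      fix \<omega> assume w: "\<omega> \<in> space M"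
      have "(\<Sum>c\<in>Basis. (c \<bullet> Z i \<omega>) * (c \<bullet> Z i \<omega>)) = (norm (Z i \<omega>))\<^sup>2"
        unfolding power2_norm_eq_inner by (subst (2) euclidean_inner) (simp add: inner_commute)
      also have "\<dots> \<le> (2 * b)\<^sup>2" using boundZ[OF i w] by (intro power_mono) auto
      finally show "(\<Sum>c\<in>Basis. (c \<bullet> Z i \<omega>) * (c \<bullet> Z i \<omega>)) \<le> (2 * b)\<^sup>2" .
    qed (use ip[OF rvZ[OF i] boundZ[OF i]] in auto)
    then show "expectation (\<lambda>\<omega>. \<Sum>c\<in>Basis. (c \<bullet> Z i \<omega>) * (c \<bullet> Z i \<omega>)) \<le> (2 * b)\<^sup>2"
      by (simp add: prob_space)
  qed
  finally show ?thesis by simp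
qed

lemma (in prob_space) prob_norm_gt_le:
  fixes f :: "'a \<Rightarrow> 'b::euclidean_space"
  assumes [measurable]: "f \<in> borel_measurable M" and bound: "\<And>\<omega>. \<omega> \<in> space M \<Longrightarrow> norm (f \<omega>) \<le> B"
    and moment: "expectation (\<lambda>\<omega>. (norm (f \<omega>))\<^sup>2) \<le> c" and r: "0 < r"
  shows "prob {\<omega>\<in>space M. norm (f \<omega>) > r} \<le> c / r\<^sup>2"
proof -
  let ?B = "{\<omega>\<in>space M. norm (f \<omega>) > r}"
  have "integrable M (\<lambda>\<omega>. (norm (f \<omega>))\<^sup>2)"
    by (rule integrable_const_bound[where B="B\<^sup>2"]) (use bound in \<open>auto intro!: AE_I2 power_mono\<close>)
  moreover have "integrable M (\<lambda>\<omega>. r\<^sup>2 * indicator ?B \<omega>)"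
    by (rule integrable_const_bound[where B="r\<^sup>2"]) (auto simp: indicator_def)
  ultimately have "expectation (\<lambda>\<omega>. r\<^sup>2 * indicator ?B \<omega>) \<le> expectation (\<lambda>\<omega>. (norm (f \<omega>))\<^sup>2)"
    by (intro integral_mono) (use r in \<open>auto simp: indicator_def intro!: power_mono less_imp_le\<close>)
  with moment have "r\<^sup>2 * prob ?B \<le> c" by simp
  then show ?thesis using r by (simp add: field_simps)
qed

lemma bounded_linear_matrix_form: "bounded_linear (\<lambda>S :: real ^ 'd ^ 'd. u \<bullet> (S *v v))"
  by (intro linear_conv_bounded_linear[THEN iffD1] linearI)
    (simp_all add: matrix_vector_mult_add_rdistrib inner_add_right scaleR_matrix_vector_assoc[symmetric])

lemma symmetric_if_form_symmetric:
  fixes S :: "real ^ 'd ^ 'd"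
  assumes "\<And>u v. u \<bullet> (S *v v) = v \<bullet> (S *v u)"
  shows "transpose S = S"
proof -
  have "transpose S *v v = S *v v" for v
  proof (rule vector_eq_rdot[THEN iffD1], rule allI)
    fix u
    show "(transpose S *v v) \<bullet> u = (S *v v) \<bullet> u"
      using assms[of u v] dot_lmul_matrix[of v S u] vector_transpose_matrix[of v "transpose S"]
      by (simp add: transpose_transpose inner_commute[of u])
  qed
  then show ?thesis using matrix_eq by blast
qed

lemma (in prob_space) expectation_outer_form:
  fixes f :: "'a \<Rightarrow> real ^ 'd"
  assumes [measurable]: "(\<lambda>\<omega>. outer (f \<omega>) (f \<omega>)) \<in> borel_measurable M"
    and bound: "\<And>\<omega>. \<omega> \<in> space M \<Longrightarrow> norm (f \<omega>) \<le> B"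
  shows "u \<bullet> (expectation (\<lambda>\<omega>. outer (f \<omega>) (f \<omega>)) *v v) = expectation (\<lambda>\<omega>. (u \<bullet> f \<omega>) * (v \<bullet> f \<omega>))"
proof -
  have "integrable M (\<lambda>\<omega>. outer (f \<omega>) (f \<omega>))"
  proof (rule integrable_const_bound[where B="B * B"])
    show "AE \<omega> in M. norm (outer (f \<omega>) (f \<omega>)) \<le> B * B"
      using bound by (intro AE_I2) (auto simp: norm_outer intro!: mult_mono order_trans[OF norm_ge_zero])
  qed measurable
  from integral_bounded_linear[OF bounded_linear_matrix_form this, of u v] show ?thesis
    by (simp add: outer_mult_vector inner_commute mult.commute)
qed

section \<open>The standard normal vector\<close>

text \<open>
  Lebesgue measure is a product measure; the lemma serves to factorise the characteristic function of the
  standard normal vector over the coordinates.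
\<close>

lemma lborel_integral_prod:
  fixes f :: "'a::euclidean_space \<Rightarrow> real \<Rightarrow> complex"
  assumes "\<And>b. b \<in> Basis \<Longrightarrow> integrable lborel (f b)"
  shows "(\<integral>x. (\<Prod>b\<in>Basis. f b (x \<bullet> b)) \<partial>lborel) = (\<Prod>b\<in>Basis. \<integral>y. f b y \<partial>lborel)"
proof -
  interpret product_sigma_finite "\<lambda>_::'a. lborel :: real measure" ..
  have [measurable]: "f b \<in> borel_measurable borel" if "b \<in> Basis" for b
    using borel_measurable_integrable[OF assms[OF that]] by simp
  have "(\<integral>x. (\<Prod>b\<in>Basis. f b (x \<bullet> b)) \<partial>(lborel :: 'a measure))
      = (\<integral>y. (\<Prod>b\<in>Basis. f b ((\<Sum>i\<in>Basis. y i *\<^sub>R i) \<bullet> b)) \<partial>(\<Pi>\<^sub>M b\<in>(Basis::'a set). lborel))"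
    by (subst lborel_eq, subst integral_distr) (auto intro!: borel_measurable_prod)
  also have "\<dots> = (\<integral>y. (\<Prod>b\<in>Basis. f b (y b)) \<partial>(\<Pi>\<^sub>M b\<in>(Basis::'a set). lborel))"
    by (intro Bochner_Integration.integral_cong prod.cong) auto
  also have "\<dots> = (\<Prod>b\<in>Basis. \<integral>y. f b y \<partial>lborel)"
    by (rule product_integral_prod) (auto simp: assms)
  finally show ?thesis .
qed

lemma std_normal_density_vec_eq:
  "(\<Prod>i\<in>UNIV. std_normal_density ((z :: real ^ 'd) $ i)) = (\<Prod>b\<in>Basis. std_normal_density (z \<bullet> b))"
proof -
  have inj: "inj (\<lambda>i. axis i (1::real))" by (auto intro!: injI simp: axis_eq_axis)
  have B: "(Basis :: (real ^ 'd) set) = range (\<lambda>i. axis i 1)" by (auto simp: Basis_vec_def)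
  show ?thesis unfolding B by (subst prod.reindex[OF inj]) (simp add: inner_axis)
qed

lemma sets_std_normal_vector [simp]: "sets std_normal_vector = sets borel"
  by (simp add: std_normal_vector_def)

lemma prob_space_std_normal_vector: "prob_space (std_normal_vector :: (real ^ 'd) measure)"
proof
  have "emeasure (std_normal_vector :: (real ^ 'd) measure) UNIV
      = (\<integral>\<^sup>+z. (\<Prod>b\<in>Basis. ennreal (std_normal_density ((z :: real ^ 'd) \<bullet> b))) \<partial>lborel)"
    unfolding std_normal_vector_def
    by (subst emeasure_density)
      (auto simp: std_normal_density_vec_eq prod_ennreal intro!: nn_integral_cong borel_measurable_prod)
  also have "\<dots> = (\<Prod>b\<in>(Basis::(real ^ 'd) set). \<integral>\<^sup>+y. ennreal (std_normal_density y) \<partial>lborel)"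
    by (rule nn_integral_lborel_prod) auto
  also have "(\<integral>\<^sup>+y. ennreal (std_normal_density y) \<partial>lborel) = 1"
    by (subst nn_integral_eq_integral) (auto simp: integrable_normal_density integral_normal_density)
  finally show "emeasure (std_normal_vector :: (real ^ 'd) measure) (space std_normal_vector) = 1"
    by (simp add: std_normal_vector_def)
qed

lemma std_normal_vector_iexp:
  "(\<integral>z. iexp (t \<bullet> z) \<partial>std_normal_vector) = complex_of_real (exp (- (norm t)\<^sup>2 / 2))"
  for t :: "real ^ 'd"
proof -
  let ?f = "\<lambda>b y. std_normal_density y *\<^sub>R iexp ((t \<bullet> b) * y)"
  have one: "(\<integral>y. std_normal_density y *\<^sub>R iexp (s * y) \<partial>lborel) = complex_of_real (exp (- s\<^sup>2 / 2))" for s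
    using fun_cong[OF char_std_normal_distribution, of s] by (simp add: char_def integral_density)
  have "(\<integral>z. iexp (t \<bullet> z) \<partial>std_normal_vector)
    = (\<integral>z. (\<Prod>b\<in>Basis. std_normal_density (z \<bullet> b)) *\<^sub>R iexp (t \<bullet> z) \<partial>lborel)"
    unfolding std_normal_vector_def
    by (subst integral_density) (auto simp: std_normal_density_vec_eq intro!: prod_nonneg borel_measurable_prod)
  also have "\<dots> = (\<integral>z. (\<Prod>b\<in>Basis. ?f b (z \<bullet> b)) \<partial>lborel)"
  proof (rule Bochner_Integration.integral_cong[OF refl])
    fix z :: "real ^ 'd"
    have "iexp (t \<bullet> z) = (\<Prod>b\<in>Basis. iexp ((t \<bullet> b) * (z \<bullet> b)))"
      by (subst euclidean_inner) (simp add: exp_sum[symmetric] sum_distrib_left)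
    then show "(\<Prod>b\<in>Basis. std_normal_density (z \<bullet> b)) *\<^sub>R iexp (t \<bullet> z) = (\<Prod>b\<in>Basis. ?f b (z \<bullet> b))"
      by (simp add: scaleR_conv_of_real prod.distrib)
  qed
  also have "\<dots> = (\<Prod>b\<in>Basis. \<integral>y. ?f b y \<partial>lborel)"
  proof (rule lborel_integral_prod)
    fix b :: "real ^ 'd"
    show "integrable lborel (?f b)"
      by (rule Bochner_Integration.integrable_bound[OF integrable_normal_density[of 1 0]]) auto
  qed
  also have "\<dots> = (\<Prod>b\<in>Basis. complex_of_real (exp (- (t \<bullet> b)\<^sup>2 / 2)))"
    by (simp only: one)
  also have "\<dots> = complex_of_real (exp (\<Sum>b\<in>Basis. - (t \<bullet> b)\<^sup>2 / 2))"
    by (simp add: exp_sum)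
  also have "(\<Sum>b\<in>Basis. - (t \<bullet> b)\<^sup>2 / 2) = - (norm t)\<^sup>2 / 2"
    unfolding power2_norm_eq_inner
    by (subst euclidean_inner[of t t]) (simp add: sum_negf sum_divide_distrib power2_eq_square)
  finally show ?thesis .
qed

lemma std_normal_vector_cos_sin:
  fixes t :: "real ^ 'd"
  shows "(\<integral>z. cos (t \<bullet> z) \<partial>std_normal_vector) = exp (- (norm t)\<^sup>2 / 2)"
    and "(\<integral>z. sin (t \<bullet> z) \<partial>std_normal_vector) = 0"
proof -
  interpret prob_space "std_normal_vector :: (real ^ 'd) measure" by (rule prob_space_std_normal_vector)
  have int: "integrable std_normal_vector (\<lambda>z. iexp (t \<bullet> z))"
    by (rule integrable_iexp) (auto cong: measurable_cong_sets)
  have "complex_of_real (\<integral>z. cos (t \<bullet> z) \<partial>std_normal_vector) = Re (\<integral>z. iexp (t \<bullet> z) \<partial>std_normal_vector)"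
    by (subst integral_Re[OF int, symmetric]) (simp add: Re_exp)
  then show "(\<integral>z. cos (t \<bullet> z) \<partial>std_normal_vector) = exp (- (norm t)\<^sup>2 / 2)"
    by (simp only: std_normal_vector_iexp Re_complex_of_real of_real_eq_iff)
  have "complex_of_real (\<integral>z. sin (t \<bullet> z) \<partial>std_normal_vector) = Im (\<integral>z. iexp (t \<bullet> z) \<partial>std_normal_vector)"
    by (subst integral_Im[OF int, symmetric]) (simp add: Im_exp)
  then show "(\<integral>z. sin (t \<bullet> z) \<partial>std_normal_vector) = 0"
    by (simp only: std_normal_vector_iexp Im_complex_of_real of_real_eq_iff)
qed

section \<open>Trigonometric polynomials and convergence in distribution\<close>

text \<open>
  Trigonometric polynomials: the linear span of the functions whose expectations are the real and imaginary
  parts of characteristic functions.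
\<close>

inductive trig_poly :: "('a::euclidean_space \<Rightarrow> real) \<Rightarrow> bool" where
  cos: "trig_poly (\<lambda>x. cos (t \<bullet> x))"
| sin: "trig_poly (\<lambda>x. sin (t \<bullet> x))"
| add: "trig_poly f \<Longrightarrow> trig_poly g \<Longrightarrow> trig_poly (\<lambda>x. f x + g x)"
| scale: "trig_poly f \<Longrightarrow> trig_poly (\<lambda>x. c * f x)"

lemma trig_poly_const: "trig_poly (\<lambda>x. c)"
  using trig_poly.scale[OF trig_poly.cos[of 0], of c] by simp

lemma trig_poly_sum:
  assumes "finite I" "\<And>i. i \<in> I \<Longrightarrow> trig_poly (f i)"
  shows "trig_poly (\<lambda>x. \<Sum>i\<in>I. f i x)"
  using assms by (induction I rule: finite_induct) (auto intro: trig_poly_const trig_poly.add)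

text \<open>
  Product-to-sum formulas: the span is an algebra, so every polynomial in sines of coordinates belongs to it.
\<close>

lemma trig_poly_mult:
  assumes "trig_poly f" "trig_poly g"
  shows "trig_poly (\<lambda>x. f x * g x)"
proof -
  have lin: "trig_poly (\<lambda>x. a * p x + b * q x)" if "trig_poly p" "trig_poly q" for a b and p q :: "'a \<Rightarrow> real"
    using that by (intro trig_poly.intros)
  have base: "trig_poly (\<lambda>x. h x * cos (t \<bullet> x))" "trig_poly (\<lambda>x. h x * sin (t \<bullet> x))"
    if "trig_poly h" for t and h :: "'a \<Rightarrow> real"
  proof -
    have "trig_poly (\<lambda>x. h x * cos (t \<bullet> x)) \<and> trig_poly (\<lambda>x. h x * sin (t \<bullet> x))"
      using that
    proof (induction h rule: trig_poly.induct)
      case (cos s)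
      have "(\<lambda>x. cos (s \<bullet> x) * cos (t \<bullet> x)) = (\<lambda>x. (1/2) * cos ((s - t) \<bullet> x) + (1/2) * cos ((s + t) \<bullet> x))"
        "(\<lambda>x. cos (s \<bullet> x) * sin (t \<bullet> x)) = (\<lambda>x. (1/2) * sin ((s + t) \<bullet> x) + (-(1/2)) * sin ((s - t) \<bullet> x))"
        by (auto simp: fun_eq_iff inner_diff_left inner_add_left cos_add cos_diff sin_add sin_diff field_simps)
      then show ?case by (simp only:) (intro conjI lin trig_poly.intros)
    next
      case (sin s)
      have "(\<lambda>x. sin (s \<bullet> x) * cos (t \<bullet> x)) = (\<lambda>x. (1/2) * sin ((s + t) \<bullet> x) + (1/2) * sin ((s - t) \<bullet> x))"
        "(\<lambda>x. sin (s \<bullet> x) * sin (t \<bullet> x)) = (\<lambda>x. (1/2) * cos ((s - t) \<bullet> x) + (-(1/2)) * cos ((s + t) \<bullet> x))"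
        by (auto simp: fun_eq_iff inner_diff_left inner_add_left cos_add cos_diff sin_add sin_diff field_simps)
      then show ?case by (simp only:) (intro conjI lin trig_poly.intros)
    next
      case (add f g)
      then show ?case by (auto simp: distrib_right intro: trig_poly.add)
    next
      case (scale f c)
      then show ?case by (auto simp: mult.assoc intro: trig_poly.scale)
    qed
    then show "trig_poly (\<lambda>x. h x * cos (t \<bullet> x))" "trig_poly (\<lambda>x. h x * sin (t \<bullet> x))" by auto
  qed
  from assms(2,1) show ?thesis
  proof (induction g rule: trig_poly.induct)
    case (add g1 g2)
    then show ?case by (auto simp: distrib_left intro: trig_poly.add)
  next
    case (scale g c)
    then show ?case by (auto simp: mult.left_commute intro: trig_poly.scale)
  qed (auto intro: base)
qed

lemma trig_poly_continuous: "trig_poly f \<Longrightarrow> continuous_on UNIV f"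
  by (induction rule: trig_poly.induct) (auto intro!: continuous_intros)

lemma trig_poly_bounded: "trig_poly f \<Longrightarrow> \<exists>C. \<forall>x. \<bar>f x\<bar> \<le> C"
proof (induction rule: trig_poly.induct)
  case (add f g)
  then obtain C D where "\<forall>x. \<bar>f x\<bar> \<le> C" "\<forall>x. \<bar>g x\<bar> \<le> D" by auto
  then have "\<forall>x. \<bar>f x + g x\<bar> \<le> C + D" by (meson abs_triangle_ineq add_mono order_trans)
  then show ?case by blast
next
  case (scale f c)
  then obtain C where "\<forall>x. \<bar>f x\<bar> \<le> C" by auto
  then have "\<forall>x. \<bar>c * f x\<bar> \<le> \<bar>c\<bar> * C" by (auto simp: abs_mult intro: mult_left_mono)
  then show ?case by blast
qed (auto intro: exI[of _ 1])

lemma trig_poly_expectation_tendsto: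
  fixes Z :: "nat \<Rightarrow> 'w \<Rightarrow> 'a::euclidean_space"
  assumes P: "\<And>n. prob_space (P n)" and N: "prob_space N" "sets N = sets borel"
    and Z: "\<And>n. Z n \<in> borel_measurable (P n)"
    and cos: "\<And>t. (\<lambda>n. \<integral>\<omega>. cos (t \<bullet> Z n \<omega>) \<partial>P n) \<longlonglongrightarrow> (\<integral>z. cos (t \<bullet> z) \<partial>N)"
    and sin: "\<And>t. (\<lambda>n. \<integral>\<omega>. sin (t \<bullet> Z n \<omega>) \<partial>P n) \<longlonglongrightarrow> (\<integral>z. sin (t \<bullet> z) \<partial>N)"
    and "trig_poly h"
  shows "(\<lambda>n. \<integral>\<omega>. h (Z n \<omega>) \<partial>P n) \<longlonglongrightarrow> (\<integral>z. h z \<partial>N)"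
  using \<open>trig_poly h\<close>
proof (induction h rule: trig_poly.induct)
  case (add f g)
  have int: "integrable (P n) (\<lambda>\<omega>. p (Z n \<omega>))" "integrable N p" if p: "trig_poly p" for p n
  proof -
    interpret P: prob_space "P n" by (rule P)
    interpret N: prob_space N by (rule N)
    have m: "p \<in> borel_measurable borel" using trig_poly_continuous[OF p] by (rule borel_measurable_continuous_onI)
    obtain C where C: "\<And>x. \<bar>p x\<bar> \<le> C" using trig_poly_bounded[OF p] by blast
    show "integrable (P n) (\<lambda>\<omega>. p (Z n \<omega>))"
      using C by (intro P.integrable_const_bound[where B=C] measurable_compose[OF Z m]) auto
    show "integrable N p"
      using C m N(2) by (intro N.integrable_const_bound[where B=C]) (auto cong: measurable_cong_sets)
  qed
  show ?case
    using add by (simp add: int Bochner_Integration.integral_add tendsto_add)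
next
  case (scale f c)
  then show ?case by (auto intro: tendsto_mult)
qed (auto simp: cos sin)

text \<open>
  Weierstrass approximation on a ball alone would not control the approximant outside the ball.  The remedy
  is the map \<open>x \<mapsto> (sin (x\<^sub>i / R))\<^sub>i\<close> into the cube \<open>[-1, 1]\<^sup>d\<close>, which is injective on the ball of radius \<open>R\<close>.  A polynomial that
  approximates \<open>y \<mapsto> f (R arcsin y\<^sub>i)\<^sub>i\<close> on the whole cube becomes, after composition, a trigonometric polynomial with a global
  bound that is close to \<open>f\<close> on the ball.
\<close>

lemma trig_poly_approximation:
  fixes f :: "'a::euclidean_space \<Rightarrow> real"
  assumes f: "continuous_on UNIV f" and C: "\<And>x. \<bar>f x\<bar> \<le> C" and "R > 0" "e > 0"
  obtains h where "trig_poly h" "\<And>x. \<bar>h x\<bar> \<le> C + e" "\<And>x. norm x \<le> R \<Longrightarrow> \<bar>f x - h x\<bar> \<le> e"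
proof -
  define Q where "Q = cbox (- (\<Sum>i\<in>Basis. i)) (\<Sum>i\<in>Basis. i :: 'a)"
  have Q: "y \<in> Q \<longleftrightarrow> (\<forall>i\<in>Basis. - 1 \<le> y \<bullet> i \<and> y \<bullet> i \<le> 1)" for y
    by (simp add: Q_def mem_box inner_sum_left inner_Basis inner_minus_left sum.delta cong: if_cong)
  define S where "S x = (\<Sum>i\<in>Basis. sin ((x \<bullet> i) / R) *\<^sub>R i)" for x :: 'a
  define A where "A y = (\<Sum>i\<in>Basis. (R * arcsin (y \<bullet> i)) *\<^sub>R i)" for y :: 'a
  have SQ: "S x \<in> Q" for x by (simp add: Q S_def)
  \<comment> \<open>on this ball \<open>x\<^sub>i / R\<close> lies in \<open>[-1, 1]\<close>, where the arcsine inverts the sine\<close>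
  have AS: "A (S x) = x" if "norm x \<le> R" for x
  proof -
    have "R * arcsin (S x \<bullet> i) = x \<bullet> i" if i: "i \<in> Basis" for i
    proof -
      have "\<bar>x \<bullet> i\<bar> \<le> R" using Basis_le_norm[OF i, of x] \<open>norm x \<le> R\<close> by linarith
      then have "- 1 \<le> (x \<bullet> i) / R" "(x \<bullet> i) / R \<le> 1" using \<open>R > 0\<close> by (auto simp: field_simps)
      moreover have "1 \<le> pi / 2" using pi_gt3 by simp
      ultimately have "- (pi / 2) \<le> (x \<bullet> i) / R" "(x \<bullet> i) / R \<le> pi / 2" by linarith+
      then have "arcsin (sin ((x \<bullet> i) / R)) = (x \<bullet> i) / R" by (simp add: arcsin_sin)
      then show ?thesis using i \<open>R > 0\<close> by (simp add: S_def)
    qed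
    then have "A (S x) = (\<Sum>i\<in>Basis. (x \<bullet> i) *\<^sub>R i)" by (simp add: A_def)
    then show ?thesis by (simp add: euclidean_representation)
  qed
  have "continuous_on Q A" unfolding A_def
    by (intro continuous_intros) (auto simp: Q)
  then have "continuous_on Q (\<lambda>y. f (A y))"
    by (rule continuous_on_compose2[OF f]) auto
  moreover have "compact Q" by (simp add: Q_def compact_cbox)
  ultimately obtain g where g: "real_polynomial_function g" "\<And>y. y \<in> Q \<Longrightarrow> \<bar>f (A y) - g y\<bar> < e"
    using Stone_Weierstrass_real_polynomial_function \<open>e > 0\<close> by metis
  have "trig_poly (\<lambda>x. g (S x))"
    using g(1)
  proof (induction g rule: real_polynomial_function.induct)
    case (linear h)
    interpret h: bounded_linear h by fact
    have "h (S x) = (\<Sum>i\<in>Basis. h i * sin (((1 / R) *\<^sub>R i) \<bullet> x))" for x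
      by (simp add: S_def h.sum h.scaleR inner_commute mult.commute)
    then show ?case by (simp only:) (intro trig_poly_sum trig_poly.scale trig_poly.sin finite_Basis)
  qed (auto intro: trig_poly_const trig_poly.add trig_poly_mult)
  moreover have "\<bar>g (S x)\<bar> \<le> C + e" for x
    using g(2)[OF SQ, of x] C[of "A (S x)"] by linarith
  moreover have "\<bar>f x - g (S x)\<bar> \<le> e" if "norm x \<le> R" for x
    using g(2)[OF SQ, of x] AS[OF that] by simp
  ultimately show thesis using that by blast
qed

lemma (in prob_space) expectation_diff_le_truncated:
  fixes Z :: "'a \<Rightarrow> 'b::euclidean_space" and f h :: "'b \<Rightarrow> real"
  assumes Z[measurable]: "Z \<in> borel_measurable M"
    and [measurable]: "f \<in> borel_measurable borel" "h \<in> borel_measurable borel"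
    and f: "\<And>x. \<bar>f x\<bar> \<le> C" and h: "\<And>x. \<bar>h x\<bar> \<le> C'"
    and close: "\<And>x. norm x \<le> R \<Longrightarrow> \<bar>f x - h x\<bar> \<le> e" and "e \<ge> 0"
  shows "\<bar>(\<integral>\<omega>. f (Z \<omega>) \<partial>M) - (\<integral>\<omega>. h (Z \<omega>) \<partial>M)\<bar> \<le> e + (C + C') * prob {\<omega>\<in>space M. norm (Z \<omega>) > R}"
proof -
  let ?B = "{\<omega>\<in>space M. norm (Z \<omega>) > R}"
  have B: "?B \<in> events" by measurable
  have [simp]: "integrable M (indicator ?B :: 'a \<Rightarrow> real)"
    using B by (intro integrable_const_bound[where B=1]) (auto simp: indicator_def)
  have [simp]: "integrable M (\<lambda>\<omega>. f (Z \<omega>))" "integrable M (\<lambda>\<omega>. h (Z \<omega>))"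
    by (rule integrable_const_bound[where B=C], use f in auto) (rule integrable_const_bound[where B=C'], use h in auto)
  have le: "\<bar>f (Z \<omega>) - h (Z \<omega>)\<bar> \<le> e + (C + C') * indicator ?B \<omega>" if "\<omega> \<in> space M" for \<omega>
    using close[of "Z \<omega>"] f[of "Z \<omega>"] h[of "Z \<omega>"] that \<open>e \<ge> 0\<close>
    by (auto simp: indicator_def not_less)
  have "\<bar>(\<integral>\<omega>. f (Z \<omega>) \<partial>M) - (\<integral>\<omega>. h (Z \<omega>) \<partial>M)\<bar> = \<bar>\<integral>\<omega>. f (Z \<omega>) - h (Z \<omega>) \<partial>M\<bar>" by simp
  also have "\<dots> \<le> (\<integral>\<omega>. \<bar>f (Z \<omega>) - h (Z \<omega>)\<bar> \<partial>M)" by (rule integral_abs_bound)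
  also have "\<dots> \<le> (\<integral>\<omega>. e + (C + C') * indicator ?B \<omega> \<partial>M)"
    using B le by (intro integral_mono) (auto intro!: integrable_abs Bochner_Integration.integrable_add)
  also have "\<dots> = e + (C + C') * prob ?B"
    using B by (subst Bochner_Integration.integral_add) (auto simp: prob_space)
  finally show ?thesis .
qed

text \<open>
  Levy's continuity theorem for random vectors, with tightness as a hypothesis: by tightness it suffices to
  approximate \<open>f\<close> on a large ball by a trigonometric polynomial with a global bound.
\<close>

theorem converges_in_distribution_if_trig_moments:
  fixes Z :: "nat \<Rightarrow> 'w \<Rightarrow> 'a::euclidean_space"
  assumes P: "\<And>n. prob_space (P n)" and N: "prob_space N" "sets N = sets borel"
    and Z: "\<And>n. Z n \<in> borel_measurable (P n)"
    and cos: "\<And>t. (\<lambda>n. \<integral>\<omega>. cos (t \<bullet> Z n \<omega>) \<partial>P n) \<longlonglongrightarrow> (\<integral>z. cos (t \<bullet> z) \<partial>N)"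
    and sin: "\<And>t. (\<lambda>n. \<integral>\<omega>. sin (t \<bullet> Z n \<omega>) \<partial>P n) \<longlonglongrightarrow> (\<integral>z. sin (t \<bullet> z) \<partial>N)"
    and tight: "\<And>e. e > 0 \<Longrightarrow> \<exists>R. \<forall>\<^sub>F n in sequentially. measure (P n) {\<omega> \<in> space (P n). norm (Z n \<omega>) > R} \<le> e"
  shows "converges_in_distribution P Z N"
  unfolding converges_in_distribution_def
proof (intro allI impI tendstoI)
  fix f :: "'a \<Rightarrow> real" and e :: real
  assume f: "continuous_on UNIV f" and bdd: "bounded (range f)" and e: "e > 0"
  interpret P: prob_space "P n" for n by (rule P)
  interpret N: prob_space N by (rule N)
  have spN: "space N = UNIV" using sets_eq_imp_space_eq[OF N(2)] by simp
  obtain C where "C > 0" and C: "\<And>x. \<bar>f x\<bar> \<le> C"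
    using bdd by (auto simp: bounded_pos)
  define D where "D = 2 * C + e + 2"
  \<comment> \<open>small enough that \<open>d\<close> plus a tail of probability \<open>d\<close> times the sum of both bounds is below \<open>e / 3\<close>\<close>
  define d where "d = e / (6 * D)"
  have D: "D \<ge> 1" using e \<open>C > 0\<close> by (simp add: D_def)
  have d: "d > 0" "d \<le> e" using e D by (auto simp: d_def divide_le_eq)
  have bound: "d + (C + (C + d)) * d < e / 3"
  proof -
    have "d + (C + (C + d)) * d \<le> d * (2 * C + e + 1)" using d by (simp add: algebra_simps)
    also have "\<dots> < d * D" using d by (intro mult_strict_left_mono) (auto simp: D_def)
    also have "\<dots> = e / 6" using D by (simp add: d_def)
    finally show ?thesis using e by simp
  qed
  obtain R1 where R1: "\<forall>\<^sub>F n in sequentially. measure (P n) {\<omega> \<in> space (P n). norm (Z n \<omega>) > R1} \<le> d"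
    using tight[OF d(1)] by blast
  obtain R2 where R2: "measure N {z. norm z > R2} \<le> d"
  proof -
    have "(\<lambda>n. measure N {z. norm z > real n}) \<longlonglongrightarrow> measure N (\<Inter>n. {z :: 'a. norm z > real n})"
      by (rule N.finite_Lim_measure_decseq) (auto simp: N(2) decseq_def)
    moreover have "(\<Inter>n. {z :: 'a. norm z > real n}) = {}"
      using real_arch_simple[of "norm z" for z :: 'a] by (auto simp: set_eq_iff not_less)
    ultimately have "(\<lambda>n. measure N {z. norm z > real n}) \<longlonglongrightarrow> 0" by simp
    from order_tendstoD(2)[OF this d(1)] obtain n where "measure N {z. norm z > real n} < d"
      by (auto simp: eventually_sequentially)
    then show thesis using that[of "real n"] by simp
  qed
  define R where "R = max 1 (max R1 R2)"
  have "R > 0" by (simp add: R_def)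
  obtain h where h: "trig_poly h" "\<And>x. \<bar>h x\<bar> \<le> C + d" "\<And>x. norm x \<le> R \<Longrightarrow> \<bar>f x - h x\<bar> \<le> d"
    using trig_poly_approximation[OF f C \<open>R > 0\<close> d(1)] by blast
  have meas[measurable]: "f \<in> borel_measurable borel" "h \<in> borel_measurable borel"
    using f trig_poly_continuous[OF h(1)] by (auto intro: borel_measurable_continuous_onI)
  have "\<bar>(\<integral>z. f z \<partial>N) - (\<integral>z. h z \<partial>N)\<bar> \<le> d + (C + (C + d)) * measure N {\<omega> \<in> space N. norm \<omega> > R}"
    using d(1) N(2) by (intro N.expectation_diff_le_truncated[of "\<lambda>z. z"] C h meas) (auto cong: measurable_cong_sets)
  moreover have "measure N {\<omega> \<in> space N. norm \<omega> > R} \<le> measure N {z. norm z > R2}"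
    by (intro N.finite_measure_mono) (auto simp: N(2) R_def)
  ultimately have fN: "\<bar>(\<integral>z. f z \<partial>N) - (\<integral>z. h z \<partial>N)\<bar> < e / 3"
    using bound R2 mult_left_mono[of _ d "C + (C + d)"] d(1) \<open>C > 0\<close> by (smt (verit))
  have "\<forall>\<^sub>F n in sequentially. \<bar>(\<integral>\<omega>. h (Z n \<omega>) \<partial>P n) - (\<integral>z. h z \<partial>N)\<bar> < e / 3"
    using tendstoD[OF trig_poly_expectation_tendsto[OF P N Z cos sin h(1)], of "e / 3"] e by (simp add: dist_real_def)
  with R1 show "\<forall>\<^sub>F n in sequentially. dist (\<integral>\<omega>. f (Z n \<omega>) \<partial>P n) (\<integral>z. f z \<partial>N) < e"
  proof eventually_elim
    case (elim n)
    have "\<bar>(\<integral>\<omega>. f (Z n \<omega>) \<partial>P n) - (\<integral>\<omega>. h (Z n \<omega>) \<partial>P n)\<bar>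
      \<le> d + (C + (C + d)) * measure (P n) {\<omega> \<in> space (P n). norm (Z n \<omega>) > R}"
      using d(1) by (intro P.expectation_diff_le_truncated C h meas Z) auto
    moreover have "measure (P n) {\<omega> \<in> space (P n). norm (Z n \<omega>) > R} \<le> measure (P n) {\<omega> \<in> space (P n). norm (Z n \<omega>) > R1}"
      using Z[of n, measurable] by (intro P.finite_measure_mono) (auto simp: R_def)
    ultimately have "\<bar>(\<integral>\<omega>. f (Z n \<omega>) \<partial>P n) - (\<integral>\<omega>. h (Z n \<omega>) \<partial>P n)\<bar> < e / 3"
      using bound elim(1) mult_left_mono[of _ d "C + (C + d)"] d(1) \<open>C > 0\<close> by (smt (verit))
    then show ?case using elim(2) fN unfolding dist_real_def by linarith
  qed
qed

text \<open>
  A perturbation that tends to zero in probability changes the expectations of the Lipschitz functions sine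
  and cosine by a null sequence and preserves tightness.
\<close>

lemma converges_in_distribution_slutsky:
  fixes Z W :: "nat \<Rightarrow> 'w \<Rightarrow> 'a::euclidean_space"
  assumes P: "\<And>n. prob_space (P n)" and N: "prob_space N" "sets N = sets borel"
    and Z: "\<And>n. Z n \<in> borel_measurable (P n)" and W: "\<And>n. W n \<in> borel_measurable (P n)"
    and cos: "\<And>t. (\<lambda>n. \<integral>\<omega>. cos (t \<bullet> Z n \<omega>) \<partial>P n) \<longlonglongrightarrow> (\<integral>z. cos (t \<bullet> z) \<partial>N)"
    and sin: "\<And>t. (\<lambda>n. \<integral>\<omega>. sin (t \<bullet> Z n \<omega>) \<partial>P n) \<longlonglongrightarrow> (\<integral>z. sin (t \<bullet> z) \<partial>N)"
    and tight: "\<And>e. e > 0 \<Longrightarrow> \<exists>R. \<forall>\<^sub>F n in sequentially. measure (P n) {\<omega> \<in> space (P n). norm (Z n \<omega>) > R} \<le> e"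
    and close: "converges_in_probability P (\<lambda>n \<omega>. W n \<omega> - Z n \<omega>) 0"
  shows "converges_in_distribution P W N"
proof (rule converges_in_distribution_if_trig_moments[OF P N W])
  interpret P: prob_space "P n" for n by (rule P)
  note [measurable] = Z W
  have closeD: "\<forall>\<^sub>F n in sequentially. measure (P n) {\<omega> \<in> space (P n). norm (W n \<omega> - Z n \<omega>) > d} < e"
    if "d > 0" "e > 0" for d e
    using close that by (auto simp: converges_in_probability_def dist_norm intro: order_tendstoD)
  have diff: "(\<lambda>n. (\<integral>\<omega>. F (t \<bullet> W n \<omega>) \<partial>P n) - (\<integral>\<omega>. F (t \<bullet> Z n \<omega>) \<partial>P n)) \<longlonglongrightarrow> 0"
    if F: "\<And>x y. \<bar>F x - F y\<bar> \<le> \<bar>x - y\<bar>" "\<And>x. \<bar>F x\<bar> \<le> 1" "F \<in> borel_measurable borel" for F :: "real \<Rightarrow> real" and t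
  proof (rule tendstoI)
    fix e :: real assume e: "e > 0"
    define d where "d = e / (2 * (norm t + 1))"
    have nt: "norm t + 1 > 0" by (smt (verit) norm_ge_zero)
    have d: "d > 0" "norm t * d \<le> e / 2"
      using e nt by (auto simp: d_def field_simps)
    have "\<forall>\<^sub>F n in sequentially. measure (P n) {\<omega> \<in> space (P n). norm (W n \<omega> - Z n \<omega>) > d} < e / 4"
      by (rule closeD) (use d e in auto)
    then show "\<forall>\<^sub>F n in sequentially. dist ((\<integral>\<omega>. F (t \<bullet> W n \<omega>) \<partial>P n) - (\<integral>\<omega>. F (t \<bullet> Z n \<omega>) \<partial>P n)) 0 < e"
    proof eventually_elim
      case (elim n)
      let ?B = "{\<omega> \<in> space (P n). norm (W n \<omega> - Z n \<omega>) > d}"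
      have B: "?B \<in> P.events n" by measurable
      have [simp]: "integrable (P n) (indicator ?B :: 'w \<Rightarrow> real)"
        using B by (intro P.integrable_const_bound[where B=1]) (auto simp: indicator_def)
      have [measurable]: "F \<in> borel_measurable borel" by fact
      have [simp]: "integrable (P n) (\<lambda>\<omega>. F (t \<bullet> W n \<omega>))" "integrable (P n) (\<lambda>\<omega>. F (t \<bullet> Z n \<omega>))"
        by (auto intro!: P.integrable_const_bound[where B=1] simp: F(2))
      have le: "\<bar>F (t \<bullet> W n \<omega>) - F (t \<bullet> Z n \<omega>)\<bar> \<le> e / 2 + 2 * indicator ?B \<omega>" if "\<omega> \<in> space (P n)" for \<omega>
      proof (cases "\<omega> \<in> ?B")
        case True
        then show ?thesis using F(2)[of "t \<bullet> W n \<omega>"] F(2)[of "t \<bullet> Z n \<omega>"] e by simp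
      next
        case False
        have "\<bar>F (t \<bullet> W n \<omega>) - F (t \<bullet> Z n \<omega>)\<bar> \<le> \<bar>t \<bullet> (W n \<omega> - Z n \<omega>)\<bar>"
          using F(1) by (simp add: inner_diff_right)
        also have "\<dots> \<le> norm t * norm (W n \<omega> - Z n \<omega>)" by (rule Cauchy_Schwarz_ineq2)
        also have "\<dots> \<le> norm t * d" using False that by (intro mult_left_mono) auto
        finally show ?thesis using d(2) False by simp
      qed
      have "\<bar>(\<integral>\<omega>. F (t \<bullet> W n \<omega>) \<partial>P n) - (\<integral>\<omega>. F (t \<bullet> Z n \<omega>) \<partial>P n)\<bar> = \<bar>\<integral>\<omega>. F (t \<bullet> W n \<omega>) - F (t \<bullet> Z n \<omega>) \<partial>P n\<bar>"
        by simp
      also have "\<dots> \<le> (\<integral>\<omega>. \<bar>F (t \<bullet> W n \<omega>) - F (t \<bullet> Z n \<omega>)\<bar> \<partial>P n)" by (rule integral_abs_bound)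
      also have "\<dots> \<le> (\<integral>\<omega>. e / 2 + 2 * indicator ?B \<omega> \<partial>P n)"
        using B le by (intro integral_mono) (auto intro!: integrable_abs Bochner_Integration.integrable_add)
      also have "\<dots> = e / 2 + 2 * measure (P n) ?B"
        using B by (subst Bochner_Integration.integral_add) (auto simp: P.prob_space)
      finally show ?case using elim by simp
    qed
  qed
  have lip: "\<bar>cos x - cos y\<bar> \<le> \<bar>x - y\<bar>" "\<bar>sin x - sin y\<bar> \<le> \<bar>x - y\<bar>" for x y :: real
  proof -
    have "norm (cos x - cos y) \<le> 1 * norm (x - y)"
      by (rule field_differentiable_bound[of UNIV cos "\<lambda>x. - sin x"]) (auto intro!: derivative_eq_intros)
    moreover have "norm (sin x - sin y) \<le> 1 * norm (x - y)"
      by (rule field_differentiable_bound[of UNIV sin cos]) (auto intro!: derivative_eq_intros)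
    ultimately show "\<bar>cos x - cos y\<bar> \<le> \<bar>x - y\<bar>" "\<bar>sin x - sin y\<bar> \<le> \<bar>x - y\<bar>" by auto
  qed
  show "(\<lambda>n. \<integral>\<omega>. cos (t \<bullet> W n \<omega>) \<partial>P n) \<longlonglongrightarrow> (\<integral>z. cos (t \<bullet> z) \<partial>N)" for t
    using tendsto_add[OF cos[of t] diff[of cos t]] lip by simp
  show "(\<lambda>n. \<integral>\<omega>. sin (t \<bullet> W n \<omega>) \<partial>P n) \<longlonglongrightarrow> (\<integral>z. sin (t \<bullet> z) \<partial>N)" for t
    using tendsto_add[OF sin[of t] diff[of sin t]] lip by simp
  fix e :: real assume e: "e > 0"
  obtain R where R: "\<forall>\<^sub>F n in sequentially. measure (P n) {\<omega> \<in> space (P n). norm (Z n \<omega>) > R} \<le> e / 2"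
    using tight[of "e / 2"] e by auto
  have "\<forall>\<^sub>F n in sequentially. measure (P n) {\<omega> \<in> space (P n). norm (W n \<omega> - Z n \<omega>) > 1} < e / 2"
    by (rule closeD) (use e in auto)
  with R have "\<forall>\<^sub>F n in sequentially. measure (P n) {\<omega> \<in> space (P n). norm (W n \<omega>) > R + 1} \<le> e"
  proof eventually_elim
    case (elim n)
    have "measure (P n) {\<omega> \<in> space (P n). norm (W n \<omega>) > R + 1}
      \<le> measure (P n) ({\<omega> \<in> space (P n). norm (Z n \<omega>) > R} \<union> {\<omega> \<in> space (P n). norm (W n \<omega> - Z n \<omega>) > 1})"
    proof (rule P.finite_measure_mono)
      show "{\<omega> \<in> space (P n). norm (W n \<omega>) > R + 1} \<subseteq> {\<omega> \<in> space (P n). norm (Z n \<omega>) > R} \<union> {\<omega> \<in> space (P n). norm (W n \<omega> - Z n \<omega>) > 1}"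
      proof
        fix \<omega> assume "\<omega> \<in> {\<omega> \<in> space (P n). norm (W n \<omega>) > R + 1}"
        then show "\<omega> \<in> {\<omega> \<in> space (P n). norm (Z n \<omega>) > R} \<union> {\<omega> \<in> space (P n). norm (W n \<omega> - Z n \<omega>) > 1}"
          using norm_triangle_sub[of "W n \<omega>" "Z n \<omega>"] by auto
      qed
    qed measurable
    also have "\<dots> \<le> measure (P n) {\<omega> \<in> space (P n). norm (Z n \<omega>) > R} + measure (P n) {\<omega> \<in> space (P n). norm (W n \<omega> - Z n \<omega>) > 1}"
      by (intro measure_Un_le) measurable
    finally show ?case using elim by linarith
  qed
  then show "\<exists>R. \<forall>\<^sub>F n in sequentially. measure (P n) {\<omega> \<in> space (P n). norm (W n \<omega>) > R} \<le> e" by blast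
qed

section \<open>Analysis of the Stein estimating function\<close>

lemma logistic_bounds: "0 < logistic t" "logistic t < 1"
  by (auto simp: logistic_def divide_simps add_pos_pos)

lemma has_real_derivative_logistic:
  "(logistic has_real_derivative logistic t * (1 - logistic t)) (at t)"
proof -
  have "1 + exp (- t) \<noteq> 0" by (smt (verit) exp_gt_zero)
  then have "((\<lambda>t. 1 / (1 + exp (- t))) has_real_derivative logistic t * (1 - logistic t)) (at t)"
    by (auto intro!: derivative_eq_intros simp: logistic_def field_simps power2_eq_square)
  then show ?thesis by (simp add: logistic_def[abs_def])
qed

lemma deriv_logistic: "deriv logistic t = logistic t * (1 - logistic t)"
  by (rule DERIV_imp_deriv) (rule has_real_derivative_logistic)

lemma deriv_logistic_bounds: "0 \<le> deriv logistic t" "deriv logistic t \<le> 1"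
  using logistic_bounds[of t] by (auto simp: deriv_logistic intro!: mult_le_one)

text \<open>
  Since \<open>\<sigma>'(t) = 1 / ((1 + exp (-t)) (1 + exp t)) = 1 / (2 + exp t + exp (-t))\<close> and each of the four unit summands of the denominator is
  at most \<open>exp \<bar>t\<bar>\<close>.  This is the source of the factor \<open>exp (2 R D)\<close> in the growth condition: the bound is applied with \<open>b = R D\<close>
  and enters the error squared.
\<close>

lemma deriv_logistic_ge:
  assumes "\<bar>t\<bar> \<le> b"
  shows "exp (- b) / 4 \<le> deriv logistic t"
proof -
  have "exp t \<le> exp b" "exp (- t) \<le> exp b" "1 \<le> exp b" using assms by auto
  moreover have "(1 + exp (- t)) * (1 + exp t) = 2 + exp t + exp (- t)"
    by (simp add: distrib_left distrib_right mult_exp_exp)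
  ultimately have "(1 + exp (- t)) * (1 + exp t) \<le> 4 * exp b" by linarith
  moreover have pos: "0 < (1 + exp (- t)) * (1 + exp t)" by (intro mult_pos_pos add_pos_pos) auto
  ultimately have "1 / (4 * exp b) \<le> 1 / ((1 + exp (- t)) * (1 + exp t))"
    by (intro divide_left_mono) auto
  also have "1 / ((1 + exp (- t)) * (1 + exp t)) = logistic t * (1 - logistic t)"
  proof -
    have "1 - logistic t = 1 / (1 + exp t)"
    proof -
      have "exp t * exp (- t) = 1" by (simp add: mult_exp_exp)
      moreover have "1 + exp t \<noteq> 0" "1 + exp (- t) \<noteq> 0" by (smt (verit) exp_gt_zero)+
      ultimately show ?thesis by (simp add: logistic_def field_simps)
    qed
    then show ?thesis by (simp add: logistic_def)
  qed
  finally show ?thesis by (simp add: deriv_logistic exp_minus inverse_eq_divide)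
qed

lemma deriv_logistic_lipschitz: "\<bar>deriv logistic a - deriv logistic b\<bar> \<le> \<bar>a - b\<bar>"
proof -
  have "norm (deriv logistic a - deriv logistic b) \<le> 1 * norm (a - b)"
  proof (rule field_differentiable_bound[of UNIV _ "\<lambda>t. deriv logistic t * (1 - 2 * logistic t)"])
    fix t :: real
    have "((\<lambda>t. logistic t * (1 - logistic t)) has_real_derivative deriv logistic t * (1 - 2 * logistic t)) (at t)"
      by (auto intro!: derivative_eq_intros has_real_derivative_logistic simp: deriv_logistic algebra_simps)
    then show "(deriv logistic has_field_derivative deriv logistic t * (1 - 2 * logistic t)) (at t within UNIV)"
      by (simp add: deriv_logistic[abs_def])
    have "\<bar>1 - 2 * logistic t\<bar> \<le> 1" using logistic_bounds[of t] by auto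
    then show "norm (deriv logistic t * (1 - 2 * logistic t)) \<le> 1"
      using deriv_logistic_bounds[of t] by (auto simp: abs_mult intro!: mult_le_one)
  qed auto
  then show ?thesis by simp
qed

lemma logistic_mean_value:
  obtains c where "min a b \<le> c" "c \<le> max a b" "logistic a - logistic b = deriv logistic c * (a - b)"
proof -
  have *: "\<exists>c. x \<le> c \<and> c \<le> y \<and> logistic y - logistic x = deriv logistic c * (y - x)" if "x \<le> y" for x y
  proof (cases "x = y")
    case False
    with that have "x < y" by simp
    from MVT2[OF this, of logistic "deriv logistic"] obtain c
      where "x < c" "c < y" "logistic y - logistic x = (y - x) * deriv logistic c"
      using has_real_derivative_logistic by (auto simp: deriv_logistic)
    then show ?thesis by (auto simp: mult.commute intro!: exI[of _ c])
  qed auto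
  show thesis
  proof (cases "a \<le> b")
    case True
    from *[OF this] obtain c where "a \<le> c" "c \<le> b" "logistic b - logistic a = deriv logistic c * (b - a)" by blast
    then show ?thesis using that[of c] True by (auto simp: min_def max_def algebra_simps)
  next
    case False
    from *[of b a] obtain c where "b \<le> c" "c \<le> a" "logistic a - logistic b = deriv logistic c * (a - b)" using False by auto
    then show ?thesis using that[of c] False by (auto simp: min_def max_def)
  qed
qed

lemma logistic_strongly_monotone:
  assumes "\<bar>a\<bar> \<le> c" "\<bar>b\<bar> \<le> c"
  shows "exp (- c) / 4 * (a - b)\<^sup>2 \<le> (logistic a - logistic b) * (a - b)"
proof -
  obtain z where z: "min a b \<le> z" "z \<le> max a b" "logistic a - logistic b = deriv logistic z * (a - b)"
    by (rule logistic_mean_value)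
  have "\<bar>z\<bar> \<le> c" using z(1,2) assms by (auto simp: min_def max_def split: if_splits)
  from mult_right_mono[OF deriv_logistic_ge[OF this], of "(a - b)\<^sup>2"] show ?thesis
    by (simp add: z(3) power2_eq_square mult.assoc)
qed

lemma logistic_taylor: "\<bar>logistic a - logistic b - deriv logistic b * (a - b)\<bar> \<le> (a - b)\<^sup>2"
proof -
  obtain z where z: "min a b \<le> z" "z \<le> max a b" "logistic a - logistic b = deriv logistic z * (a - b)"
    by (rule logistic_mean_value)
  have "\<bar>deriv logistic z - deriv logistic b\<bar> \<le> \<bar>a - b\<bar>"
    using deriv_logistic_lipschitz[of z b] z(1,2) by (auto simp: min_def max_def split: if_splits)
  from mult_right_mono[OF this, of "\<bar>a - b\<bar>"] show ?thesis
    by (simp add: z(3) abs_mult[symmetric] left_diff_distrib[symmetric] power2_eq_square)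
qed

lemma stein_h_eq: 
  "stein_h E s x \<beta> = (\<Sum>m\<in>E. logistic (\<beta> \<bullet> edge_diff m s x) *\<^sub>R edge_diff m s x + (s (x(m := 0)) - s x))"
  by (simp add: stein_h_def add_diff_eq)

lemma stein_g_diff:
  "stein_g I A s x \<beta> - stein_g I A s x \<beta>' = (\<Sum>p\<in>I. \<Sum>m\<in>edges A p.
     (logistic (\<beta> \<bullet> edge_diff m (s p) (x p)) - logistic (\<beta>' \<bullet> edge_diff m (s p) (x p))) *\<^sub>R edge_diff m (s p) (x p))"
  by (simp add: stein_g_def stein_h_eq sum_subtractf[symmetric] scaleR_diff_left)

lemma abs_inner_le:
  assumes "norm \<beta> \<le> R" "norm v \<le> D" "0 \<le> D"
  shows "\<bar>\<beta> \<bullet> v\<bar> \<le> R * D"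
  using order_trans[OF Cauchy_Schwarz_ineq2[of \<beta> v] mult_mono[OF assms(1,2)]] assms
    order_trans[OF norm_ge_zero assms(1)] by simp

text \<open>
  The score is monotone with a modulus given by \<open>\<Sum> \<Delta> \<Delta>\<^sup>T\<close>, because every argument of the logistic function stays in
  \<open>[-RD, RD]\<close> as long as both parameters lie in the ball of radius \<open>R\<close>.
\<close>

lemma stein_g_strongly_monotone:
  fixes \<beta> \<beta>' :: "real ^ 'd"
  assumes D: "\<And>p m. p \<in> I \<Longrightarrow> m \<in> edges A p \<Longrightarrow> norm (edge_diff m (s p) (x p)) \<le> D" "0 \<le> D"
    and \<beta>: "norm \<beta> \<le> R" "norm \<beta>' \<le> R"
  shows "exp (- (R * D)) / 4 * ((\<beta> - \<beta>') \<bullet> ((\<Sum>p\<in>I. \<Sum>m\<in>edges A p. outer (edge_diff m (s p) (x p)) (edge_diff m (s p) (x p))) *v (\<beta> - \<beta>')))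
    \<le> (\<beta> - \<beta>') \<bullet> (stein_g I A s x \<beta> - stein_g I A s x \<beta>')"
proof -
  have "exp (- (R * D)) / 4 * ((\<beta> - \<beta>') \<bullet> ((\<Sum>p\<in>I. \<Sum>m\<in>edges A p. outer (edge_diff m (s p) (x p)) (edge_diff m (s p) (x p))) *v (\<beta> - \<beta>')))
    = (\<Sum>p\<in>I. \<Sum>m\<in>edges A p. exp (- (R * D)) / 4 * ((\<beta> \<bullet> edge_diff m (s p) (x p)) - (\<beta>' \<bullet> edge_diff m (s p) (x p)))\<^sup>2)"
    by (simp add: matrix_vector_mult_sum inner_sum_right sum_distrib_left outer_mult_vector
        inner_diff_left inner_diff_right inner_commute power2_eq_square mult.assoc)
  also have "\<dots> \<le> (\<Sum>p\<in>I. \<Sum>m\<in>edges A p. (logistic (\<beta> \<bullet> edge_diff m (s p) (x p)) - logistic (\<beta>' \<bullet> edge_diff m (s p) (x p)))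
      * ((\<beta> \<bullet> edge_diff m (s p) (x p)) - (\<beta>' \<bullet> edge_diff m (s p) (x p))))"
    by (intro sum_mono logistic_strongly_monotone abs_inner_le \<beta> D)
  also have "\<dots> = (\<beta> - \<beta>') \<bullet> (stein_g I A s x \<beta> - stein_g I A s x \<beta>')"
    unfolding stein_g_diff by (simp add: inner_sum_right inner_diff_left)
  finally show ?thesis .
qed

lemma stein_g_taylor:
  fixes \<beta> \<beta>' :: "real ^ 'd"
  assumes D: "\<And>p m. p \<in> I \<Longrightarrow> m \<in> edges A p \<Longrightarrow> norm (edge_diff m (s p) (x p)) \<le> D" "0 \<le> D"
    and a: "\<And>p. p \<in> I \<Longrightarrow> real (card (edges A p)) \<le> a"
  shows "norm (stein_g I A s x \<beta> - stein_g I A s x \<beta>' - stein_hessian I A s x \<beta>' *v (\<beta> - \<beta>'))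
    \<le> real (card I) * a * D ^ 3 * (norm (\<beta> - \<beta>'))\<^sup>2"
proof -
  let ?d = "\<lambda>p m. edge_diff m (s p) (x p)"
  have "stein_g I A s x \<beta> - stein_g I A s x \<beta>' - stein_hessian I A s x \<beta>' *v (\<beta> - \<beta>')
    = (\<Sum>p\<in>I. \<Sum>m\<in>edges A p. (logistic (\<beta> \<bullet> ?d p m) - logistic (\<beta>' \<bullet> ?d p m)
        - deriv logistic (\<beta>' \<bullet> ?d p m) * (\<beta> \<bullet> ?d p m - \<beta>' \<bullet> ?d p m)) *\<^sub>R ?d p m)"
    unfolding stein_g_diff stein_hessian_def
    by (simp add: matrix_vector_mult_sum scaleR_matrix_vector_assoc[symmetric] outer_mult_vector
        sum_subtractf[symmetric] scaleR_diff_left scaleR_diff_right right_diff_distrib inner_diff_left inner_diff_right inner_commute)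
  also have "norm \<dots> \<le> (\<Sum>p\<in>I. \<Sum>m\<in>edges A p. D ^ 3 * (norm (\<beta> - \<beta>'))\<^sup>2)"
  proof (intro order_trans[OF norm_sum sum_mono] order_trans[OF norm_sum])
    fix p m assume p: "p \<in> I" "m \<in> edges A p"
    have "norm ((logistic (\<beta> \<bullet> ?d p m) - logistic (\<beta>' \<bullet> ?d p m)
        - deriv logistic (\<beta>' \<bullet> ?d p m) * (\<beta> \<bullet> ?d p m - \<beta>' \<bullet> ?d p m)) *\<^sub>R ?d p m)
      \<le> (\<beta> \<bullet> ?d p m - \<beta>' \<bullet> ?d p m)\<^sup>2 * norm (?d p m)"
      using logistic_taylor by (auto intro!: mult_right_mono)
    also have "\<dots> \<le> (norm (\<beta> - \<beta>') * D)\<^sup>2 * D"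
    proof (intro mult_mono D p)
      have "\<bar>(\<beta> - \<beta>') \<bullet> ?d p m\<bar> \<le> norm (\<beta> - \<beta>') * D"
        by (intro abs_inner_le D p order_refl)
      from power_mono[OF this, of 2] show "(\<beta> \<bullet> ?d p m - \<beta>' \<bullet> ?d p m)\<^sup>2 \<le> (norm (\<beta> - \<beta>') * D)\<^sup>2"
        by (simp add: inner_diff_left)
    qed auto
    also have "\<dots> = D ^ 3 * (norm (\<beta> - \<beta>'))\<^sup>2"
      by (simp add: power2_eq_square power3_eq_cube)
    finally show "norm ((logistic (\<beta> \<bullet> ?d p m) - logistic (\<beta>' \<bullet> ?d p m)
        - deriv logistic (\<beta>' \<bullet> ?d p m) * (\<beta> \<bullet> ?d p m - \<beta>' \<bullet> ?d p m)) *\<^sub>R ?d p m) \<le> D ^ 3 * (norm (\<beta> - \<beta>'))\<^sup>2" .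
  qed
  also have "\<dots> = (\<Sum>p\<in>I. real (card (edges A p)) * (D ^ 3 * (norm (\<beta> - \<beta>'))\<^sup>2))" by simp
  also have "\<dots> \<le> (\<Sum>p\<in>I. a * (D ^ 3 * (norm (\<beta> - \<beta>'))\<^sup>2))"
    by (intro sum_mono mult_right_mono a) (auto simp: D)
  finally show ?thesis by (simp add: mult_ac)
qed

text \<open>
  The deterministic core of the asymptotics.  Here \<open>g\<close> and \<open>g'\<close> are the score at the estimator and at the
  true parameter, \<open>\<delta>\<close> is the estimation error, \<open>H\<close> the Hessian and \<open>E\<close> its mean.  Monotonicity gives
  \<open>k norm \<delta> \<le> norm (g - g')\<close>, and comparing with the normalised scores bounds \<open>norm \<delta>\<close> by \<open>b\<close>.  Then
  \<open>J E \<delta> + J g' = J g - J ((H - E) \<delta> + (g - g' - H \<delta>))\<close>, where both terms inside are small.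
\<close>

lemma root_linearization_error:
  fixes S H E :: "real ^ 'd ^ 'd" and \<delta> g g' :: "real ^ 'd"
  assumes sym: "transpose S = S" and low: "\<And>v. l * (norm v)\<^sup>2 \<le> v \<bullet> (S *v v)" and l: "0 < l"
    and up: "\<And>v. v \<bullet> (S *v v) \<le> u * (norm v)\<^sup>2"
    and mono: "k * (norm \<delta>)\<^sup>2 \<le> \<delta> \<bullet> (g - g')" and k: "0 < k"
    and taylor: "norm (g - g' - H *v \<delta>) \<le> r * (norm \<delta>)\<^sup>2" and r: "0 \<le> r"
  defines "J \<equiv> inv_sqrt_matrix S"
  defines "b \<equiv> sqrt u * (norm (J *v g) + norm (J *v g')) / k"
  shows "norm ((J ** E) *v \<delta> - (- (J *v g')))
    \<le> norm (J *v g) + (norm (H - E) * b + r * b\<^sup>2) / sqrt l"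
proof -
  note J = norm_inv_sqrt_matrix_le[OF sym low l, folded J_def] norm_le_norm_inv_sqrt_matrix[OF sym low l up, folded J_def]
  have "k * (norm \<delta>)\<^sup>2 \<le> norm \<delta> * norm (g - g')" using mono norm_cauchy_schwarz[of \<delta> "g - g'"] by linarith
  then have "norm \<delta> * (k * norm \<delta>) \<le> norm \<delta> * norm (g - g')" by (simp add: power2_eq_square mult_ac)
  then have "k * norm \<delta> \<le> norm (g - g')" by (cases "\<delta> = 0") auto
  also have "\<dots> \<le> sqrt u * norm (J *v (g - g'))" by (rule J(2))
  also have "\<dots> \<le> sqrt u * (norm (J *v g) + norm (J *v g'))"
  proof (rule mult_left_mono)
    show "norm (J *v (g - g')) \<le> norm (J *v g) + norm (J *v g')"
      by (simp add: matrix_vector_mult_diff_distrib norm_triangle_ineq4)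
    have "0 \<le> u * (norm (axis undefined 1 :: real ^ 'd))\<^sup>2"
      by (rule order_trans[OF _ order_trans[OF low up]]) (use l in simp)
    then show "0 \<le> sqrt u" by simp
  qed
  finally have \<delta>: "norm \<delta> \<le> b" using k by (simp add: b_def pos_le_divide_eq mult.commute)
  have "(J ** E) *v \<delta> - (- (J *v g')) = J *v g - J *v ((H - E) *v \<delta> + (g - g' - H *v \<delta>))"
    by (simp add: matrix_vector_mul_assoc[symmetric] matrix_vector_right_distrib matrix_vector_mult_diff_distrib
        matrix_vector_mult_diff_rdistrib)
  also have "norm \<dots> \<le> norm (J *v g) + norm (J *v ((H - E) *v \<delta> + (g - g' - H *v \<delta>)))"
    by (rule norm_triangle_ineq4)
  also have "norm (J *v ((H - E) *v \<delta> + (g - g' - H *v \<delta>))) \<le> norm ((H - E) *v \<delta> + (g - g' - H *v \<delta>)) / sqrt l"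
    by (rule J(1))
  also have "norm ((H - E) *v \<delta> + (g - g' - H *v \<delta>)) \<le> norm (H - E) * b + r * b\<^sup>2"
  proof (rule order_trans[OF norm_triangle_ineq add_mono])
    show "norm ((H - E) *v \<delta>) \<le> norm (H - E) * b"
      by (rule order_trans[OF norm_matrix_vector_mult_le]) (intro mult_left_mono \<delta>, simp)
    show "norm (g - g' - H *v \<delta>) \<le> r * b\<^sup>2"
      by (rule order_trans[OF taylor]) (intro mult_left_mono power_mono \<delta> r norm_ge_zero)
  qed
  finally show ?thesis using l by (simp add: divide_right_mono)
qed

section \<open>The law of the local exponential random graph model\<close>

definition gibbs_pmf :: "'a set \<Rightarrow> ('a \<Rightarrow> real) \<Rightarrow> 'a pmf" where
  "gibbs_pmf C w = embed_pmf (\<lambda>x. indicator C x * (w x / sum w C))"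

lemma
  fixes f :: "'a \<Rightarrow> 'b::{banach, second_countable_topology}"
  assumes C: "finite C" "C \<noteq> {}" and w: "\<And>x. x \<in> C \<Longrightarrow> 0 < w x"
  shows pmf_gibbs_pmf: "pmf (gibbs_pmf C w) x = indicator C x * (w x / sum w C)"
    and set_pmf_gibbs_pmf: "set_pmf (gibbs_pmf C w) = C"
    and expectation_gibbs_pmf:
      "measure_pmf.expectation (gibbs_pmf C w) f = (1 / sum w C) *\<^sub>R (\<Sum>x\<in>C. w x *\<^sub>R f x)"
proof -
  have Z: "0 < sum w C" using C w by (intro sum_pos)
  have nn: "0 \<le> indicator C x * (w x / sum w C)" for x
    using w[of x] Z by (auto simp: indicator_def)
  have "(\<integral>\<^sup>+x. ennreal (indicator C x * (w x / sum w C)) \<partial>count_space UNIV)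
      = (\<integral>\<^sup>+x. ennreal (w x / sum w C) * indicator C x \<partial>count_space UNIV)"
    by (intro nn_integral_cong) (auto simp: indicator_def)
  also have "\<dots> = (\<Sum>x\<in>C. ennreal (w x / sum w C))"
    using C by (subst nn_integral_indicator_finite) auto
  also have "\<dots> = ennreal (\<Sum>x\<in>C. w x / sum w C)"
    using w Z by (intro sum_ennreal) (auto simp: less_imp_le)
  also have "\<dots> = 1" using Z by (simp add: sum_divide_distrib[symmetric])
  finally have one: "(\<integral>\<^sup>+x. ennreal (indicator C x * (w x / sum w C)) \<partial>count_space UNIV) = 1" .
  show pmf: "pmf (gibbs_pmf C w) x = indicator C x * (w x / sum w C)" for x
    unfolding gibbs_pmf_def by (rule pmf_embed_pmf[OF nn one])
  show set: "set_pmf (gibbs_pmf C w) = C"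
    using w Z by (force simp: set_pmf_eq pmf indicator_def)
  show "measure_pmf.expectation (gibbs_pmf C w) f = (1 / sum w C) *\<^sub>R (\<Sum>x\<in>C. w x *\<^sub>R f x)"
    by (subst integral_measure_pmf[OF C(1)]) (auto simp: set pmf scaleR_sum_right)
qed

lemma finite_configs: "finite E \<Longrightarrow> finite (configs E)"
  by (simp add: configs_def finite_PiE)

lemma configs_not_empty: "configs E \<noteq> {}"
  by (simp add: configs_def PiE_eq_empty_iff)

lemma finite_card_edges:
  assumes "finite (A k)" "finite (A l)"
  shows "finite (edges A (k, l))" "card (edges A (k, l)) \<le> card (A k) * card (A l)"
proof -
  have sub: "edges A (k, l) \<subseteq> (\<lambda>(u, v). {u, v}) ` (A k \<times> A l)" by (auto simp: edges_def)
  have fin: "finite ((\<lambda>(u, v). {u, v}) ` (A k \<times> A l))" using assms by auto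
  show "finite (edges A (k, l))" using finite_subset[OF sub fin] .
  have "card (edges A (k, l)) \<le> card ((\<lambda>(u, v). {u, v}) ` (A k \<times> A l))" by (rule card_mono[OF fin sub])
  also have "\<dots> \<le> card (A k \<times> A l)" by (rule card_image_le) (use assms in auto)
  finally show "card (edges A (k, l)) \<le> card (A k) * card (A l)" by (simp add: card_cartesian_product)
qed

lemma edge_diff_update [simp]: "edge_diff m s (x(m := i)) = edge_diff m s x"
  by (simp add: edge_diff_def)

text \<open>
  Pair \<open>x\<close> with the configuration in which edge \<open>m\<close> is flipped.  The logistic value is the conditional probability
  of the edge given all others, so the \<open>m\<close>-th summands of the two configurations cancel: with weights \<open>a\<close> and \<open>b\<close> of the
  configurations without and with \<open>m\<close> they add up to \<open>((a + b) \<sigma> - b) \<Delta>\<^sub>m = 0\<close>.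
\<close>

lemma stein_identity:
  fixes s :: "('e \<Rightarrow> nat) \<Rightarrow> real ^ 'd"
  assumes E: "finite E"
  shows "(\<Sum>x\<in>configs E. exp (\<beta> \<bullet> s x) *\<^sub>R stein_h E s x \<beta>) = 0"
proof -
  define F where "F m x = exp (\<beta> \<bullet> s x) *\<^sub>R (logistic (\<beta> \<bullet> edge_diff m s x) *\<^sub>R edge_diff m s x + (s (x(m := 0)) - s x))" for m x
  have pair: "F m (x(m := 0)) + F m (x(m := 1)) = 0" for m x
  proof -
    define a b where "a = exp (\<beta> \<bullet> s (x(m := 0)))" and "b = exp (\<beta> \<bullet> s (x(m := 1)))"
    have pos: "0 < a" "0 < b" by (auto simp: a_def b_def)
    have "exp (- (\<beta> \<bullet> edge_diff m s x)) = a / b"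
      by (simp add: a_def b_def edge_diff_def inner_diff_right exp_diff[symmetric])
    then have "logistic (\<beta> \<bullet> edge_diff m s x) = 1 / (1 + a / b)"
      by (simp only: logistic_def)
    also have "\<dots> = b / (a + b)" using pos by (simp add: field_simps)
    finally have "logistic (\<beta> \<bullet> edge_diff m s x) = b / (a + b)" .
    then have l: "(a + b) * logistic (\<beta> \<bullet> edge_diff m s x) = b" using pos by simp
    have "F m (x(m := 0)) + F m (x(m := 1)) = ((a + b) * logistic (\<beta> \<bullet> edge_diff m s x) - b) *\<^sub>R edge_diff m s x"
      unfolding F_def a_def[symmetric] b_def[symmetric]
      by (simp add: a_def[symmetric] b_def[symmetric] edge_diff_def[symmetric] algebra_simps)
        (simp add: edge_diff_def algebra_simps)
    then show ?thesis by (simp add: l)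
  qed
  have "(\<Sum>x\<in>configs E. F m x) = 0" if m: "m \<in> E" for m
  proof -
    define flip where "flip x = x(m := 1 - x m)" for x :: "'e \<Rightarrow> nat"
    have val: "x m = 0 \<or> x m = 1" if "x \<in> configs E" for x
      using that m by (auto simp: configs_def PiE_iff)
    have flip: "flip x \<in> configs E" "flip (flip x) = x" if "x \<in> configs E" for x
      using val[OF that] that m by (auto simp: flip_def configs_def PiE_iff extensional_def fun_eq_iff)
    have "(\<Sum>x\<in>configs E. F m x) = (\<Sum>x\<in>configs E. F m (flip x))"
      by (rule sum.reindex_bij_witness[of _ flip flip]) (auto simp: flip)
    then have "2 *\<^sub>R (\<Sum>x\<in>configs E. F m x) = (\<Sum>x\<in>configs E. F m x + F m (flip x))"
      by (simp add: sum.distrib scaleR_2)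
    also have "\<dots> = 0"
    proof (intro sum.neutral ballI)
      fix x assume x: "x \<in> configs E"
      from val[OF x] show "F m x + F m (flip x) = 0"
      proof
        assume *: "x m = 0"
        then have "x = x(m := 0)" "flip x = x(m := 1)" by (auto simp: flip_def)
        with pair[of m x] show ?thesis by simp
      next
        assume *: "x m = 1"
        then have "x = x(m := 1)" "flip x = x(m := 0)" by (auto simp: flip_def)
        with pair[of m x] show ?thesis by (simp add: add.commute)
      qed
    qed
    finally show ?thesis by simp
  qed
  then have "(\<Sum>m\<in>E. \<Sum>x\<in>configs E. F m x) = 0" by simp
  then have "(\<Sum>x\<in>configs E. \<Sum>m\<in>E. F m x) = 0" by (subst sum.swap)
  then show ?thesis by (simp only: F_def stein_h_eq scaleR_sum_right)
qed

text \<open>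
  Every summand is \<open>\<sigma> \<Delta>\<^sub>m\<close> or \<open>(\<sigma> - 1) \<Delta>\<^sub>m\<close>, according to whether the edge \<open>m\<close> is absent or present.
\<close>

lemma norm_stein_h_le:
  fixes s :: "('e \<Rightarrow> nat) \<Rightarrow> real ^ 'd"
  assumes x: "x \<in> configs E" and D: "\<And>m. m \<in> E \<Longrightarrow> norm (edge_diff m s x) \<le> D"
  shows "norm (stein_h E s x \<beta>) \<le> real (card E) * D"
proof -
  have "norm (logistic (\<beta> \<bullet> edge_diff m s x) *\<^sub>R edge_diff m s x + (s (x(m := 0)) - s x)) \<le> D" if m: "m \<in> E" for m
  proof -
    let ?l = "logistic (\<beta> \<bullet> edge_diff m s x)"
    have "x m = 0 \<or> x m = 1" using x m by (auto simp: configs_def PiE_iff)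
    then obtain c where c: "\<bar>c\<bar> \<le> 1"
      "?l *\<^sub>R edge_diff m s x + (s (x(m := 0)) - s x) = c *\<^sub>R edge_diff m s x"
    proof
      assume "x m = 0"
      then have "x(m := 0) = x" by auto
      then show thesis using that[of ?l] logistic_bounds[of "\<beta> \<bullet> edge_diff m s x"] by simp
    next
      assume "x m = 1"
      then have "x(m := 1) = x" by auto
      then have "s (x(m := 0)) - s x = - edge_diff m s x" by (simp add: edge_diff_def)
      then show thesis using that[of "?l - 1"] logistic_bounds[of "\<beta> \<bullet> edge_diff m s x"] by (simp add: scaleR_diff_left)
    qed
    have "\<bar>c\<bar> * norm (edge_diff m s x) \<le> 1 * D"
      using c(1) D[OF m] by (intro mult_mono) auto
    then show ?thesis by (simp add: c(2))
  qed
  then show ?thesis unfolding stein_h_eq by (intro order_trans[OF norm_sum] sum_bounded_above)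
qed

text \<open>
  The factor of the model weight that belongs to the block pair \<open>p\<close>.
\<close>

definition subgraph_weight :: "('v, 'd1::finite) statistics \<Rightarrow> ('v, 'd2::finite) statistics \<Rightarrow> real ^ 'd1 \<Rightarrow> real ^ 'd2 \<Rightarrow>
   nat \<times> nat \<Rightarrow> ('v set \<Rightarrow> nat) \<Rightarrow> real" where
  "subgraph_weight sW sB \<beta>W \<beta>B p y = exp (if fst p = snd p then \<beta>W \<bullet> sW p y else \<beta>B \<bullet> sB p y)"

lemma finite_block_pairs: "finite (block_pairs K)" "finite (within_pairs K)" "finite (between_pairs K)"
  by (rule finite_subset[of _ "{1..K} \<times> {1..K}"], auto simp: block_pairs_def within_pairs_def between_pairs_def)+

lemma block_pairs_split: "block_pairs K = within_pairs K \<union> between_pairs K" "within_pairs K \<inter> between_pairs K = {}"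
  by (auto simp: block_pairs_def within_pairs_def between_pairs_def)

lemma lergm_weight_eq_prod:
  "lergm_weight K sW sB \<beta>W \<beta>B x = (\<Prod>p\<in>block_pairs K. subgraph_weight sW sB \<beta>W \<beta>B p (x p))"
proof -
  have "(\<Prod>p\<in>block_pairs K. subgraph_weight sW sB \<beta>W \<beta>B p (x p))
      = (\<Prod>p\<in>within_pairs K. subgraph_weight sW sB \<beta>W \<beta>B p (x p)) * (\<Prod>p\<in>between_pairs K. subgraph_weight sW sB \<beta>W \<beta>B p (x p))"
    unfolding block_pairs_split(1) by (rule prod.union_disjoint) (auto simp: finite_block_pairs block_pairs_split(2))
  also have "(\<Prod>p\<in>within_pairs K. subgraph_weight sW sB \<beta>W \<beta>B p (x p)) = exp (\<Sum>p\<in>within_pairs K. \<beta>W \<bullet> sW p (x p))"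
    by (simp add: exp_sum finite_block_pairs) (auto intro!: prod.cong simp: subgraph_weight_def within_pairs_def)
  also have "(\<Prod>p\<in>between_pairs K. subgraph_weight sW sB \<beta>W \<beta>B p (x p)) = exp (\<Sum>p\<in>between_pairs K. \<beta>B \<bullet> sB p (x p))"
    by (simp add: exp_sum finite_block_pairs) (auto intro!: prod.cong simp: subgraph_weight_def between_pairs_def)
  finally show ?thesis by (simp add: lergm_weight_def exp_add)
qed

text \<open>
  The default value \<open>undefined\<close> makes the support of the product agree with the extensional functions in
  \<open>graphs\<close>.
\<close>

definition lergm_pmf :: "(nat \<Rightarrow> 'v set) \<Rightarrow> nat \<Rightarrow> ('v, 'd1::finite) statistics \<Rightarrow> ('v, 'd2::finite) statistics \<Rightarrow>
   real ^ 'd1 \<Rightarrow> real ^ 'd2 \<Rightarrow> 'v graph pmf" where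
  "lergm_pmf A K sW sB \<beta>W \<beta>B =
     Pi_pmf (block_pairs K) undefined (\<lambda>p. gibbs_pmf (configs (edges A p)) (subgraph_weight sW sB \<beta>W \<beta>B p))"

lemma finite_edges_block_pairs:
  assumes "\<And>k. k \<in> {1..K} \<Longrightarrow> finite (A k)" "p \<in> block_pairs K"
  shows "finite (edges A p)"
  using assms by (auto simp: block_pairs_def intro!: finite_card_edges)

text \<open>
  The model weight factorises over block pairs, so the model is the product of Gibbs distributions of its
  subgraphs.  The normalising constants agree since both mass functions have total mass one on \<open>graphs\<close>.
\<close>

lemma lergm_pmf:
  assumes fin: "\<And>k. k \<in> {1..K} \<Longrightarrow> finite (A k)"
  shows set_lergm_pmf: "set_pmf (lergm_pmf A K sW sB \<beta>W \<beta>B) = graphs A K"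
    and pmf_lergm_pmf: "x \<in> graphs A K \<Longrightarrow> pmf (lergm_pmf A K sW sB \<beta>W \<beta>B) x
      = lergm_weight K sW sB \<beta>W \<beta>B x / (\<Sum>y\<in>graphs A K. lergm_weight K sW sB \<beta>W \<beta>B y)"
    and finite_graphs: "finite (graphs A K)"
proof -
  let ?w = "subgraph_weight sW sB \<beta>W \<beta>B" and ?\<mu> = "lergm_pmf A K sW sB \<beta>W \<beta>B"
  have finE: "finite (configs (edges A p))" if "p \<in> block_pairs K" for p
    using finite_configs finite_edges_block_pairs[where A=A and K=K, OF fin that] by auto
  note gibbs = pmf_gibbs_pmf[OF finE configs_not_empty] set_pmf_gibbs_pmf[OF finE configs_not_empty]
  have wpos: "0 < ?w p y" for p y by (simp add: subgraph_weight_def)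
  show fing: "finite (graphs A K)" unfolding graphs_def
    using finE finite_block_pairs by (intro finite_PiE) auto
  have "set_pmf ?\<mu> = PiE_dflt (block_pairs K) undefined (\<lambda>p. configs (edges A p))"
    unfolding lergm_pmf_def set_Pi_pmf[OF finite_block_pairs(1)]
    using gibbs(2)[OF _ wpos] by (auto simp: PiE_dflt_def)
  also have "\<dots> = graphs A K" by (auto simp: PiE_dflt_def graphs_def PiE_def extensional_def)
  finally show set: "set_pmf ?\<mu> = graphs A K" .
  define Z where "Z = (\<Prod>p\<in>block_pairs K. sum (?w p) (configs (edges A p)))"
  have pmf: "pmf ?\<mu> x = lergm_weight K sW sB \<beta>W \<beta>B x / Z" if x: "x \<in> graphs A K" for x
  proof -
    have "pmf ?\<mu> x = (\<Prod>p\<in>block_pairs K. pmf (gibbs_pmf (configs (edges A p)) (?w p)) (x p))"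
      unfolding lergm_pmf_def using x by (intro pmf_Pi' finite_block_pairs) (auto simp: graphs_def PiE_def extensional_def)
    also have "\<dots> = (\<Prod>p\<in>block_pairs K. ?w p (x p) / sum (?w p) (configs (edges A p)))"
      using x by (intro prod.cong refl) (auto simp: gibbs(1) wpos graphs_def PiE_iff)
    finally show ?thesis by (simp add: lergm_weight_eq_prod Z_def prod_dividef)
  qed
  have "(\<Sum>x\<in>graphs A K. pmf ?\<mu> x) = 1" by (rule sum_pmf_eq_1[OF fing]) (simp add: set)
  then have "(\<Sum>x\<in>graphs A K. lergm_weight K sW sB \<beta>W \<beta>B x) / Z = 1"
    by (simp add: pmf sum_divide_distrib)
  then have "Z = (\<Sum>x\<in>graphs A K. lergm_weight K sW sB \<beta>W \<beta>B x)" by (cases "Z = 0") auto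
  then show "x \<in> graphs A K \<Longrightarrow> pmf ?\<mu> x
      = lergm_weight K sW sB \<beta>W \<beta>B x / (\<Sum>y\<in>graphs A K. lergm_weight K sW sB \<beta>W \<beta>B y)"
    using pmf by simp
qed

lemma is_lergm_law:
  assumes fin: "\<And>k. k \<in> {1..K} \<Longrightarrow> finite (A k)" and X: "is_lergm P X A K sW sB \<beta>W \<beta>B"
  shows lergm_in_graphs: "\<And>\<omega>. \<omega> \<in> space P \<Longrightarrow> X \<omega> \<in> graphs A K"
    and lergm_measurable: "X \<in> P \<rightarrow>\<^sub>M count_space UNIV"
    and lergm_distr: "distr P (count_space UNIV) X = measure_pmf (lergm_pmf A K sW sB \<beta>W \<beta>B)"
proof -
  let ?\<mu> = "lergm_pmf A K sW sB \<beta>W \<beta>B" and ?G = "graphs A K"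
  let ?f = "\<lambda>x. ennreal (lergm_weight K sW sB \<beta>W \<beta>B x / (\<Sum>y\<in>?G. lergm_weight K sW sB \<beta>W \<beta>B y))"
  have dens: "distr P (count_space ?G) X = density (count_space ?G) ?f" and meas: "X \<in> P \<rightarrow>\<^sub>M count_space ?G"
    using X by (auto simp: is_lergm_def distributed_def)
  have pmf: "pmf ?\<mu> x = lergm_weight K sW sB \<beta>W \<beta>B x / (\<Sum>y\<in>?G. lergm_weight K sW sB \<beta>W \<beta>B y)" if "x \<in> ?G" for x
    by (rule pmf_lergm_pmf[OF _ that]) (rule fin)
  have set: "set_pmf ?\<mu> = ?G" by (rule set_lergm_pmf) (rule fin)
  show inG: "X \<omega> \<in> ?G" if "\<omega> \<in> space P" for \<omega> using measurable_space[OF meas that] by simp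
  show meas': "X \<in> P \<rightarrow>\<^sub>M count_space UNIV"
    by (rule measurable_compose[OF meas, of "\<lambda>x. x", simplified]) simp
  show "distr P (count_space UNIV) X = measure_pmf ?\<mu>"
  proof (rule measure_eqI)
    fix B assume "B \<in> sets (distr P (count_space UNIV) X)"
    have "emeasure (distr P (count_space UNIV) X) B = emeasure P (X -` (B \<inter> ?G) \<inter> space P)"
      using meas' inG by (subst emeasure_distr) (auto intro!: arg_cong[where f="emeasure P"])
    also have "\<dots> = emeasure (distr P (count_space ?G) X) (B \<inter> ?G)"
      using meas by (subst emeasure_distr) auto
    also have "\<dots> = (\<integral>\<^sup>+x. ?f x * indicator (B \<inter> ?G) x \<partial>count_space ?G)"
      unfolding dens by (subst emeasure_density) auto
    also have "\<dots> = (\<Sum>x\<in>?G. ?f x * indicator (B \<inter> ?G) x)"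
      by (rule nn_integral_count_space_finite[OF finite_graphs[where A=A and K=K, OF fin]])
    also have "\<dots> = (\<Sum>x\<in>B \<inter> ?G. ennreal (pmf ?\<mu> x))"
      using finite_graphs[where A=A and K=K, OF fin] by (intro sum.mono_neutral_cong_right) (auto simp: pmf indicator_def)
    also have "\<dots> = emeasure ?\<mu> (B \<inter> ?G)"
      using finite_graphs[where A=A and K=K, OF fin] by (subst emeasure_measure_pmf_finite) auto
    also have "\<dots> = emeasure ?\<mu> B"
      using emeasure_Int_set_pmf[of ?\<mu> B] by (simp only: set)
    finally show "emeasure (distr P (count_space UNIV) X) B = emeasure ?\<mu> B" .
  qed simp
qed

text \<open>
  Independence is a property of the joint law, so that it may be checked on the product of Gibbs
  distributions and transported to the probability space of the random graph.
\<close>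

lemma (in prob_space) indep_vars_if_distr:
  assumes X: "X \<in> M \<rightarrow>\<^sub>M N" and Y: "\<And>i. i \<in> I \<Longrightarrow> Y i \<in> N \<rightarrow>\<^sub>M M' i" and I: "I \<noteq> {}"
    and indep: "prob_space.indep_vars (distr M N X) M' Y I"
  shows "indep_vars M' (\<lambda>i \<omega>. Y i (X \<omega>)) I"
proof -
  interpret D: prob_space "distr M N X" by (rule prob_space_distr[OF X])
  have "distr (distr M N X) (PiM I M') (\<lambda>x. \<lambda>i\<in>I. Y i x) = PiM I (\<lambda>i. distr (distr M N X) (M' i) (Y i))"
    using indep Y by (subst D.indep_vars_iff_distr_eq_PiM'[symmetric, OF I]) auto
  moreover have "distr (distr M N X) (PiM I M') (\<lambda>x. \<lambda>i\<in>I. Y i x) = distr M (PiM I M') (\<lambda>\<omega>. \<lambda>i\<in>I. Y i (X \<omega>))"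
    by (subst distr_distr[OF measurable_restrict X]) (use Y in \<open>auto simp: comp_def\<close>)
  moreover have "PiM I (\<lambda>i. distr (distr M N X) (M' i) (Y i)) = PiM I (\<lambda>i. distr M (M' i) (\<lambda>\<omega>. Y i (X \<omega>)))"
    using X Y by (intro PiM_cong refl) (auto simp: distr_distr comp_def)
  ultimately show ?thesis
    using X Y by (subst indep_vars_iff_distr_eq_PiM'[OF I]) (auto intro: measurable_compose)
qed

lemma lergm_indep:
  assumes fin: "\<And>k. k \<in> {1..K} \<Longrightarrow> finite (A k)" and P: "prob_space P" and X: "is_lergm P X A K sW sB \<beta>W \<beta>B" and K: "1 \<le> K"
  shows "prob_space.indep_vars P (\<lambda>_. count_space UNIV) (\<lambda>p \<omega>. X \<omega> p) (block_pairs K)"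
proof -
  interpret P: prob_space P by (rule P)
  have "(1, 1) \<in> block_pairs K" using K by (simp add: block_pairs_def)
  then have ne: "block_pairs K \<noteq> {}" by blast
  have distr: "distr P (count_space UNIV) X = measure_pmf (lergm_pmf A K sW sB \<beta>W \<beta>B)"
    by (rule lergm_distr[OF _ X]) (rule fin)
  show ?thesis
    by (rule P.indep_vars_if_distr[OF lergm_measurable[where A=A and K=K, OF fin X] _ ne])
      (auto simp: distr lergm_pmf_def intro!: indep_vars_Pi_pmf finite_block_pairs)
qed

text \<open>
  The \<open>p\<close>-subgraph has a Gibbs distribution, for which \<open>stein_identity\<close> says that the expectation vanishes.
\<close>

lemma lergm_stein_h_centered:
  fixes s :: "('v, 'd::finite) statistics"
  assumes fin: "\<And>k. k \<in> {1..K} \<Longrightarrow> finite (A k)" and X: "is_lergm P X A K sW sB \<beta>W \<beta>B"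
    and p: "p \<in> block_pairs K" and w: "\<And>y. subgraph_weight sW sB \<beta>W \<beta>B p y = exp (\<beta> \<bullet> s p y)"
  shows "(\<integral>\<omega>. stein_h (edges A p) (s p) (X \<omega> p) \<beta> \<partial>P) = 0"
proof -
  let ?w = "subgraph_weight sW sB \<beta>W \<beta>B p" and ?C = "configs (edges A p)"
  let ?h = "\<lambda>y. stein_h (edges A p) (s p) y \<beta>"
  have finE: "finite (edges A p)" using finite_edges_block_pairs[where A=A and K=K, OF fin p] by auto
  have distr: "distr P (count_space UNIV) X = measure_pmf (lergm_pmf A K sW sB \<beta>W \<beta>B)"
    by (rule lergm_distr[OF _ X]) (rule fin)
  have "(\<integral>\<omega>. ?h (X \<omega> p) \<partial>P) = (\<integral>x. ?h (x p) \<partial>distr P (count_space UNIV) X)"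
    using lergm_measurable[where A=A and K=K, OF fin X] by (subst integral_distr) auto
  also have "\<dots> = measure_pmf.expectation (map_pmf (\<lambda>x. x p) (lergm_pmf A K sW sB \<beta>W \<beta>B)) ?h"
    by (simp add: distr)
  also have "map_pmf (\<lambda>x. x p) (lergm_pmf A K sW sB \<beta>W \<beta>B) = gibbs_pmf ?C ?w"
    unfolding lergm_pmf_def using p by (subst Pi_pmf_component[OF finite_block_pairs(1)]) simp
  also have "measure_pmf.expectation (gibbs_pmf ?C ?w) ?h = (1 / sum ?w ?C) *\<^sub>R (\<Sum>y\<in>?C. ?w y *\<^sub>R ?h y)"
    by (rule expectation_gibbs_pmf[OF finite_configs[OF finE] configs_not_empty]) (simp add: w)
  also have "(\<Sum>y\<in>?C. ?w y *\<^sub>R ?h y) = 0" unfolding w by (rule stein_identity[OF finE])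
  finally show ?thesis by simp
qed

section \<open>The linearisation error for one graph\<close>

text \<open>
  One member of the sequence, for the within-block or the between-block pairs alike: \<open>a\<close> bounds the number of edges of a
  block pair, \<open>D\<close> the edge differences, and \<open>b\<close> is an estimator with values in the ball of radius \<open>R\<close>.
\<close>

locale stein_model = prob_space P for P :: "'w measure" +
  fixes X :: "'w \<Rightarrow> 'v graph" and I :: "(nat \<times> nat) set" and A :: "nat \<Rightarrow> 'v set"
    and s :: "('v, 'd::finite) statistics" and \<beta> :: "real ^ 'd" and b :: "'v graph \<Rightarrow> real ^ 'd"
    and R D a \<xi> \<zeta> :: real
  assumes X: "X \<in> P \<rightarrow>\<^sub>M count_space UNIV"
    and finite_I: "finite I" and I_ne: "I \<noteq> {}"
    and indep: "indep_vars (\<lambda>_. count_space UNIV) (\<lambda>p \<omega>. X \<omega> p) I"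
    and config: "\<And>\<omega> p. \<omega> \<in> space P \<Longrightarrow> p \<in> I \<Longrightarrow> X \<omega> p \<in> configs (edges A p)"
    and card_edges: "\<And>p. p \<in> I \<Longrightarrow> real (card (edges A p)) \<le> a"
    and D: "0 \<le> D"
    and edge_diff: "\<And>p x m. p \<in> I \<Longrightarrow> x \<in> configs (edges A p) \<Longrightarrow> m \<in> edges A p \<Longrightarrow> norm (edge_diff m (s p) x) \<le> D"
    and centered: "\<And>p. p \<in> I \<Longrightarrow> expectation (\<lambda>\<omega>. stein_h (edges A p) (s p) (X \<omega> p) \<beta>) = 0"
    and \<xi>: "0 < \<xi>" "\<And>p. p \<in> I \<Longrightarrow> \<xi> \<le> lambda_min (\<Sum>m\<in>edges A p.
        expectation (\<lambda>\<omega>. outer (edge_diff m (s p) (X \<omega> p)) (edge_diff m (s p) (X \<omega> p))))"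
    and \<zeta>: "0 < \<zeta>" "\<And>p. p \<in> I \<Longrightarrow> \<zeta> \<le> lambda_min (expectation (\<lambda>\<omega>.
        outer (stein_h (edges A p) (s p) (X \<omega> p) \<beta>) (stein_h (edges A p) (s p) (X \<omega> p) \<beta>)))"
    and \<beta>: "norm \<beta> \<le> R"
    and b: "\<And>\<omega>. \<omega> \<in> space P \<Longrightarrow> norm (b (X \<omega>)) \<le> R"
begin

abbreviation "h p \<omega> \<equiv> stein_h (edges A p) (s p) (X \<omega> p) \<beta>"
abbreviation "g \<omega> \<equiv> stein_g I A s (X \<omega>) \<beta>"
abbreviation "\<Delta> p m \<omega> \<equiv> edge_diff m (s p) (X \<omega> p)"

text \<open>
  \<open>Z\<close> is the normalised score at the true parameter, with the sign that it has in the expansion of the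
  standardised estimation error \<open>W\<close>.  \<open>U\<close> and \<open>V\<close> are the contributions of a block pair to the matrix that governs strong
  monotonicity and to the Hessian.
\<close>

definition "N = real (card I)"
definition "S = g_cov P X I A s \<beta>"
definition "J = inv_sqrt_matrix S"
definition "Z \<omega> = - (J *v g \<omega>)"
definition "W \<omega> = Q_matrix P X I A s \<beta> *v (b (X \<omega>) - \<beta>)"
definition "U p \<omega> = (\<Sum>m\<in>edges A p. outer (\<Delta> p m \<omega>) (\<Delta> p m \<omega>))"
definition "V p \<omega> = (\<Sum>m\<in>edges A p. deriv logistic (\<beta> \<bullet> \<Delta> p m \<omega>) *\<^sub>R outer (\<Delta> p m \<omega>) (\<Delta> p m \<omega>))"

lemma N: "0 < N" using finite_I I_ne by (simp add: N_def card_gt_0_iff)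

lemma a: "0 \<le> a"
proof -
  obtain p where "p \<in> I" using I_ne by blast
  from order_trans[OF of_nat_0_le_iff card_edges[OF this]] show ?thesis .
qed

text \<open>
  The random graph is measurable into a discrete space, so every function of it is a random variable.
\<close>

lemma measurable_fun_X [measurable]: "(\<lambda>\<omega>. F (X \<omega>)) \<in> borel_measurable P"
  by (rule measurable_compose[OF X]) simp

lemma indep_fun: "indep_vars (\<lambda>_. borel) (\<lambda>p \<omega>. F p (X \<omega> p)) I"
  by (rule indep_vars_compose2[OF indep]) simp

lemma \<Delta>: "\<omega> \<in> space P \<Longrightarrow> p \<in> I \<Longrightarrow> m \<in> edges A p \<Longrightarrow> norm (\<Delta> p m \<omega>) \<le> D"
  by (intro edge_diff config)

lemma h_bound: "\<omega> \<in> space P \<Longrightarrow> p \<in> I \<Longrightarrow> norm (h p \<omega>) \<le> a * D"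
  by (rule order_trans[OF norm_stein_h_le[OF config \<Delta>]]) (auto intro!: mult_right_mono card_edges D)

lemma g_eq: "g \<omega> = (\<Sum>p\<in>I. h p \<omega>)" by (simp add: stein_g_def)

lemma g_bound: "\<omega> \<in> space P \<Longrightarrow> norm (g \<omega>) \<le> N * (a * D)"
  unfolding g_eq N_def by (rule order_trans[OF norm_sum sum_bounded_above]) (rule h_bound)

lemma h_form: "p \<in> I \<Longrightarrow> u \<bullet> (expectation (\<lambda>\<omega>. outer (h p \<omega>) (h p \<omega>)) *v v) = expectation (\<lambda>\<omega>. (u \<bullet> h p \<omega>) * (v \<bullet> h p \<omega>))"
  by (rule expectation_outer_form) (auto intro: h_bound measurable_fun_X[of "\<lambda>x. outer (stein_h (edges A p) (s p) (x p) \<beta>) (stein_h (edges A p) (s p) (x p) \<beta>)"])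

lemma S_form: "u \<bullet> (S *v v) = (\<Sum>p\<in>I. expectation (\<lambda>\<omega>. (u \<bullet> h p \<omega>) * (v \<bullet> h p \<omega>)))"
proof -
  have "u \<bullet> (S *v v) = expectation (\<lambda>\<omega>. (u \<bullet> g \<omega>) * (v \<bullet> g \<omega>))"
    unfolding S_def g_cov_def
    by (rule expectation_outer_form) (auto intro: g_bound measurable_fun_X[of "\<lambda>x. outer (stein_g I A s x \<beta>) (stein_g I A s x \<beta>)"])
  also have "\<dots> = (\<Sum>p\<in>I. expectation (\<lambda>\<omega>. (u \<bullet> h p \<omega>) * (v \<bullet> h p \<omega>)))"
    unfolding g_eq by (rule indep_sum_second_moment[OF finite_I indep_fun h_bound centered])
  finally show ?thesis .
qed

lemma S_symmetric: "transpose S = S"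
  by (rule symmetric_if_form_symmetric) (simp add: S_form mult.commute)

lemma S_lower: "N * \<zeta> * (norm v)\<^sup>2 \<le> v \<bullet> (S *v v)"
proof -
  have "\<zeta> * (norm v)\<^sup>2 \<le> expectation (\<lambda>\<omega>. (v \<bullet> h p \<omega>) * (v \<bullet> h p \<omega>))" if p: "p \<in> I" for p
  proof -
    have "\<zeta> * (norm v)\<^sup>2 \<le> lambda_min (expectation (\<lambda>\<omega>. outer (h p \<omega>) (h p \<omega>))) * (norm v)\<^sup>2"
      by (intro mult_right_mono \<zeta> p) simp
    also have "\<dots> \<le> v \<bullet> (expectation (\<lambda>\<omega>. outer (h p \<omega>) (h p \<omega>)) *v v)"
      by (intro lambda_min_le_quadratic_form symmetric_if_form_symmetric) (simp add: h_form p mult.commute)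
    finally show ?thesis by (simp add: h_form p)
  qed
  then have "(\<Sum>p\<in>I. \<zeta> * (norm v)\<^sup>2) \<le> v \<bullet> (S *v v)" unfolding S_form by (intro sum_mono)
  then show ?thesis by (simp add: N_def mult.assoc)
qed

lemma S_upper: "v \<bullet> (S *v v) \<le> N * (a * D)\<^sup>2 * (norm v)\<^sup>2"
proof -
  have "expectation (\<lambda>\<omega>. (v \<bullet> h p \<omega>) * (v \<bullet> h p \<omega>)) \<le> (norm v * (a * D)) * (norm v * (a * D))" if p: "p \<in> I" for p
  proof -
    have le: "(v \<bullet> h p \<omega>) * (v \<bullet> h p \<omega>) \<le> (norm v * (a * D)) * (norm v * (a * D))" if "\<omega> \<in> space P" for \<omega>
    proof -
      have "\<bar>v \<bullet> h p \<omega>\<bar> \<le> norm v * (a * D)"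
        by (rule order_trans[OF Cauchy_Schwarz_ineq2]) (intro mult_left_mono h_bound that p norm_ge_zero)
      then have "\<bar>v \<bullet> h p \<omega>\<bar> * \<bar>v \<bullet> h p \<omega>\<bar> \<le> (norm v * (a * D)) * (norm v * (a * D))"
        using a D by (intro mult_mono) auto
      then show ?thesis by simp
    qed
    have "expectation (\<lambda>\<omega>. (v \<bullet> h p \<omega>) * (v \<bullet> h p \<omega>)) \<le> expectation (\<lambda>\<omega>. (norm v * (a * D)) * (norm v * (a * D)))"
      using le by (intro integral_mono integrable_const integrable_const_bound[where B="(norm v * (a * D)) * (norm v * (a * D))"] measurable_fun_X) auto
    then show ?thesis by (simp add: prob_space)
  qed
  then have "v \<bullet> (S *v v) \<le> (\<Sum>p\<in>I. (norm v * (a * D)) * (norm v * (a * D)))" unfolding S_form by (intro sum_mono)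
  also have "\<dots> = N * (a * D)\<^sup>2 * (norm v)\<^sup>2" by (simp add: N_def power2_eq_square mult_ac)
  finally show ?thesis .
qed

lemma N\<zeta>_pos: "0 < N * \<zeta>" using N \<zeta>(1) by simp

lemmas J_facts =
  transpose_inv_sqrt_matrix[OF S_symmetric S_lower N\<zeta>_pos, folded J_def]
  inv_sqrt_matrix_normalizes[OF S_symmetric S_lower N\<zeta>_pos, folded J_def]
  norm_inv_sqrt_matrix_le[OF S_symmetric S_lower N\<zeta>_pos, folded J_def]

text \<open>
  Otherwise all \<open>h p\<close> would vanish, against the positive lower bound on their covariances.
\<close>

lemma aD_pos: "0 < a" "0 < D"
proof -
  let ?e = "axis undefined 1 :: real ^ 'd"
  have "N * \<zeta> * (norm ?e)\<^sup>2 \<le> N * (a * D)\<^sup>2 * (norm ?e)\<^sup>2" by (rule order_trans[OF S_lower S_upper])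
  then have "0 < N * (a * D)\<^sup>2" using N\<zeta>_pos by simp
  then have "a * D \<noteq> 0" by auto
  then show "0 < a" "0 < D" using a D by auto
qed

lemma J_inner: "t \<bullet> (J *v v) = (J *v t) \<bullet> v"
  using symmetric_matrix_inner[OF J_facts(1), of t v] by simp

lemma Z_eq: "t \<bullet> Z \<omega> = (\<Sum>p\<in>I. (- (J *v t)) \<bullet> h p \<omega>)"
  by (simp add: Z_def J_inner g_eq inner_sum_right sum_negf)

text \<open>
  \<open>Z\<close> has the identity as covariance matrix, because \<open>J S J = 1\<close>.
\<close>

lemma Z_second_moment: "(\<Sum>p\<in>I. expectation (\<lambda>\<omega>. ((- (J *v t)) \<bullet> h p \<omega>)\<^sup>2)) = (norm t)\<^sup>2"
proof -
  have "(\<Sum>p\<in>I. expectation (\<lambda>\<omega>. ((- (J *v t)) \<bullet> h p \<omega>)\<^sup>2)) = (J *v t) \<bullet> (S *v (J *v t))"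
    unfolding S_form by (simp add: power2_eq_square)
  also have "\<dots> = t \<bullet> ((J ** S ** J) *v t)"
    by (simp add: J_inner[symmetric] matrix_vector_mul_assoc matrix_mul_assoc)
  also have "\<dots> = (norm t)\<^sup>2" by (simp add: J_facts(2) power2_norm_eq_inner)
  finally show ?thesis .
qed

lemma Z_iexp_approx:
  defines "c t \<equiv> norm t * (a * D / sqrt (N * \<zeta>))"
  shows "cmod (expectation (\<lambda>\<omega>. iexp (t \<bullet> Z \<omega>)) - complex_of_real (exp (- (norm t)\<^sup>2 / 2))) \<le> (c t + (c t)\<^sup>2) * (norm t)\<^sup>2"
  unfolding Z_eq
proof (rule sum_indep_iexp_approx[OF finite_I])
  show "indep_vars (\<lambda>_. borel) (\<lambda>p \<omega>. (- (J *v t)) \<bullet> h p \<omega>) I"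
    by (rule indep_fun[of "\<lambda>p x. (- (J *v t)) \<bullet> stein_h (edges A p) (s p) x \<beta>"])
  show "0 \<le> c t" using aD_pos N\<zeta>_pos by (simp add: c_def less_imp_le)
  fix p assume p: "p \<in> I"
  have "integrable P (h p)"
    using h_bound[OF _ p] by (intro integrable_const_bound[where B="a * D"] measurable_fun_X) auto
  then show "expectation (\<lambda>\<omega>. (- (J *v t)) \<bullet> h p \<omega>) = 0"
    using centered[OF p] by (subst integral_inner_right) auto
  fix \<omega> assume w: "\<omega> \<in> space P"
  have "\<bar>(- (J *v t)) \<bullet> h p \<omega>\<bar> \<le> (norm t / sqrt (N * \<zeta>)) * (a * D)"
    by (rule order_trans[OF Cauchy_Schwarz_ineq2])
      (intro mult_mono, use J_facts(3)[of t] h_bound[OF w p] N\<zeta>_pos in auto)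
  then show "\<bar>(- (J *v t)) \<bullet> h p \<omega>\<bar> \<le> c t" by (simp add: c_def)
qed (rule Z_second_moment[symmetric])

lemma Z_bound: "\<omega> \<in> space P \<Longrightarrow> norm (Z \<omega>) \<le> N * (a * D) / sqrt (N * \<zeta>)"
  unfolding Z_def norm_minus_cancel
  by (rule order_trans[OF J_facts(3)]) (intro divide_right_mono g_bound real_sqrt_ge_zero less_imp_le[OF N\<zeta>_pos])

lemma Z_measurable [measurable]: "Z \<in> borel_measurable P" "W \<in> borel_measurable P"
  unfolding Z_def[abs_def] W_def[abs_def]
  using measurable_fun_X[of "\<lambda>x. - (J *v stein_g I A s x \<beta>)"] measurable_fun_X[of "\<lambda>x. Q_matrix P X I A s \<beta> *v (b x - \<beta>)"]
  by auto

lemma Z_tight: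
  assumes "0 < r"
  shows "prob {\<omega>\<in>space P. norm (Z \<omega>) > r} \<le> real CARD('d) / r\<^sup>2"
proof (rule prob_norm_gt_le[OF Z_measurable(1) Z_bound])
  have int: "integrable P (\<lambda>\<omega>. (e \<bullet> Z \<omega>)\<^sup>2)" if "e \<in> Basis" for e
  proof (rule integrable_const_bound[where B="(N * (a * D) / sqrt (N * \<zeta>))\<^sup>2"])
    show "AE \<omega> in P. norm ((e \<bullet> Z \<omega>)\<^sup>2) \<le> (N * (a * D) / sqrt (N * \<zeta>))\<^sup>2"
    proof (rule AE_I2)
      fix \<omega> assume "\<omega> \<in> space P"
      then have "\<bar>e \<bullet> Z \<omega>\<bar> \<le> N * (a * D) / sqrt (N * \<zeta>)"
        using Basis_le_norm[OF that, of "Z \<omega>"] Z_bound[of \<omega>] by (simp add: inner_commute)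
      from power_mono[OF this, of 2] show "norm ((e \<bullet> Z \<omega>)\<^sup>2) \<le> (N * (a * D) / sqrt (N * \<zeta>))\<^sup>2" by simp
    qed
  qed measurable
  have E: "expectation (\<lambda>\<omega>. (e \<bullet> Z \<omega>)\<^sup>2) = (norm e)\<^sup>2" for e
  proof -
    let ?u = "- (J *v e)"
    have "expectation (\<lambda>\<omega>. (e \<bullet> Z \<omega>)\<^sup>2) = expectation (\<lambda>\<omega>. (?u \<bullet> (\<Sum>p\<in>I. h p \<omega>)) * (?u \<bullet> (\<Sum>p\<in>I. h p \<omega>)))"
      by (simp add: Z_eq inner_sum_right power2_eq_square)
    also have "\<dots> = (\<Sum>p\<in>I. expectation (\<lambda>\<omega>. (?u \<bullet> h p \<omega>) * (?u \<bullet> h p \<omega>)))"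
      by (rule indep_sum_second_moment[OF finite_I indep_fun h_bound centered])
    also have "\<dots> = (norm e)\<^sup>2" using Z_second_moment[of e] by (simp add: power2_eq_square)
    finally show ?thesis .
  qed
  have "(norm (Z \<omega>))\<^sup>2 = (\<Sum>e\<in>Basis. (e \<bullet> Z \<omega>)\<^sup>2)" for \<omega>
    unfolding power2_norm_eq_inner by (subst euclidean_inner) (simp add: inner_commute power2_eq_square)
  then have "expectation (\<lambda>\<omega>. (norm (Z \<omega>))\<^sup>2) = (\<Sum>e\<in>(Basis::(real ^ 'd) set). (norm e)\<^sup>2)"
    using int by (simp add: E)
  then show "expectation (\<lambda>\<omega>. (norm (Z \<omega>))\<^sup>2) \<le> real CARD('d)" by simp
qed (use assms in auto)

lemma UV_bound:
  assumes "\<omega> \<in> space P" "p \<in> I"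
  shows "norm (U p \<omega>) \<le> a * D\<^sup>2" "norm (V p \<omega>) \<le> a * D\<^sup>2"
proof -
  have sq: "norm (outer (\<Delta> p m \<omega>) (\<Delta> p m \<omega>)) \<le> D\<^sup>2" if "m \<in> edges A p" for m
    unfolding norm_outer power2_eq_square using \<Delta>[OF assms that] D by (intro mult_mono) auto
  have *: "norm (deriv logistic c *\<^sub>R outer (\<Delta> p m \<omega>) (\<Delta> p m \<omega>)) \<le> 1 * D\<^sup>2" if "m \<in> edges A p" for m c
    using sq[OF that] deriv_logistic_bounds[of c] unfolding norm_scaleR by (intro mult_mono) auto
  have "real (card (edges A p)) * D\<^sup>2 \<le> a * D\<^sup>2" by (intro mult_right_mono card_edges assms) simp
  then show "norm (U p \<omega>) \<le> a * D\<^sup>2" "norm (V p \<omega>) \<le> a * D\<^sup>2"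
    unfolding U_def V_def using sq * by (auto intro!: order_trans[OF norm_sum order_trans[OF sum_bounded_above]])
qed

lemma UV_deviation:
  assumes r: "0 < r"
  shows "prob {\<omega>\<in>space P. norm ((\<Sum>p\<in>I. U p \<omega>) - (\<Sum>p\<in>I. expectation (U p))) > r} \<le> N * (2 * (a * D\<^sup>2))\<^sup>2 / r\<^sup>2"
    and "prob {\<omega>\<in>space P. norm ((\<Sum>p\<in>I. V p \<omega>) - (\<Sum>p\<in>I. expectation (V p))) > r} \<le> N * (2 * (a * D\<^sup>2))\<^sup>2 / r\<^sup>2"
proof -
  have gen: "prob {\<omega>\<in>space P. norm ((\<Sum>p\<in>I. F p (X \<omega> p)) - (\<Sum>p\<in>I. expectation (\<lambda>\<omega>. F p (X \<omega> p)))) > r} \<le> N * (2 * (a * D\<^sup>2))\<^sup>2 / r\<^sup>2"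
    if F: "\<And>p \<omega>. \<omega> \<in> space P \<Longrightarrow> p \<in> I \<Longrightarrow> norm (F p (X \<omega> p)) \<le> a * D\<^sup>2"
    for F :: "nat \<times> nat \<Rightarrow> ('v set \<Rightarrow> nat) \<Rightarrow> real ^ 'd ^ 'd"
  proof (rule prob_norm_gt_le[where B="N * (a * D\<^sup>2) + norm (\<Sum>p\<in>I. expectation (\<lambda>\<omega>. F p (X \<omega> p)))"])
    show "(\<lambda>\<omega>. (\<Sum>p\<in>I. F p (X \<omega> p)) - (\<Sum>p\<in>I. expectation (\<lambda>\<omega>. F p (X \<omega> p)))) \<in> borel_measurable P"
      by (rule measurable_fun_X)
    show "expectation (\<lambda>\<omega>. (norm ((\<Sum>p\<in>I. F p (X \<omega> p)) - (\<Sum>p\<in>I. expectation (\<lambda>\<omega>. F p (X \<omega> p)))))\<^sup>2) \<le> N * (2 * (a * D\<^sup>2))\<^sup>2"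
      unfolding N_def by (rule indep_sum_norm_square[OF finite_I indep_fun[of F] F])
    fix \<omega> assume w: "\<omega> \<in> space P"
    have "norm (\<Sum>p\<in>I. F p (X \<omega> p)) \<le> N * (a * D\<^sup>2)"
      unfolding N_def by (rule order_trans[OF norm_sum sum_bounded_above]) (rule F[OF w])
    then show "norm ((\<Sum>p\<in>I. F p (X \<omega> p)) - (\<Sum>p\<in>I. expectation (\<lambda>\<omega>. F p (X \<omega> p)))) \<le> N * (a * D\<^sup>2) + norm (\<Sum>p\<in>I. expectation (\<lambda>\<omega>. F p (X \<omega> p)))"
      using norm_triangle_ineq4[of "\<Sum>p\<in>I. F p (X \<omega> p)" "\<Sum>p\<in>I. expectation (\<lambda>\<omega>. F p (X \<omega> p))"] by linarith
  qed (rule r)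
  show "prob {\<omega>\<in>space P. norm ((\<Sum>p\<in>I. U p \<omega>) - (\<Sum>p\<in>I. expectation (U p))) > r} \<le> N * (2 * (a * D\<^sup>2))\<^sup>2 / r\<^sup>2"
    using gen[of "\<lambda>p x. \<Sum>m\<in>edges A p. outer (edge_diff m (s p) x) (edge_diff m (s p) x)"] UV_bound(1)
    by (simp add: U_def[abs_def])
  show "prob {\<omega>\<in>space P. norm ((\<Sum>p\<in>I. V p \<omega>) - (\<Sum>p\<in>I. expectation (V p))) > r} \<le> N * (2 * (a * D\<^sup>2))\<^sup>2 / r\<^sup>2"
    using gen[of "\<lambda>p x. \<Sum>m\<in>edges A p. deriv logistic (\<beta> \<bullet> edge_diff m (s p) x) *\<^sub>R outer (edge_diff m (s p) x) (edge_diff m (s p) x)"] UV_bound(2)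
    by (simp add: V_def[abs_def])
qed

lemma hessian_eq: "stein_hessian I A s (X \<omega>) \<beta> = (\<Sum>p\<in>I. V p \<omega>)"
  by (simp add: stein_hessian_def V_def)

lemma UV_integrable:
  assumes "p \<in> I"
  shows "integrable P (U p)" "integrable P (V p)"
proof -
  have "AE \<omega> in P. norm (U p \<omega>) \<le> a * D\<^sup>2" "AE \<omega> in P. norm (V p \<omega>) \<le> a * D\<^sup>2"
    using UV_bound[OF _ assms] by (auto intro!: AE_I2)
  then show "integrable P (U p)" "integrable P (V p)"
    unfolding U_def V_def by (auto intro: integrable_const_bound measurable_fun_X)
qed

lemma expectation_hessian: "expectation (\<lambda>\<omega>. stein_hessian I A s (X \<omega>) \<beta>) = (\<Sum>p\<in>I. expectation (V p))"
  unfolding hessian_eq by (rule Bochner_Integration.integral_sum) (rule UV_integrable)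

lemma expected_U_lower: "N * \<xi> * (norm v)\<^sup>2 \<le> v \<bullet> ((\<Sum>p\<in>I. expectation (U p)) *v v)"
proof -
  have "\<xi> * (norm v)\<^sup>2 \<le> v \<bullet> (expectation (U p) *v v)" if p: "p \<in> I" for p
  proof -
    have m: "(\<lambda>\<omega>. outer (\<Delta> p m \<omega>) (\<Delta> p m \<omega>)) \<in> borel_measurable P" for m
      by (rule measurable_fun_X)
    have int: "integrable P (\<lambda>\<omega>. outer (\<Delta> p m \<omega>) (\<Delta> p m \<omega>))" if "m \<in> edges A p" for m
    proof (rule integrable_const_bound[where B="D * D", OF AE_I2 m])
      fix \<omega> assume "\<omega> \<in> space P"
      with \<Delta>[OF this p that] show "norm (outer (\<Delta> p m \<omega>) (\<Delta> p m \<omega>)) \<le> D * D"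
        unfolding norm_outer using D by (intro mult_mono) auto
    qed
    have E: "expectation (U p) = (\<Sum>m\<in>edges A p. expectation (\<lambda>\<omega>. outer (\<Delta> p m \<omega>) (\<Delta> p m \<omega>)))"
      unfolding U_def[abs_def] using int by (rule Bochner_Integration.integral_sum)
    have form: "u \<bullet> (expectation (\<lambda>\<omega>. outer (\<Delta> p m \<omega>) (\<Delta> p m \<omega>)) *v w) = expectation (\<lambda>\<omega>. (u \<bullet> \<Delta> p m \<omega>) * (w \<bullet> \<Delta> p m \<omega>))"
      if "m \<in> edges A p" for u w m
      by (rule expectation_outer_form[OF m]) (rule \<Delta>[OF _ p that])
    have sym: "transpose (expectation (U p)) = expectation (U p)"
      by (rule symmetric_if_form_symmetric) (simp add: E matrix_vector_mult_sum inner_sum_right form mult.commute)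
    have "\<xi> * (norm v)\<^sup>2 \<le> lambda_min (expectation (U p)) * (norm v)\<^sup>2"
      unfolding E by (intro mult_right_mono \<xi> p) simp
    also have "\<dots> \<le> v \<bullet> (expectation (U p) *v v)" by (rule lambda_min_le_quadratic_form[OF sym])
    finally show ?thesis .
  qed
  then have "(\<Sum>p\<in>I. \<xi> * (norm v)\<^sup>2) \<le> (\<Sum>p\<in>I. v \<bullet> (expectation (U p) *v v))" by (intro sum_mono)
  then show ?thesis by (simp add: N_def mult.assoc matrix_vector_mult_sum inner_sum_right)
qed

text \<open>
  The constants come from \<open>root_linearization_error\<close> with monotonicity constant \<open>k = exp (-RD) / 4 \<cdot> N \<xi> / 2\<close> (half of the mean
  of \<open>\<Sum> \<Delta> \<Delta>\<^sup>T\<close> survives), Taylor constant \<open>N a D\<^sup>3\<close> and \<open>norm (J g) + norm Z \<le> 2 r\<close>, so that the estimation error is at most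
  \<open>16 r exp (RD) a D / (\<xi> sqrt N)\<close>.
\<close>

lemma linearization_on_good_event:
  assumes w: "\<omega> \<in> space P" and r: "1 \<le> r" and e: "e \<le> 1"
    and g_hat: "norm (J *v stein_g I A s (X \<omega>) (b (X \<omega>))) \<le> e"
    and Z: "norm (Z \<omega>) \<le> r"
    and U: "norm ((\<Sum>p\<in>I. U p \<omega>) - (\<Sum>p\<in>I. expectation (U p))) \<le> N * \<xi> / 2"
    and V: "norm ((\<Sum>p\<in>I. V p \<omega>) - (\<Sum>p\<in>I. expectation (V p))) \<le> r * (sqrt N * (2 * (a * D\<^sup>2)))"
  shows "norm (W \<omega> - Z \<omega>) \<le> e + 32 * r\<^sup>2 / (\<xi> * sqrt \<zeta>) * (exp (R * D) * a\<^sup>2 * D ^ 3 / sqrt N)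
    + 256 * r\<^sup>2 / (\<xi>\<^sup>2 * sqrt \<zeta>) * (exp (2 * R * D) * a ^ 3 * D ^ 5 / sqrt N)"
proof -
  let ?gh = "stein_g I A s (X \<omega>) (b (X \<omega>))" and ?\<delta> = "b (X \<omega>) - \<beta>"
  let ?H = "stein_hessian I A s (X \<omega>) \<beta>" and ?E = "expectation (\<lambda>\<omega>. stein_hessian I A s (X \<omega>) \<beta>)"
  define k where "k = exp (- (R * D)) / 4 * (N * \<xi> / 2)"
  define q where "q = N * a * D ^ 3"
  define \<tau> where "\<tau> = norm (J *v ?gh) + norm (J *v g \<omega>)"
  define c where "c = sqrt (N * (a * D)\<^sup>2) * \<tau> / k"
  have pos: "0 < k" "0 \<le> q" using N \<xi> a D by (auto simp: k_def q_def)
  have quad: "N * \<xi> / 2 * (norm ?\<delta>)\<^sup>2 \<le> ?\<delta> \<bullet> ((\<Sum>p\<in>I. U p \<omega>) *v ?\<delta>)"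
  proof -
    let ?F = "(\<Sum>p\<in>I. U p \<omega>) - (\<Sum>p\<in>I. expectation (U p))"
    have "\<bar>?\<delta> \<bullet> (?F *v ?\<delta>)\<bar> \<le> norm ?\<delta> * (norm ?F * norm ?\<delta>)"
      by (rule order_trans[OF Cauchy_Schwarz_ineq2]) (intro mult_left_mono norm_matrix_vector_mult_le norm_ge_zero)
    also have "\<dots> \<le> norm ?\<delta> * (N * \<xi> / 2 * norm ?\<delta>)"
      by (intro mult_left_mono mult_right_mono U norm_ge_zero)
    also have "\<dots> = N * \<xi> / 2 * (norm ?\<delta>)\<^sup>2" by (simp add: power2_eq_square)
    finally have close: "\<bar>?\<delta> \<bullet> ((\<Sum>p\<in>I. U p \<omega>) *v ?\<delta>) - ?\<delta> \<bullet> ((\<Sum>p\<in>I. expectation (U p)) *v ?\<delta>)\<bar> \<le> N * \<xi> / 2 * (norm ?\<delta>)\<^sup>2"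
      by (simp only: matrix_vector_mult_diff_rdistrib inner_diff_right)
    have halve: "y \<le> x" if "\<bar>x - z\<bar> \<le> y" "2 * y \<le> z" for x y z :: real using that by linarith
    show ?thesis by (rule halve[OF close]) (use expected_U_lower[of ?\<delta>] in simp)
  qed
  have "norm ((J ** ?E) *v ?\<delta> - (- (J *v g \<omega>))) \<le> norm (J *v ?gh) + (norm (?H - ?E) * c + q * c\<^sup>2) / sqrt (N * \<zeta>)"
    unfolding J_def c_def \<tau>_def
  proof (rule root_linearization_error[OF S_symmetric S_lower N\<zeta>_pos S_upper _ pos(1) _ pos(2)])
    have "k * (norm ?\<delta>)\<^sup>2 \<le> exp (- (R * D)) / 4 * (?\<delta> \<bullet> ((\<Sum>p\<in>I. U p \<omega>) *v ?\<delta>))"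
      using mult_left_mono[OF quad, of "exp (- (R * D)) / 4"] by (simp add: k_def mult.assoc)
    also have "\<dots> \<le> ?\<delta> \<bullet> (?gh - g \<omega>)"
      unfolding U_def by (rule stein_g_strongly_monotone) (auto intro: \<Delta> w D b \<beta>)
    finally show "k * (norm ?\<delta>)\<^sup>2 \<le> ?\<delta> \<bullet> (?gh - g \<omega>)" .
    show "norm (?gh - g \<omega> - ?H *v ?\<delta>) \<le> q * (norm ?\<delta>)\<^sup>2"
      unfolding q_def N_def by (rule stein_g_taylor) (auto intro: \<Delta> w D card_edges)
  qed
  then have main: "norm (W \<omega> - Z \<omega>) \<le> norm (J *v ?gh) + (norm (?H - ?E) * c + q * c\<^sup>2) / sqrt (N * \<zeta>)"
    by (simp add: W_def Z_def Q_matrix_def S_def J_def)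
  define x where "x = exp (R * D)"
  define n where "n = sqrt N"
  have n: "0 < n" "N = n * n" using N by (auto simp: n_def)
  have x: "0 < x" "exp (2 * R * D) = x\<^sup>2" "exp (- (R * D)) = 1 / x"
    by (simp_all add: x_def power2_eq_square exp_add[symmetric] exp_minus inverse_eq_divide)
  have "\<tau> \<le> e + r" using g_hat Z by (simp add: \<tau>_def Z_def)
  then have \<tau>: "\<tau> \<le> 2 * r" using r e by linarith
  have c_eq: "c = 8 * x * a * D * \<tau> / (\<xi> * n)"
  proof -
    have root: "sqrt (N * (a * D)\<^sup>2) = n * (a * D)" using a D by (simp add: n_def real_sqrt_mult)
    have "c = n * (a * D) * \<tau> / (1 / x / 4 * (n * n * \<xi> / 2))"
      by (simp only: c_def k_def root x(3) n(2)[symmetric])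
    then show ?thesis using n(1) x(1) \<xi>(1) by (simp add: field_simps)
  qed
  have "8 * x * a * D * \<tau> / (\<xi> * n) \<le> 8 * x * a * D * (2 * r) / (\<xi> * n)"
    using x(1) a D n(1) \<xi>(1) \<tau> by (intro divide_right_mono mult_left_mono) auto
  then have c: "c \<le> 16 * x * a * D * r / (\<xi> * n)" by (simp add: c_eq mult_ac)
  have c0: "0 \<le> c" using x(1) a D n(1) \<xi>(1) by (simp add: c_eq \<tau>_def)
  have H: "norm (?H - ?E) \<le> r * (n * (2 * (a * D\<^sup>2)))"
    using V by (simp add: hessian_eq[symmetric] expectation_hessian[symmetric] n_def)
  have "norm (?H - ?E) * c + q * c\<^sup>2 \<le> r * (n * (2 * (a * D\<^sup>2))) * (16 * x * a * D * r / (\<xi> * n)) + q * (16 * x * a * D * r / (\<xi> * n))\<^sup>2"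
    using r n a D pos(2) by (intro add_mono mult_mono mult_left_mono power_mono H c c0) auto
  then have "(norm (?H - ?E) * c + q * c\<^sup>2) / sqrt (N * \<zeta>)
      \<le> (r * (n * (2 * (a * D\<^sup>2))) * (16 * x * a * D * r / (\<xi> * n)) + q * (16 * x * a * D * r / (\<xi> * n))\<^sup>2) / sqrt (N * \<zeta>)"
    by (intro divide_right_mono) (use N\<zeta>_pos in auto)
  also have "\<dots> = 32 * r\<^sup>2 / (\<xi> * sqrt \<zeta>) * (x * a\<^sup>2 * D ^ 3 / n) + 256 * r\<^sup>2 / (\<xi>\<^sup>2 * sqrt \<zeta>) * (x\<^sup>2 * a ^ 3 * D ^ 5 / n)"
  proof -
    have root: "sqrt (N * \<zeta>) = n * sqrt \<zeta>" by (simp add: n_def real_sqrt_mult)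
    show ?thesis unfolding root q_def unfolding n(2) using n(1) \<xi>(1) \<zeta>(1)
      by (simp add: field_simps power2_eq_square eval_nat_numeral)
  qed
  finally show ?thesis unfolding x(2) x_def[symmetric] n_def[symmetric] using main g_hat by linarith
qed

text \<open>
  Of the four events that are excluded in \<open>linearization_on_good_event\<close>, the one about the score at the estimator
  stays in the bound; the probabilities of the others are bounded by Chebyshev's inequality.
\<close>

lemma linearization_error_prob:
  assumes r: "1 \<le> r" and e: "e \<le> 1"
    and small: "e + 32 * r\<^sup>2 / (\<xi> * sqrt \<zeta>) * (exp (R * D) * a\<^sup>2 * D ^ 3 / sqrt N)
      + 256 * r\<^sup>2 / (\<xi>\<^sup>2 * sqrt \<zeta>) * (exp (2 * R * D) * a ^ 3 * D ^ 5 / sqrt N) \<le> \<epsilon>"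
  shows "prob {\<omega>\<in>space P. norm (W \<omega> - Z \<omega>) > \<epsilon>}
    \<le> prob {\<omega>\<in>space P. norm (J *v stein_g I A s (X \<omega>) (b (X \<omega>))) > e}
      + (real CARD('d) + 1) / r\<^sup>2 + 16 / \<xi>\<^sup>2 * (a * D\<^sup>2 / sqrt N)\<^sup>2"
proof -
  let ?B1 = "{\<omega>\<in>space P. norm (J *v stein_g I A s (X \<omega>) (b (X \<omega>))) > e}"
  let ?B2 = "{\<omega>\<in>space P. norm (Z \<omega>) > r}"
  let ?B3 = "{\<omega>\<in>space P. norm ((\<Sum>p\<in>I. U p \<omega>) - (\<Sum>p\<in>I. expectation (U p))) > N * \<xi> / 2}"
  let ?B4 = "{\<omega>\<in>space P. norm ((\<Sum>p\<in>I. V p \<omega>) - (\<Sum>p\<in>I. expectation (V p))) > r * (sqrt N * (2 * (a * D\<^sup>2)))}"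
  have meas: "{\<omega>\<in>space P. norm (F (X \<omega>)) > c} \<in> events" for F :: "'v graph \<Rightarrow> 'e::euclidean_space" and c
    using measurable_fun_X[of F, measurable] by measurable
  have B1: "?B1 \<in> events" by (rule meas)
  have B2: "?B2 \<in> events" by measurable
  have B3: "?B3 \<in> events" unfolding U_def
    by (rule meas[of _ "\<lambda>x. (\<Sum>p\<in>I. \<Sum>m\<in>edges A p. outer (edge_diff m (s p) (x p)) (edge_diff m (s p) (x p))) - _"])
  have B4: "?B4 \<in> events" unfolding V_def
    by (rule meas[of _ "\<lambda>x. (\<Sum>p\<in>I. \<Sum>m\<in>edges A p. deriv logistic (\<beta> \<bullet> edge_diff m (s p) (x p)) *\<^sub>R outer (edge_diff m (s p) (x p)) (edge_diff m (s p) (x p))) - _"])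
  have "prob {\<omega>\<in>space P. norm (W \<omega> - Z \<omega>) > \<epsilon>} \<le> prob (((?B1 \<union> ?B2) \<union> ?B3) \<union> ?B4)"
  proof (rule finite_measure_mono)
    show "{\<omega>\<in>space P. norm (W \<omega> - Z \<omega>) > \<epsilon>} \<subseteq> ((?B1 \<union> ?B2) \<union> ?B3) \<union> ?B4"
    proof
      fix \<omega> assume w: "\<omega> \<in> {\<omega>\<in>space P. norm (W \<omega> - Z \<omega>) > \<epsilon>}"
      show "\<omega> \<in> ((?B1 \<union> ?B2) \<union> ?B3) \<union> ?B4"
      proof (rule ccontr)
        assume "\<omega> \<notin> ((?B1 \<union> ?B2) \<union> ?B3) \<union> ?B4"
        with w have "norm (W \<omega> - Z \<omega>) \<le> e + 32 * r\<^sup>2 / (\<xi> * sqrt \<zeta>) * (exp (R * D) * a\<^sup>2 * D ^ 3 / sqrt N)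
            + 256 * r\<^sup>2 / (\<xi>\<^sup>2 * sqrt \<zeta>) * (exp (2 * R * D) * a ^ 3 * D ^ 5 / sqrt N)"
          by (intro linearization_on_good_event r e) (auto simp: not_less)
        with small w show False by auto
      qed
    qed
    show "((?B1 \<union> ?B2) \<union> ?B3) \<union> ?B4 \<in> events" by (intro sets.Un B1 B2 B3 B4)
  qed
  also have "\<dots> \<le> prob ((?B1 \<union> ?B2) \<union> ?B3) + prob ?B4" by (intro measure_Un_le sets.Un B1 B2 B3 B4)
  also have "prob ((?B1 \<union> ?B2) \<union> ?B3) \<le> prob (?B1 \<union> ?B2) + prob ?B3" by (intro measure_Un_le sets.Un B1 B2 B3)
  also have "prob (?B1 \<union> ?B2) \<le> prob ?B1 + prob ?B2" by (intro measure_Un_le B1 B2)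
  also have "prob ?B2 \<le> real CARD('d) / r\<^sup>2" by (rule Z_tight) (use r in simp)
  also have "prob ?B3 \<le> N * (2 * (a * D\<^sup>2))\<^sup>2 / (N * \<xi> / 2)\<^sup>2"
    by (rule UV_deviation) (use N \<xi> in simp)
  also have "\<dots> = 16 / \<xi>\<^sup>2 * (a * D\<^sup>2 / sqrt N)\<^sup>2"
    using N \<xi>(1) by (simp add: power_mult_distrib power_divide) (simp add: field_simps power2_eq_square)
  also have "prob ?B4 \<le> N * (2 * (a * D\<^sup>2))\<^sup>2 / (r * (sqrt N * (2 * (a * D\<^sup>2))))\<^sup>2"
    by (rule UV_deviation) (use N r aD_pos in simp)
  also have "\<dots> = 1 / r\<^sup>2"
    using N r aD_pos by (simp add: power_mult_distrib)
  finally show ?thesis by (simp add: add_divide_distrib)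
qed

end

section \<open>Asymptotic normality\<close>

text \<open>
  The rates say, in this order, that the summands of \<open>Z\<close> are uniformly small, that \<open>\<Sum> \<Delta> \<Delta>\<^sup>T\<close> concentrates, and that the
  fluctuation of the Hessian and the Taylor remainder contribute negligibly to \<open>W - Z\<close>.  The model assumptions are
  only required eventually: there are no between-block pairs when there is a single block.
\<close>

theorem stein_estimator_asymptotically_normal:
  fixes P :: "nat \<Rightarrow> 'w measure" and X :: "nat \<Rightarrow> 'w \<Rightarrow> 'v graph" and s :: "nat \<Rightarrow> ('v, 'd::finite) statistics"
  assumes P: "\<And>n. prob_space (P n)" and X: "\<And>n. X n \<in> P n \<rightarrow>\<^sub>M count_space UNIV"
    and model: "\<forall>\<^sub>F n in sequentially. stein_model (P n) (X n) (I n) (A n) (s n) \<beta> (b n) R (D n) (a n) \<xi> \<zeta>"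
    and root: "converges_in_probability P (\<lambda>n \<omega>. inv_sqrt_matrix (g_cov (P n) (X n) (I n) (A n) (s n) \<beta>) *v
            stein_g (I n) (A n) (s n) (X n \<omega>) (b n (X n \<omega>))) 0"
    and rate: "(\<lambda>n. a n * D n / sqrt (real (card (I n)))) \<longlonglongrightarrow> 0"
      "(\<lambda>n. a n * (D n)\<^sup>2 / sqrt (real (card (I n)))) \<longlonglongrightarrow> 0"
      "(\<lambda>n. exp (R * D n) * (a n)\<^sup>2 * D n ^ 3 / sqrt (real (card (I n)))) \<longlonglongrightarrow> 0"
      "(\<lambda>n. exp (2 * R * D n) * a n ^ 3 * D n ^ 5 / sqrt (real (card (I n)))) \<longlonglongrightarrow> 0"
  shows "converges_in_distribution P
           (\<lambda>n \<omega>. Q_matrix (P n) (X n) (I n) (A n) (s n) \<beta> *v (b n (X n \<omega>) - \<beta>)) std_normal_vector"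
proof -
  define J where "J n = inv_sqrt_matrix (g_cov (P n) (X n) (I n) (A n) (s n) \<beta>)" for n
  define Z where "Z n \<omega> = - (J n *v stein_g (I n) (A n) (s n) (X n \<omega>) \<beta>)" for n \<omega>
  define W where "W n \<omega> = Q_matrix (P n) (X n) (I n) (A n) (s n) \<beta> *v (b n (X n \<omega>) - \<beta>)" for n \<omega>
  define N where "N n = real (card (I n))" for n
  interpret P: prob_space "P n" for n by (rule P)
  have meas: "(\<lambda>\<omega>. F (X n \<omega>)) \<in> borel_measurable (P n)" for F :: "'v graph \<Rightarrow> 'e::topological_space" and n
    by (rule measurable_compose[OF X]) simp
  have Zm: "Z n \<in> borel_measurable (P n)" and Wm: "W n \<in> borel_measurable (P n)" for n
    unfolding Z_def W_def by (rule meas)+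
  have from_model:
    "cmod ((\<integral>\<omega>. iexp (t \<bullet> Z n \<omega>) \<partial>P n) - complex_of_real (exp (- (norm t)\<^sup>2 / 2)))
      \<le> (norm t * (a n * D n / sqrt (N n * \<zeta>)) + (norm t * (a n * D n / sqrt (N n * \<zeta>)))\<^sup>2) * (norm t)\<^sup>2"
    "0 < r \<Longrightarrow> measure (P n) {\<omega>\<in>space (P n). norm (Z n \<omega>) > r} \<le> real CARD('d) / r\<^sup>2"
    "1 \<le> r \<Longrightarrow> e \<le> 1 \<Longrightarrow> e + 32 * r\<^sup>2 / (\<xi> * sqrt \<zeta>) * (exp (R * D n) * (a n)\<^sup>2 * D n ^ 3 / sqrt (N n))
      + 256 * r\<^sup>2 / (\<xi>\<^sup>2 * sqrt \<zeta>) * (exp (2 * R * D n) * a n ^ 3 * D n ^ 5 / sqrt (N n)) \<le> \<epsilon> \<Longrightarrow>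
      measure (P n) {\<omega>\<in>space (P n). norm (W n \<omega> - Z n \<omega>) > \<epsilon>}
    \<le> measure (P n) {\<omega>\<in>space (P n). norm (J n *v stein_g (I n) (A n) (s n) (X n \<omega>) (b n (X n \<omega>))) > e}
      + (real CARD('d) + 1) / r\<^sup>2 + 16 / \<xi>\<^sup>2 * (a n * (D n)\<^sup>2 / sqrt (N n))\<^sup>2"
    if "stein_model (P n) (X n) (I n) (A n) (s n) \<beta> (b n) R (D n) (a n) \<xi> \<zeta>" for n t r e \<epsilon>
  proof -
    interpret M: stein_model "P n" "X n" "I n" "A n" "s n" \<beta> "b n" R "D n" "a n" \<xi> \<zeta> by (rule that)
    have eq: "J n = M.J" "Z n = M.Z" "W n = M.W" "N n = M.N"
      by (simp_all add: fun_eq_iff J_def Z_def W_def N_def M.J_def M.S_def M.Z_def M.W_def M.N_def)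
    show "cmod ((\<integral>\<omega>. iexp (t \<bullet> Z n \<omega>) \<partial>P n) - complex_of_real (exp (- (norm t)\<^sup>2 / 2)))
      \<le> (norm t * (a n * D n / sqrt (N n * \<zeta>)) + (norm t * (a n * D n / sqrt (N n * \<zeta>)))\<^sup>2) * (norm t)\<^sup>2"
      unfolding eq by (rule M.Z_iexp_approx)
    show "0 < r \<Longrightarrow> measure (P n) {\<omega>\<in>space (P n). norm (Z n \<omega>) > r} \<le> real CARD('d) / r\<^sup>2"
      unfolding eq by (rule M.Z_tight)
    show "1 \<le> r \<Longrightarrow> e \<le> 1 \<Longrightarrow> e + 32 * r\<^sup>2 / (\<xi> * sqrt \<zeta>) * (exp (R * D n) * (a n)\<^sup>2 * D n ^ 3 / sqrt (N n))
      + 256 * r\<^sup>2 / (\<xi>\<^sup>2 * sqrt \<zeta>) * (exp (2 * R * D n) * a n ^ 3 * D n ^ 5 / sqrt (N n)) \<le> \<epsilon> \<Longrightarrow>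
      measure (P n) {\<omega>\<in>space (P n). norm (W n \<omega> - Z n \<omega>) > \<epsilon>}
    \<le> measure (P n) {\<omega>\<in>space (P n). norm (J n *v stein_g (I n) (A n) (s n) (X n \<omega>) (b n (X n \<omega>))) > e}
      + (real CARD('d) + 1) / r\<^sup>2 + 16 / \<xi>\<^sup>2 * (a n * (D n)\<^sup>2 / sqrt (N n))\<^sup>2"
      unfolding eq by (rule M.linearization_error_prob)
  qed
  have iexp: "(\<lambda>n. \<integral>\<omega>. iexp (t \<bullet> Z n \<omega>) \<partial>P n) \<longlonglongrightarrow> complex_of_real (exp (- (norm t)\<^sup>2 / 2))" for t
  proof -
    have "(\<lambda>n. a n * D n / sqrt (N n) * (1 / sqrt \<zeta>)) \<longlonglongrightarrow> 0 * (1 / sqrt \<zeta>)"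
      unfolding N_def by (intro tendsto_mult tendsto_const rate)
    then have "(\<lambda>n. a n * D n / sqrt (N n * \<zeta>)) \<longlonglongrightarrow> 0" by (simp add: real_sqrt_mult)
    then have "(\<lambda>n. (norm t * (a n * D n / sqrt (N n * \<zeta>)) + (norm t * (a n * D n / sqrt (N n * \<zeta>)))\<^sup>2) * (norm t)\<^sup>2)
      \<longlonglongrightarrow> (norm t * 0 + (norm t * 0)\<^sup>2) * (norm t)\<^sup>2"
      by (intro tendsto_add tendsto_mult tendsto_power tendsto_const)
    then have lim: "(\<lambda>n. (norm t * (a n * D n / sqrt (N n * \<zeta>)) + (norm t * (a n * D n / sqrt (N n * \<zeta>)))\<^sup>2) * (norm t)\<^sup>2) \<longlonglongrightarrow> 0"
      by simp
    have "\<forall>\<^sub>F n in sequentially. cmod ((\<integral>\<omega>. iexp (t \<bullet> Z n \<omega>) \<partial>P n) - complex_of_real (exp (- (norm t)\<^sup>2 / 2)))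
      \<le> (norm t * (a n * D n / sqrt (N n * \<zeta>)) + (norm t * (a n * D n / sqrt (N n * \<zeta>)))\<^sup>2) * (norm t)\<^sup>2"
      using model by eventually_elim (rule from_model(1))
    from Lim_null_comparison[OF this lim] show ?thesis by (rule LIM_zero_cancel)
  qed
  have int: "integrable (P n) (\<lambda>\<omega>. iexp (t \<bullet> Z n \<omega>))" for t n
    using Zm[of n] by (intro P.integrable_iexp) auto
  have "converges_in_distribution P W std_normal_vector"
  proof (rule converges_in_distribution_slutsky[OF P prob_space_std_normal_vector sets_std_normal_vector Zm Wm])
    fix t
    have "(\<integral>\<omega>. cos (t \<bullet> Z n \<omega>) \<partial>P n) = Re (\<integral>\<omega>. iexp (t \<bullet> Z n \<omega>) \<partial>P n)"
      "(\<integral>\<omega>. sin (t \<bullet> Z n \<omega>) \<partial>P n) = Im (\<integral>\<omega>. iexp (t \<bullet> Z n \<omega>) \<partial>P n)" for n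
      by (simp_all add: integral_Re[OF int, symmetric] integral_Im[OF int, symmetric] Re_exp Im_exp)
    then show "(\<lambda>n. \<integral>\<omega>. cos (t \<bullet> Z n \<omega>) \<partial>P n) \<longlonglongrightarrow> (\<integral>z. cos (t \<bullet> z) \<partial>std_normal_vector)"
      "(\<lambda>n. \<integral>\<omega>. sin (t \<bullet> Z n \<omega>) \<partial>P n) \<longlonglongrightarrow> (\<integral>z. sin (t \<bullet> z) \<partial>std_normal_vector)"
      using tendsto_Re[OF iexp[of t]] tendsto_Im[OF iexp[of t]] by (simp_all add: std_normal_vector_cos_sin)
  next
    fix e :: real assume e: "e > 0"
    define r where "r = sqrt (real CARD('d) / e)"
    have r: "0 < r" "real CARD('d) / r\<^sup>2 = e" using e by (simp_all add: r_def)
    have "\<forall>\<^sub>F n in sequentially. measure (P n) {\<omega> \<in> space (P n). norm (Z n \<omega>) > r} \<le> e"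
      using model
    proof eventually_elim
      case (elim n)
      from from_model(2)[OF this r(1)] show ?case by (simp only: r(2))
    qed
    then show "\<exists>r. \<forall>\<^sub>F n in sequentially. measure (P n) {\<omega> \<in> space (P n). norm (Z n \<omega>) > r} \<le> e" by blast
  next
    show "converges_in_probability P (\<lambda>n \<omega>. W n \<omega> - Z n \<omega>) 0"
      unfolding converges_in_probability_def
    proof (intro allI impI tendstoI)
      fix \<epsilon> \<eta> :: real assume \<epsilon>: "\<epsilon> > 0" and \<eta>: "\<eta> > 0"
      define e where "e = min 1 (\<epsilon> / 2)"
      have e: "0 < e" "e \<le> 1" "e \<le> \<epsilon> / 2" using \<epsilon> by (auto simp: e_def)
      define r where "r = max 1 (sqrt (3 * (real CARD('d) + 1) / \<eta>))"
      have "3 * (real CARD('d) + 1) / \<eta> = (sqrt (3 * (real CARD('d) + 1) / \<eta>))\<^sup>2" using \<eta> by simp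
      also have "\<dots> \<le> r\<^sup>2" by (intro power_mono) (use \<eta> in \<open>auto simp: r_def\<close>)
      finally have r: "1 \<le> r" "(real CARD('d) + 1) / r\<^sup>2 \<le> \<eta> / 3"
        using \<eta> by (auto simp: r_def field_simps)
      define err where "err n = 32 * r\<^sup>2 / (\<xi> * sqrt \<zeta>) * (exp (R * D n) * (a n)\<^sup>2 * D n ^ 3 / sqrt (N n))
        + 256 * r\<^sup>2 / (\<xi>\<^sup>2 * sqrt \<zeta>) * (exp (2 * R * D n) * a n ^ 3 * D n ^ 5 / sqrt (N n))" for n
      have "err \<longlonglongrightarrow> 32 * r\<^sup>2 / (\<xi> * sqrt \<zeta>) * 0 + 256 * r\<^sup>2 / (\<xi>\<^sup>2 * sqrt \<zeta>) * 0"
        unfolding err_def N_def by (intro tendsto_add tendsto_mult tendsto_const rate)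
      then have "\<forall>\<^sub>F n in sequentially. err n < \<epsilon> / 2" using \<epsilon> by (intro order_tendstoD) auto
      moreover have "(\<lambda>n. 16 / \<xi>\<^sup>2 * (a n * (D n)\<^sup>2 / sqrt (N n))\<^sup>2) \<longlonglongrightarrow> 16 / \<xi>\<^sup>2 * 0\<^sup>2"
        unfolding N_def by (intro tendsto_mult tendsto_power tendsto_const rate)
      then have "\<forall>\<^sub>F n in sequentially. 16 / \<xi>\<^sup>2 * (a n * (D n)\<^sup>2 / sqrt (N n))\<^sup>2 < \<eta> / 3"
        using \<eta> by (intro order_tendstoD) auto
      moreover have "\<forall>\<^sub>F n in sequentially.
          measure (P n) {\<omega>\<in>space (P n). norm (J n *v stein_g (I n) (A n) (s n) (X n \<omega>) (b n (X n \<omega>))) > e} < \<eta> / 3"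
        using root e(1) \<eta> unfolding converges_in_probability_def dist_norm J_def diff_zero
        by (intro order_tendstoD) auto
      ultimately show "\<forall>\<^sub>F n in sequentially. dist (measure (P n) {\<omega> \<in> space (P n). dist (W n \<omega> - Z n \<omega>) 0 > \<epsilon>}) 0 < \<eta>"
        using model
      proof eventually_elim
        case (elim n)
        have "e + err n \<le> \<epsilon>" using elim(1) e by linarith
        then have "measure (P n) {\<omega>\<in>space (P n). norm (W n \<omega> - Z n \<omega>) > \<epsilon>}
          \<le> measure (P n) {\<omega>\<in>space (P n). norm (J n *v stein_g (I n) (A n) (s n) (X n \<omega>) (b n (X n \<omega>))) > e}
            + (real CARD('d) + 1) / r\<^sup>2 + 16 / \<xi>\<^sup>2 * (a n * (D n)\<^sup>2 / sqrt (N n))\<^sup>2"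
          by (intro from_model(3)[OF elim(4) r(1) e(2)]) (simp add: err_def)
        then have "measure (P n) {\<omega>\<in>space (P n). norm (W n \<omega> - Z n \<omega>) > \<epsilon>} < \<eta>"
          using elim(2,3) r(2) by linarith
        then show ?case by simp
      qed
    qed
  qed
  then show ?thesis by (simp add: W_def[abs_def])
qed

text \<open>
  All error terms are of the form \<open>exp (j R D) a\<^sup>i D\<^sup>k / sqrt N\<close> with \<open>a = M\<^sup>2\<close> and \<open>D = L M\<^sup>C\<close>; the growth condition dominates them up
  to the exponents \<open>j = 2\<close>, \<open>i = 7\<close> and \<open>k = 5\<close>.
\<close>

lemma growth_tendsto:
  fixes K M :: "nat \<Rightarrow> nat" and L C R :: real
  assumes M: "\<And>n. 1 \<le> M n" and LC: "0 \<le> L" "0 \<le> C" "0 < R"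
    and growth: "(\<lambda>n. 1 / sqrt (real (K n)) * exp (2 * R * L * real (M n) powr C) * real (M n) powr (14 + 5 * C)) \<longlonglongrightarrow> 0"
    and K: "\<And>n. 1 \<le> K n" and N: "\<forall>\<^sub>F n in sequentially. real (K n) / 2 \<le> N n"
    and exps: "j \<le> 2" "i \<le> 7" "k \<le> (5::nat)"
  shows "(\<lambda>n. exp (j * R * (L * real (M n) powr C)) * ((real (M n))\<^sup>2) ^ i * (L * real (M n) powr C) ^ k / sqrt (N n)) \<longlonglongrightarrow> 0"
proof (rule Lim_null_comparison)
  let ?r = "\<lambda>n. 1 / sqrt (real (K n)) * exp (2 * R * L * real (M n) powr C) * real (M n) powr (14 + 5 * C)"
  show "(\<lambda>n. L ^ k * sqrt 2 * ?r n) \<longlonglongrightarrow> 0"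
    using tendsto_mult[OF tendsto_const growth, of "L ^ k * sqrt 2"] by simp
  show "\<forall>\<^sub>F n in sequentially. norm (exp (j * R * (L * real (M n) powr C)) * ((real (M n))\<^sup>2) ^ i * (L * real (M n) powr C) ^ k / sqrt (N n))
      \<le> L ^ k * sqrt 2 * ?r n"
    using N
  proof eventually_elim
    case (elim n)
    let ?M = "real (M n)"
    have M1: "1 \<le> ?M" using M[of n] by simp
    have e1: "exp (j * R * (L * ?M powr C)) \<le> exp (2 * R * L * ?M powr C)"
      using exps(1) LC by (auto simp: mult.assoc intro!: mult_right_mono)
    have e2: "(?M\<^sup>2) ^ i * (L * ?M powr C) ^ k \<le> L ^ k * ?M powr (14 + 5 * C)"
    proof -
      have M0: "0 < ?M" "0 < ?M powr C" using M1 by auto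
      have "(?M\<^sup>2) ^ i = ?M powr (2 * real i)"
        using powr_realpow[OF M0(1), of "2 * i"] by (simp add: power_mult)
      moreover have "(L * ?M powr C) ^ k = L ^ k * ?M powr (C * real k)"
        using powr_realpow[OF M0(2), of k] by (simp add: power_mult_distrib powr_powr)
      ultimately have "(?M\<^sup>2) ^ i * (L * ?M powr C) ^ k = L ^ k * ?M powr (2 * real i + C * real k)"
        by (simp add: powr_add)
      also have "\<dots> \<le> L ^ k * ?M powr (14 + 5 * C)"
      proof (intro mult_left_mono powr_mono M1)
        have "C * real k \<le> C * 5" using exps(3) LC by (intro mult_left_mono) auto
        then show "2 * real i + C * real k \<le> 14 + 5 * C" using exps(2) by simp
      qed (use LC in simp)
      finally show ?thesis .
    qed
    have e3: "exp (j * R * (L * ?M powr C)) * ((?M\<^sup>2) ^ i * (L * ?M powr C) ^ k)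
      \<le> exp (2 * R * L * ?M powr C) * (L ^ k * ?M powr (14 + 5 * C))"
      by (rule mult_mono[OF e1 e2]) (use LC in auto)
    have e4: "1 / sqrt (N n) \<le> sqrt 2 / sqrt (real (K n))"
    proof -
      have "sqrt (real (K n) / 2) \<le> sqrt (N n)" using elim by simp
      moreover have "0 < sqrt (real (K n) / 2)" using K[of n] by simp
      ultimately have "1 / sqrt (N n) \<le> 1 / sqrt (real (K n) / 2)" by (intro divide_left_mono mult_pos_pos) auto
      then show ?thesis by (simp add: real_sqrt_divide)
    qed
    have "0 < N n" using elim K[of n] by simp
    then have "exp (j * R * (L * ?M powr C)) * ((?M\<^sup>2) ^ i * (L * ?M powr C) ^ k) * (1 / sqrt (N n))
      \<le> exp (2 * R * L * ?M powr C) * (L ^ k * ?M powr (14 + 5 * C)) * (sqrt 2 / sqrt (real (K n)))"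
      by (intro mult_mono[OF e3 e4]) (use LC in auto)
    then show ?case using LC \<open>0 < N n\<close> by (simp add: abs_mult mult_ac)
  qed
qed

text \<open>
  The exponential and the power of \<open>M\<close> are at least one, so \<open>1 / sqrt K < 1\<close> eventually.
\<close>

lemma growth_imp_blocks_at_top:
  fixes K M :: "nat \<Rightarrow> nat" and L C R :: real
  assumes M: "\<And>n. 1 \<le> M n" and LC: "0 \<le> L" "0 \<le> C" "0 < R"
    and growth: "(\<lambda>n. 1 / sqrt (real (K n)) * exp (2 * R * L * real (M n) powr C) * real (M n) powr (14 + 5 * C)) \<longlonglongrightarrow> 0"
    and K: "\<And>n. 1 \<le> K n"
  shows "\<forall>\<^sub>F n in sequentially. 2 \<le> K n"
proof -
  have "\<forall>\<^sub>F n in sequentially. 1 / sqrt (real (K n)) * exp (2 * R * L * real (M n) powr C) * real (M n) powr (14 + 5 * C) < 1"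
    using growth by (rule order_tendstoD) simp
  then show ?thesis
  proof eventually_elim
    case (elim n)
    have "1 * 1 \<le> exp (2 * R * L * real (M n) powr C) * real (M n) powr (14 + 5 * C)"
      using M[of n] LC by (intro mult_mono ge_one_powr_ge_zero) auto
    then have "1 / sqrt (real (K n)) * 1 \<le> 1 / sqrt (real (K n)) * (exp (2 * R * L * real (M n) powr C) * real (M n) powr (14 + 5 * C))"
      by (intro mult_left_mono) auto
    with elim have "1 / sqrt (real (K n)) < 1" by (simp add: mult.assoc)
    then have "K n \<noteq> 1" by auto
    with K[of n] show ?case by linarith
  qed
qed

lemma card_within_pairs: "card (within_pairs K) = K"
proof -
  have "within_pairs K = (\<lambda>k. (k, k)) ` {1..K}" by (auto simp: within_pairs_def)
  then show ?thesis by (simp add: card_image inj_on_def)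
qed

text \<open>
  The \<open>K - 1\<close> pairs of consecutive blocks suffice.
\<close>

lemma card_between_pairs_ge:
  assumes "2 \<le> K"
  shows "real K / 2 \<le> real (card (between_pairs K))"
proof -
  have "(\<lambda>k. (k, Suc k)) ` {1..<K} \<subseteq> between_pairs K" by (auto simp: between_pairs_def)
  from card_mono[OF finite_block_pairs(3) this] have "K - 1 \<le> card (between_pairs K)"
    by (simp add: card_image inj_on_def)
  with assms show ?thesis by linarith
qed

text \<open>
  The within-block and the between-block statements are the instances for two families \<open>I\<close> of block pairs.  What
  matters about \<open>I\<close> is that it has at least of the order of \<open>K\<close> members and that \<open>\<beta>\<close> and \<open>s\<close> are the parameter and the
  statistics in the weights of its subgraphs.
\<close>

theorem lergm_stein_estimator_normal:
  fixes P :: "nat \<Rightarrow> 'w measure" and X :: "nat \<Rightarrow> 'w \<Rightarrow> 'v graph" and s :: "nat \<Rightarrow> ('v, 'd::finite) statistics"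
    and sW :: "nat \<Rightarrow> ('v, 'd1::finite) statistics" and sB :: "nat \<Rightarrow> ('v, 'd2::finite) statistics"
  assumes prob: "\<And>n. prob_space (P n)"
    and lergm: "\<And>n. is_lergm (P n) (X n) (A n) (K n) (sW n) (sB n) \<beta>W \<beta>B"
    and K: "\<And>n. 1 \<le> K n"
    and blocks: "\<And>n k. k \<in> {1..K n} \<Longrightarrow> finite (A n k) \<and> A n k \<noteq> {} \<and> card (A n k) \<le> M n"
    and I: "\<And>n. I n \<subseteq> block_pairs (K n)" and card_I: "\<forall>\<^sub>F n in sequentially. real (K n) / 2 \<le> real (card (I n))"
    and weight: "\<And>n p y. p \<in> I n \<Longrightarrow> subgraph_weight (sW n) (sB n) \<beta>W \<beta>B p y = exp (\<beta> \<bullet> s n p y)"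
    and R: "R > 0" "\<beta> \<in> interior (cball 0 R)"
    and A2: "L \<ge> 0" "C \<ge> 0" "\<And>n p x m. p \<in> I n \<Longrightarrow> x \<in> configs (edges (A n) p) \<Longrightarrow> m \<in> edges (A n) p \<Longrightarrow>
         norm (edge_diff m (s n p) x) \<le> L * real (M n) powr C"
    and A3: "\<xi> > 0" "\<And>n. edge_diff_min_eigen (P n) (X n) (I n) (A n) (s n) \<ge> ereal \<xi>"
    and A4: "\<zeta> > 0" "\<And>n. Upsilon (P n) (X n) (I n) (A n) (s n) \<beta> \<ge> ereal \<zeta>"
    and estimator: "\<And>n. is_stein_estimator (I n) (A n) (K n) (s n) R (b n)"
    and A5: "converges_in_probability P (\<lambda>n \<omega>. inv_sqrt_matrix (g_cov (P n) (X n) (I n) (A n) (s n) \<beta>) *v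
            stein_g (I n) (A n) (s n) (X n \<omega>) (b n (X n \<omega>))) 0"
    and growth: "(\<lambda>n. 1 / sqrt (real (K n)) * exp (2 * R * L * real (M n) powr C) * real (M n) powr (14 + 5 * C)) \<longlonglongrightarrow> 0"
  shows "converges_in_distribution P
           (\<lambda>n \<omega>. Q_matrix (P n) (X n) (I n) (A n) (s n) \<beta> *v (b n (X n \<omega>) - \<beta>)) std_normal_vector"
proof -
  define D where "D n = L * real (M n) powr C" for n
  define a where "a n = (real (M n))\<^sup>2" for n
  have finA: "finite (A n k)" if "k \<in> {1..K n}" for n k using blocks[OF that] by blast
  have M: "1 \<le> M n" for n
  proof -
    have "1 \<in> {1..K n}" using K[of n] by simp
    from blocks[OF this] have "0 < card (A n 1)" "card (A n 1) \<le> M n" by (auto simp: card_gt_0_iff)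
    then show ?thesis by linarith
  qed
  have X: "X n \<in> P n \<rightarrow>\<^sub>M count_space UNIV" for n
    by (rule lergm_measurable[OF _ lergm]) (rule finA)
  have inG: "X n \<omega> \<in> graphs (A n) (K n)" if "\<omega> \<in> space (P n)" for n \<omega>
    by (rule lergm_in_graphs[OF _ lergm that]) (rule finA)
  have model: "stein_model (P n) (X n) (I n) (A n) (s n) \<beta> (b n) R (D n) (a n) \<xi> \<zeta>" if "I n \<noteq> {}" for n
  proof (intro stein_model.intro stein_model_axioms.intro prob X that A3(1) A4(1))
    show "finite (I n)" by (rule finite_subset[OF I finite_block_pairs(1)])
    have "prob_space.indep_vars (P n) (\<lambda>_. count_space UNIV) (\<lambda>p \<omega>. X n \<omega> p) (block_pairs (K n))"
      by (rule lergm_indep[OF _ prob lergm K]) (rule finA)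
    then show "prob_space.indep_vars (P n) (\<lambda>_. count_space UNIV) (\<lambda>p \<omega>. X n \<omega> p) (I n)"
      by (rule prob_space.indep_vars_subset[OF prob _ I])
    show "0 \<le> D n" using A2 by (simp add: D_def)
    show "norm \<beta> \<le> R" using R(2) interior_subset[of "cball 0 R"] by auto
    fix p assume p: "p \<in> I n"
    then have pb: "p \<in> block_pairs (K n)" using I by blast
    show "(\<integral>\<omega>. stein_h (edges (A n) p) (s n p) (X n \<omega> p) \<beta> \<partial>P n) = 0"
      by (rule lergm_stein_h_centered[OF _ lergm pb]) (rule finA, assumption, rule weight[OF p])
    show "real (card (edges (A n) p)) \<le> a n"
    proof -
      obtain k l where kl: "p = (k, l)" "k \<in> {1..K n}" "l \<in> {1..K n}" using pb by (auto simp: block_pairs_def)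
      have "card (edges (A n) p) \<le> card (A n k) * card (A n l)"
        unfolding kl(1) by (intro finite_card_edges finA kl)
      also have "\<dots> \<le> M n * M n" using blocks kl by (intro mult_le_mono) auto
      finally show ?thesis by (simp add: a_def power2_eq_square del: of_nat_mult flip: of_nat_mult)
    qed
    show "\<xi> \<le> lambda_min (\<Sum>m\<in>edges (A n) p. \<integral>\<omega>. outer (edge_diff m (s n p) (X n \<omega> p)) (edge_diff m (s n p) (X n \<omega> p)) \<partial>P n)"
      using order_trans[OF A3(2)[of n, unfolded edge_diff_min_eigen_def] INF_lower[OF p]] by simp
    show "\<zeta> \<le> lambda_min (\<integral>\<omega>. outer (stein_h (edges (A n) p) (s n p) (X n \<omega> p) \<beta>) (stein_h (edges (A n) p) (s n p) (X n \<omega> p) \<beta>) \<partial>P n)"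
      using order_trans[OF A4(2)[of n, unfolded Upsilon_def] INF_lower[OF p]] by simp
    show "X n \<omega> p \<in> configs (edges (A n) p)" if "\<omega> \<in> space (P n)" for \<omega>
      using inG[OF that] pb by (auto simp: graphs_def)
    show "norm (edge_diff m (s n p) x) \<le> D n" if "x \<in> configs (edges (A n) p)" "m \<in> edges (A n) p" for x m
      unfolding D_def by (rule A2(3)[OF p that])
  next
    show "norm (b n (X n \<omega>)) \<le> R" if "\<omega> \<in> space (P n)" for \<omega>
      using estimator[of n] inG[OF that] by (auto simp: is_stein_estimator_def is_arg_min_def)
  qed
  have "\<forall>\<^sub>F n in sequentially. stein_model (P n) (X n) (I n) (A n) (s n) \<beta> (b n) R (D n) (a n) \<xi> \<zeta>"
    using card_I
  proof eventually_elim
    case (elim n)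
    then have "card (I n) \<noteq> 0" using K[of n] by auto
    then show ?case by (intro model) auto
  qed
  note normal = stein_estimator_asymptotically_normal[OF prob X this A5]
  note rate = growth_tendsto[OF M A2(1,2) R(1) growth K card_I, folded D_def a_def]
  show ?thesis
  proof (rule normal)
    show "(\<lambda>n. a n * D n / sqrt (real (card (I n)))) \<longlonglongrightarrow> 0" using rate[of 0 1 1] by simp
    show "(\<lambda>n. a n * (D n)\<^sup>2 / sqrt (real (card (I n)))) \<longlonglongrightarrow> 0" using rate[of 0 1 2] by simp
    show "(\<lambda>n. exp (R * D n) * (a n)\<^sup>2 * D n ^ 3 / sqrt (real (card (I n)))) \<longlonglongrightarrow> 0" using rate[of 1 2 3] by simp
    show "(\<lambda>n. exp (2 * R * D n) * a n ^ 3 * D n ^ 5 / sqrt (real (card (I n)))) \<longlonglongrightarrow> 0" using rate[of 2 3 5] by simp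
  qed
qed

theorem theorem4p19:
  fixes P :: "nat \<Rightarrow> 'w measure"
    and X :: "nat \<Rightarrow> 'w \<Rightarrow> 'v graph"
    and V :: "nat \<Rightarrow> 'v set"
    and K :: "nat \<Rightarrow> nat"
    and A :: "nat \<Rightarrow> nat \<Rightarrow> 'v set"
    and sW :: "nat \<Rightarrow> ('v, 'd1::finite) statistics"
    and sB :: "nat \<Rightarrow> ('v, 'd2::finite) statistics"
    and \<beta>W :: "real ^ 'd1" and \<beta>B :: "real ^ 'd2"
    and bW :: "nat \<Rightarrow> 'v graph \<Rightarrow> real ^ 'd1"
    and bB :: "nat \<Rightarrow> 'v graph \<Rightarrow> real ^ 'd2"
    and M :: "nat \<Rightarrow> nat"
    and RW RB LW LB CW CB \<xi>W \<xi>B \<zeta>W \<zeta>B :: real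
  assumes finite_vertices: "\<And>n. finite (V n)"
    and blocks: "\<And>n. 1 \<le> K n" "\<And>n. inj_on (A n) {1..K n}"
      "\<And>n. partition_on (V n) (A n ` {1..K n})"
    and M: "\<And>n. M n = max_block_size (A n) (K n)"
    and prob: "\<And>n. prob_space (P n)"
    and lergm: "\<And>n. is_lergm (P n) (X n) (A n) (K n) (sW n) (sB n) \<beta>W \<beta>B"
    and A1: "RW > 0" "RB > 0" "\<beta>W \<in> interior (cball 0 RW)" "\<beta>B \<in> interior (cball 0 RB)"
    and A2: "LW \<ge> 0" "LB \<ge> 0" "CW \<ge> 0" "CB \<ge> 0"
      "\<And>n p x m. p \<in> within_pairs (K n) \<Longrightarrow> x \<in> configs (edges (A n) p) \<Longrightarrow> m \<in> edges (A n) p \<Longrightarrow>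
         norm (edge_diff m (sW n p) x) \<le> LW * real (M n) powr CW"
      "\<And>n p x m. p \<in> between_pairs (K n) \<Longrightarrow> x \<in> configs (edges (A n) p) \<Longrightarrow> m \<in> edges (A n) p \<Longrightarrow>
         norm (edge_diff m (sB n p) x) \<le> LB * real (M n) powr CB"
    and A3: "\<xi>W > 0" "\<xi>B > 0"
      "\<And>n. edge_diff_min_eigen (P n) (X n) (within_pairs (K n)) (A n) (sW n) \<ge> ereal \<xi>W"
      "\<And>n. edge_diff_min_eigen (P n) (X n) (between_pairs (K n)) (A n) (sB n) \<ge> ereal \<xi>B"
    and A4: "\<zeta>W > 0" "\<zeta>B > 0"
      "\<And>n. Upsilon (P n) (X n) (within_pairs (K n)) (A n) (sW n) \<beta>W \<ge> ereal \<zeta>W"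
      "\<And>n. Upsilon (P n) (X n) (between_pairs (K n)) (A n) (sB n) \<beta>B \<ge> ereal \<zeta>B"
    and estimator:
      "\<And>n. is_stein_estimator (within_pairs (K n)) (A n) (K n) (sW n) RW (bW n)"
      "\<And>n. is_stein_estimator (between_pairs (K n)) (A n) (K n) (sB n) RB (bB n)"
    and A5:
      "converges_in_probability P
         (\<lambda>n \<omega>. inv_sqrt_matrix (g_cov (P n) (X n) (within_pairs (K n)) (A n) (sW n) \<beta>W) *v
            stein_g (within_pairs (K n)) (A n) (sW n) (X n \<omega>) (bW n (X n \<omega>))) 0"
      "converges_in_probability P
         (\<lambda>n \<omega>. inv_sqrt_matrix (g_cov (P n) (X n) (between_pairs (K n)) (A n) (sB n) \<beta>B) *v
            stein_g (between_pairs (K n)) (A n) (sB n) (X n \<omega>) (bB n (X n \<omega>))) 0"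
    and growth:
      "(\<lambda>n. 1 / sqrt (real (K n)) * exp (2 * RW * LW * real (M n) powr CW) * real (M n) powr (14 + 5 * CW)) \<longlonglongrightarrow> 0"
      "(\<lambda>n. 1 / sqrt (real (K n)) * exp (2 * RB * LB * real (M n) powr CB) * real (M n) powr (14 + 5 * CB)) \<longlonglongrightarrow> 0"
  shows "converges_in_distribution P
           (\<lambda>n \<omega>. Q_matrix (P n) (X n) (within_pairs (K n)) (A n) (sW n) \<beta>W *v
              (bW n (X n \<omega>) - \<beta>W)) std_normal_vector \<and>
         converges_in_distribution P
           (\<lambda>n \<omega>. Q_matrix (P n) (X n) (between_pairs (K n)) (A n) (sB n) \<beta>B *v
              (bB n (X n \<omega>) - \<beta>B)) std_normal_vector"
proof -
  have block: "finite (A n k) \<and> A n k \<noteq> {} \<and> card (A n k) \<le> M n" if k: "k \<in> {1..K n}" for n k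
  proof (intro conjI)
    have "A n k \<subseteq> V n" "A n k \<noteq> {}"
      using blocks(3)[of n] k by (auto simp: partition_on_def)
    then show "finite (A n k)" "A n k \<noteq> {}" using finite_subset finite_vertices by auto
    show "card (A n k) \<le> M n" unfolding M max_block_size_def using k by (intro Max_ge) auto
  qed
  have M1: "1 \<le> M n" for n
  proof -
    have "1 \<in> {1..K n}" using blocks(1)[of n] by simp
    from block[OF this] have "0 < card (A n 1)" "card (A n 1) \<le> M n" by (auto simp: card_gt_0_iff)
    then show ?thesis by linarith
  qed
  have within: "\<forall>\<^sub>F n in sequentially. real (K n) / 2 \<le> real (card (within_pairs (K n)))"
    by (simp add: card_within_pairs)
  have between: "\<forall>\<^sub>F n in sequentially. real (K n) / 2 \<le> real (card (between_pairs (K n)))"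
    using growth_imp_blocks_at_top[OF M1 A2(1,3) A1(1) growth(1) blocks(1)]
    by eventually_elim (rule card_between_pairs_ge)
  show ?thesis
  proof (intro conjI)
    show "converges_in_distribution P
           (\<lambda>n \<omega>. Q_matrix (P n) (X n) (within_pairs (K n)) (A n) (sW n) \<beta>W *v
              (bW n (X n \<omega>) - \<beta>W)) std_normal_vector"
      by (rule lergm_stein_estimator_normal[OF prob lergm blocks(1) block _ within _ A1(1,3) A2(1,3,5) A3(1,3) A4(1,3)
            estimator(1) A5(1) growth(1)])
        (auto simp: block_pairs_split subgraph_weight_def within_pairs_def[of "K _"])
    show "converges_in_distribution P
           (\<lambda>n \<omega>. Q_matrix (P n) (X n) (between_pairs (K n)) (A n) (sB n) \<beta>B *v
              (bB n (X n \<omega>) - \<beta>B)) std_normal_vector"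
      by (rule lergm_stein_estimator_normal[OF prob lergm blocks(1) block _ between _ A1(2,4) A2(2,4,6) A3(2,4) A4(2,4)
            estimator(2) A5(2) growth(2)])
        (auto simp: block_pairs_split subgraph_weight_def between_pairs_def[of "K _"])
  qed
qed

end
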